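(* There is a holomorphic family of compact complex manifolds $\{X_{\mathbf t}\}_{\mathbf t\in\Delta}$ of complex dimension $3$, where $\Delta=\{\mathbf t\in\mathbb C \mid |\mathbf t|<1\}$, such that: (i) $X_0$ is a pseudo-Kähler manifold; (ii) $X_{\mathbf t}$ does not admit pseudo-Kähler metrics for any $\mathbf t\neq 0$. Hence, the pseudo-Kähler property is not stable under deformations of the complex structure.
   Context: A pseudo-Kähler structure (pseudo-Kähler metric) on a complex manifold $X=(M,J)$ is a smooth real closed non-degenerate $2$-form $F$ (a symplectic form) with $F(JU,JV)=F(U,V)$ for all vector fields $U,V$, i.e. $F$ is of bidegree $(1,1)$; the associated pseudo-Riemannian metric is $g(U,V)=F(JU,V)$, of arbitrary (possibly definite) signature. $X$ is called a pseudo-Kähler manifold if it admits such an $F$. A holomorphic family of compact complex manifolds is a proper holomorphic submersion $\pi:\mathcal X\to\Delta$ between complex manifolds, with $X_{\mathbf t}=\pi^{-1}(\mathbf t)$. A property is stable under deformations if, whenever a compact complex manifold $X$ has it, for every holomorphic family with $X_0=X$ the fibre $X_{\mathbf t}$ has it for all $\mathbf t$ sufficiently close to $0$. *)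

theory Defs
  imports "HOL-Analysis.Analysis"
begin

section \<open>Complex manifolds\<close>

text \<open>A chart is a domain together with a coordinate map; the values of the coordinate map
  outside the domain are irrelevant.\<close>

type_synonym ('a, 'n) chart = "'a set \<times> ('a \<Rightarrow> complex ^ 'n)"

definition chart_inv :: "('a, 'n::finite) chart \<Rightarrow> complex ^ 'n \<Rightarrow> 'a" where
  "chart_inv c = inv_into (fst c) (snd c)"

definition is_chart :: "'a topology \<Rightarrow> ('a, 'n::finite) chart \<Rightarrow> bool" where
  "is_chart T c \<longleftrightarrow>
     openin T (fst c) \<and> open (snd c ` fst c) \<and>
     homeomorphic_map (subtopology T (fst c)) (top_of_set (snd c ` fst c)) (snd c)"

text \<open>Holomorphy in several variables is complex Frechet differentiability: the real derivative
  exists and is complex linear. Only used on open sets.\<close>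

definition holomorphic_map_on :: "(complex ^ 'n::finite) set \<Rightarrow> (complex ^ 'n \<Rightarrow> complex ^ 'm::finite) \<Rightarrow> bool" where
  "holomorphic_map_on S f \<longleftrightarrow>
     (\<forall>z\<in>S. \<exists>D. (f has_derivative D) (at z) \<and> (\<forall>(a::complex) v. D (a *s v) = a *s D v))"

definition holomorphic_immersion_on :: "(complex ^ 'n::finite) set \<Rightarrow> (complex ^ 'n \<Rightarrow> complex ^ 'm::finite) \<Rightarrow> bool" where
  "holomorphic_immersion_on S f \<longleftrightarrow>
     (\<forall>z\<in>S. \<exists>D. (f has_derivative D) (at z) \<and> (\<forall>(a::complex) v. D (a *s v) = a *s D v) \<and> inj D)"

definition holomorphic_submersion_on :: "(complex ^ 'n::finite) set \<Rightarrow> (complex ^ 'n \<Rightarrow> complex) \<Rightarrow> bool" where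
  "holomorphic_submersion_on S f \<longleftrightarrow>
     (\<forall>z\<in>S. \<exists>D. (f has_derivative D) (at z) \<and> (\<forall>(a::complex) v. D (a *s v) = a * D v) \<and> surj D)"

definition holomorphically_compatible :: "('a, 'n::finite) chart \<Rightarrow> ('a, 'n) chart \<Rightarrow> bool" where
  "holomorphically_compatible c d \<longleftrightarrow>
     holomorphic_map_on (snd c ` (fst c \<inter> fst d)) (snd d \<circ> chart_inv c) \<and>
     holomorphic_map_on (snd d ` (fst c \<inter> fst d)) (snd c \<circ> chart_inv d)"

record ('a, 'n) cmfd =
  mtop :: "'a topology"
  atlas :: "('a, 'n) chart set"

text \<open>The atlas is required to be maximal, so that equality of structures means: same points,
  same topology, same complex structure. The dimension is the cardinality of the index type
  \<open>'n\<close>. Connectedness is not assumed.\<close>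

definition complex_manifold :: "('a, 'n::finite) cmfd \<Rightarrow> bool" where
  "complex_manifold X \<longleftrightarrow>
     Hausdorff_space (mtop X) \<and> second_countable (mtop X) \<and>
     (\<forall>c\<in>atlas X. is_chart (mtop X) c) \<and>
     (\<Union>c\<in>atlas X. fst c) = topspace (mtop X) \<and>
     (\<forall>c\<in>atlas X. \<forall>d\<in>atlas X. holomorphically_compatible c d) \<and>
     (\<forall>c. is_chart (mtop X) c \<and> (\<forall>d\<in>atlas X. holomorphically_compatible c d) \<longrightarrow> c \<in> atlas X)"

definition compact_complex_manifold :: "('a, 'n::finite) cmfd \<Rightarrow> bool" where
  "compact_complex_manifold X \<longleftrightarrow> complex_manifold X \<and> compact_space (mtop X)"


section \<open>Pseudo-Kaehler structures\<close>

text \<open>On an open set \<open>S\<close> of a Euclidean space, \<open>Ck_on k S f\<close> says that \<open>f\<close> is \<open>k\<close> times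
  continuously differentiable (all iterated directional derivatives exist and are continuous).\<close>

primrec Ck_on :: "nat \<Rightarrow> 'e::euclidean_space set \<Rightarrow> ('e \<Rightarrow> real) \<Rightarrow> bool" where
  "Ck_on 0 S f \<longleftrightarrow> continuous_on S f"
| "Ck_on (Suc k) S f \<longleftrightarrow>
     (\<forall>x\<in>S. f differentiable (at x)) \<and> (\<forall>v. Ck_on k S (\<lambda>x. frechet_derivative f (at x) v))"

definition smooth_on :: "'e::euclidean_space set \<Rightarrow> ('e \<Rightarrow> real) \<Rightarrow> bool" where
  "smooth_on S f \<longleftrightarrow> (\<forall>k. Ck_on k S f)"

text \<open>A field of real bilinear forms on the tangent spaces is given by its local expressions:
  \<open>F c p u v\<close> is its value at the point \<open>p\<close> on the tangent vectors with coordinates \<open>u\<close> and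
  \<open>v\<close> in the chart \<open>c\<close>. Only charts \<open>c\<close> of the atlas and points \<open>p\<close> of their domains matter.\<close>

type_synonym ('a, 'n) tensor2 =
  "('a, 'n) chart \<Rightarrow> 'a \<Rightarrow> complex ^ 'n \<Rightarrow> complex ^ 'n \<Rightarrow> real"

definition coord_change :: "('a, 'n::finite) chart \<Rightarrow> ('a, 'n) chart \<Rightarrow> 'a \<Rightarrow> complex ^ 'n \<Rightarrow> complex ^ 'n" where
  "coord_change c d p = frechet_derivative (snd d \<circ> chart_inv c) (at (snd c p))"

definition coeff_fun :: "('a, 'n::finite) tensor2 \<Rightarrow> ('a, 'n) chart \<Rightarrow> complex ^ 'n \<Rightarrow> complex ^ 'n \<Rightarrow> complex ^ 'n \<Rightarrow> real" where
  "coeff_fun F c u v z = F c (chart_inv c z) u v"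

definition smooth_two_form :: "('a, 'n::finite) cmfd \<Rightarrow> ('a, 'n) tensor2 \<Rightarrow> bool" where
  "smooth_two_form X F \<longleftrightarrow>
     (\<forall>c\<in>atlas X. \<forall>p\<in>fst c. bilinear (F c p) \<and> (\<forall>u. F c p u u = 0)) \<and>
     (\<forall>c\<in>atlas X. \<forall>d\<in>atlas X. \<forall>p\<in>fst c \<inter> fst d. \<forall>u v.
        F c p u v = F d p (coord_change c d p u) (coord_change c d p v)) \<and>
     (\<forall>c\<in>atlas X. \<forall>u v. smooth_on (snd c ` fst c) (coeff_fun F c u v))"

text \<open>\<open>dF(u,v,w) = u(F(v,w)) - v(F(u,w)) + w(F(u,v))\<close> for coordinate fields \<open>u, v, w\<close>
  with constant coefficients, whose brackets vanish.\<close>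

definition closed_two_form :: "('a, 'n::finite) cmfd \<Rightarrow> ('a, 'n) tensor2 \<Rightarrow> bool" where
  "closed_two_form X F \<longleftrightarrow>
     (\<forall>c\<in>atlas X. \<forall>z\<in>snd c ` fst c. \<forall>u v w.
        frechet_derivative (coeff_fun F c v w) (at z) u
        - frechet_derivative (coeff_fun F c u w) (at z) v
        + frechet_derivative (coeff_fun F c u v) (at z) w = 0)"

definition nondegenerate_form :: "('a, 'n::finite) cmfd \<Rightarrow> ('a, 'n) tensor2 \<Rightarrow> bool" where
  "nondegenerate_form X F \<longleftrightarrow>
     (\<forall>c\<in>atlas X. \<forall>p\<in>fst c. \<forall>u. u \<noteq> 0 \<longrightarrow> (\<exists>v. F c p u v \<noteq> 0))"

text \<open>In holomorphic coordinates \<open>J\<close> is multiplication by the imaginary unit.\<close>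

definition J_invariant_form :: "('a, 'n::finite) cmfd \<Rightarrow> ('a, 'n) tensor2 \<Rightarrow> bool" where
  "J_invariant_form X F \<longleftrightarrow>
     (\<forall>c\<in>atlas X. \<forall>p\<in>fst c. \<forall>u v. F c p (\<i> *s u) (\<i> *s v) = F c p u v)"

definition pseudo_kaehler_structure :: "('a, 'n::finite) cmfd \<Rightarrow> ('a, 'n) tensor2 \<Rightarrow> bool" where
  "pseudo_kaehler_structure X F \<longleftrightarrow>
     smooth_two_form X F \<and> closed_two_form X F \<and> nondegenerate_form X F \<and> J_invariant_form X F"

definition admits_pseudo_kaehler :: "('a, 'n::finite) cmfd \<Rightarrow> bool" where
  "admits_pseudo_kaehler X \<longleftrightarrow> (\<exists>F. pseudo_kaehler_structure X F)"


section \<open>Holomorphic families over the unit disc\<close>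

abbreviation unit_disc :: "complex set" where
  "unit_disc \<equiv> {t. norm t < 1}"

text \<open>\<open>complex ^ ('n + 1)\<close> has dimension one more than \<open>complex ^ 'n\<close>.\<close>

definition holomorphic_family :: "('a, 'n::finite + 1) cmfd \<Rightarrow> ('a \<Rightarrow> complex) \<Rightarrow> bool" where
  "holomorphic_family X \<pi> \<longleftrightarrow>
     complex_manifold X \<and>
     continuous_map (mtop X) (top_of_set unit_disc) \<pi> \<and>
     proper_map (mtop X) (top_of_set unit_disc) \<pi> \<and>
     (\<forall>c\<in>atlas X. holomorphic_submersion_on (snd c ` fst c) (\<pi> \<circ> chart_inv c))"

text \<open>The fibre over \<open>t\<close>, with the subspace topology and the complex structure of a closed
  submanifold: its charts are those charts of the subspace in which the inclusion into the
  total space is a holomorphic immersion.\<close>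

definition fibre :: "('a, 'n::finite + 1) cmfd \<Rightarrow> ('a \<Rightarrow> complex) \<Rightarrow> complex \<Rightarrow> ('a, 'n) cmfd" where
  "fibre X \<pi> t =
     (let T = subtopology (mtop X) {x \<in> topspace (mtop X). \<pi> x = t}
      in \<lparr> mtop = T,
           atlas = {c. is_chart T c \<and>
             (\<forall>d\<in>atlas X. holomorphic_immersion_on (snd c ` (fst c \<inter> fst d)) (snd d \<circ> chart_inv c))} \<rparr>)"

definition stable_under_deformations :: "(('a, 'n::finite) cmfd \<Rightarrow> bool) \<Rightarrow> bool" where
  "stable_under_deformations P \<longleftrightarrow>
     (\<forall>X0. compact_complex_manifold X0 \<and> P X0 \<longrightarrow>
        (\<forall>X \<pi>. holomorphic_family X \<pi> \<and> fibre X \<pi> 0 = X0 \<longrightarrow>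
           (\<forall>\<^sub>F t in nhds 0. P (fibre X \<pi> t))))"

text \<open>HOL cannot quantify over the type of points inside a formula, so a universe is fixed. It
  has at least the cardinality of the continuum, hence contains an isomorphic copy of every
  (Hausdorff, second countable) complex manifold.\<close>

type_synonym point = "(complex ^ (3 + 1)) set"

end

theory Submission
  imports Defs "HOL-Complex_Analysis.Complex_Analysis"
begin

text \<open>
  Let the Heisenberg-type group of triples \<open>(a, b, c)\<close> of Gaussian integers act on the product of
  \<open>\<complex>\<^sup>3\<close> and the disc by
  \<open>(w\<^sub>1, w\<^sub>2, w\<^sub>3, t) \<mapsto> (w\<^sub>1 + a, w\<^sub>2 + b + t * cnj b, w\<^sub>3 + c + cnj b * w\<^sub>1, t)\<close>.
  For fixed \<open>t\<close> this is the Iwasawa manifold as a smooth manifold, with a complex structure that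
  moves with \<open>t\<close>. The action is holomorphic in all four variables, free and properly
  discontinuous, and every fibre has a compact fundamental domain, so the quotient is a holomorphic
  family over the disc (\<open>heis_holomorphic_family\<close>, \<open>heis_fibre_compact\<close>).

  Put \<open>\<omega>\<^sub>1 = dw\<^sub>1\<close>, \<open>\<omega>\<^sub>2 = dw\<^sub>2\<close>, \<open>\<omega>\<^sub>3 = dw\<^sub>3 - cnj z\<^sub>2 dw\<^sub>1\<close> with \<open>w\<^sub>2 = z\<^sub>2 + t * cnj z\<^sub>2\<close>.
  At \<open>t = 0\<close> one has \<open>d\<omega>\<^sub>3 = \<omega>\<^sub>1 \<and> cnj \<omega>\<^sub>2\<close>, so that \<open>\<omega>\<^sub>2 \<and> cnj \<omega>\<^sub>3\<close> is closed, and its real part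
  plus a multiple of \<open>\<i> \<omega>\<^sub>1 \<and> cnj \<omega>\<^sub>1\<close> is a pseudo-Kaehler form (\<open>X_fib_0_pseudo_kaehler\<close>).
  The model form is this one, written out in coordinates. For \<open>t \<noteq> 0\<close> the differential of \<open>\<omega>\<^sub>3\<close>
  acquires a part of type (2,0), and no closed form of type (1,1) can pair the direction of \<open>w\<^sub>3\<close>
  with anything, up to exact forms.

  To turn this into a proof for arbitrary smooth forms, lift a pseudo-Kaehler form of a fibre to
  \<open>\<complex>\<^sup>3\<close>. It becomes a Hermitian matrix of functions \<open>H j k\<close> with \<open>\<partial>\<^sub>i H j k = \<partial>\<^sub>j H i k\<close>, equivariant
  under the group, whose determinant has no zero (\<open>pseudo_kaehler_gives_kaehler_matrix\<close>).
  Integrating over a fundamental domain is an iteration of one-dimensional averages along lattice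
  vectors, and such an average kills the derivative of a periodic function, which is Stokes' theorem
  in this setting. It implies that replacing \<open>H\<close> by its average \<open>G\<close> over the translations in
  \<open>w\<^sub>3\<close> does not change the mean of the determinant: the difference is the derivative along
  \<open>w\<^sub>3\<close> of another such matrix, hence by closedness it contributes a divergence (\<open>mean_mix_avg\<close>).
  The entries of the last row of \<open>G\<close> are holomorphic up to conjugation, hence constant by Liouville's
  theorem, and comparing periods shows that they vanish when \<open>t \<noteq> 0\<close>
  (\<open>average_vertical_vanishes\<close>). So \<open>det G = 0\<close>, whereas \<open>det H\<close> is real, continuous and without
  zeros, and its mean cannot vanish: a contradiction (\<open>kaehler_matrix_degenerate\<close>).
\<close>

section \<open>Directional derivatives and integrals of translates\<close>

definition dir_deriv :: "'e::real_normed_vector \<Rightarrow> ('e \<Rightarrow> 'b::real_normed_vector) \<Rightarrow> 'e \<Rightarrow> 'b" where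
  "dir_deriv u f x = frechet_derivative f (at x) u"

text \<open>Only finitely many directional derivatives have to be controlled, so continuity of each of them
  is the convenient form of continuous differentiability; it is also the form in which smoothness of
  two-forms is given.\<close>

definition C1_on :: "'e::euclidean_space set \<Rightarrow> ('e \<Rightarrow> 'b::real_normed_vector) \<Rightarrow> bool" where
  "C1_on S f \<longleftrightarrow> (\<forall>x\<in>S. f differentiable (at x)) \<and> (\<forall>u. continuous_on S (dir_deriv u f))"

lemma dir_deriv_eqI: "(f has_derivative D) (at x) \<Longrightarrow> dir_deriv u f x = D u"
  unfolding dir_deriv_def using frechet_derivative_at[of f D x] by simp

lemma has_derivative_dd: "f differentiable (at x) \<Longrightarrow> (f has_derivative (\<lambda>u. dir_deriv u f x)) (at x)"
  unfolding dir_deriv_def frechet_derivative_works by simp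

lemma dir_deriv_linear: "f differentiable (at x) \<Longrightarrow> linear (\<lambda>u. dir_deriv u f x)"
  by (rule has_derivative_linear[OF has_derivative_dd])

lemma dir_deriv_cong: "open S \<Longrightarrow> x \<in> S \<Longrightarrow> (\<And>y. y \<in> S \<Longrightarrow> f y = g y) \<Longrightarrow> dir_deriv u f x = dir_deriv u g x"
proof -
  assume *: "open S" "x \<in> S" "\<And>y. y \<in> S \<Longrightarrow> f y = g y"
  have "(f has_derivative D) (at x) \<longleftrightarrow> (g has_derivative D) (at x)" for D
    using has_derivative_transform_within_open[OF _ *(1,2), where f=f and g=g]
      has_derivative_transform_within_open[OF _ *(1,2), where f=g and g=f] *(3) by auto
  then show ?thesis unfolding dir_deriv_def frechet_derivative_def by presburger
qed

lemma differentiable_cong_open: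
  assumes "open S" "x \<in> S" "\<And>y. y \<in> S \<Longrightarrow> f y = g y"
  shows "f differentiable (at x) \<longleftrightarrow> g differentiable (at x)"
proof -
  have "(f has_derivative D) (at x) \<longleftrightarrow> (g has_derivative D) (at x)" for D
    using has_derivative_transform_within_open[OF _ assms(1,2), where f=f and g=g]
      has_derivative_transform_within_open[OF _ assms(1,2), where f=g and g=f] assms(3) by auto
  then show ?thesis unfolding differentiable_def by simp
qed

lemma C1_on_continuous: "C1_on S f \<Longrightarrow> continuous_on S f"
  unfolding C1_on_def
  by (intro continuous_at_imp_continuous_on ballI differentiable_imp_continuous_within) auto

lemma C1_onI:
  assumes "\<And>x. x \<in> S \<Longrightarrow> (f has_derivative (\<lambda>u. D u x)) (at x)" and "\<And>u. continuous_on S (D u)"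
  shows "C1_on S f"
  unfolding C1_on_def
proof (intro conjI ballI allI)
  fix u
  have "dir_deriv u f x = D u x" if "x \<in> S" for x using dir_deriv_eqI[OF assms(1)[OF that]] .
  then show "continuous_on S (dir_deriv u f)" using assms(2)[of u] by (simp cong: continuous_on_cong)
qed (use assms(1) in \<open>auto simp: differentiable_def\<close>)

lemma C1_on_has_derivative: "C1_on S f \<Longrightarrow> x \<in> S \<Longrightarrow> (f has_derivative (\<lambda>u. dir_deriv u f x)) (at x)"
  unfolding C1_on_def by (simp add: has_derivative_dd)

text \<open>In finite dimension continuity of the derivative as an operator can be tested on basis vectors.
  Differentiation under the integral sign needs the operator version.\<close>

lemma C1_on_blinfun:
  assumes "C1_on S f"
  obtains f' where "\<And>x. x \<in> S \<Longrightarrow> (f has_derivative blinfun_apply (f' x)) (at x)"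
    "\<And>x u. x \<in> S \<Longrightarrow> blinfun_apply (f' x) u = dir_deriv u f x" "continuous_on S f'"
proof -
  let ?f = "\<lambda>x. Blinfun (\<lambda>u. dir_deriv u f x)"
  have a: "blinfun_apply (?f x) = (\<lambda>u. dir_deriv u f x)" if "x \<in> S" for x
    using C1_on_has_derivative[OF assms that] by (simp add: bounded_linear_Blinfun_apply
        has_derivative_bounded_linear)
  have "continuous_on S (\<lambda>x. blinfun_apply (?f x) i)" for i
    using assms a by (subst continuous_on_cong[OF refl, of _ _ "dir_deriv i f"]) (auto simp: C1_on_def)
  then have "continuous_on S ?f" by (intro continuous_on_blinfun_componentwise)
  then show ?thesis using that[of ?f] a C1_on_has_derivative[OF assms] by simp
qed

text \<open>Weighted integrals of translates \<open>f (x + g r)\<close>. They cover the averages along segments as well as the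
  circle integrals of Cauchy's formula, so that both inherit differentiability from one lemma.\<close>

definition shift_int :: "(real \<Rightarrow> complex) \<Rightarrow> (real \<Rightarrow> 'e::euclidean_space) \<Rightarrow> real \<Rightarrow> real \<Rightarrow> ('e \<Rightarrow> complex) \<Rightarrow> 'e \<Rightarrow>
    complex" where
  "shift_int w g a b f x = integral {a..b} (\<lambda>r. w r * f (x + g r))"

lemma shift_int_continuous:
  assumes "continuous_on {a..b} w" "continuous_on {a..b} g"
    and "\<And>x r. x \<in> S \<Longrightarrow> r \<in> {a..b} \<Longrightarrow> x + g r \<in> S'" and "continuous_on S' f"
  shows "continuous_on S (shift_int w g a b f)"
proof -
  have "continuous_on (S \<times> cbox a b) (\<lambda>(x,r). w r * f (x + g r))"
    unfolding split_beta
    by (intro continuous_intros continuous_on_compose2[OF assms(4)] continuous_on_compose2[OF assms(1)]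
       continuous_on_compose2[OF assms(2)]) (use assms(3) in auto)
  from integral_continuous_on_param[OF this] show ?thesis
    unfolding shift_int_def by simp
qed

lemma shift_int_C1:
  fixes f :: "'e::euclidean_space \<Rightarrow> complex"
  assumes w: "continuous_on {a..b} w" and g: "continuous_on {a..b} g" and S: "open S"
    and m: "\<And>x r. x \<in> S \<Longrightarrow> r \<in> {a..b} \<Longrightarrow> x + g r \<in> S'" and f: "C1_on S' f"
  shows "C1_on S (shift_int w g a b f)"
    and "x \<in> S \<Longrightarrow> dir_deriv u (shift_int w g a b f) x = shift_int w g a b (dir_deriv u f) x"
proof -
  obtain f' where f': "\<And>x. x \<in> S' \<Longrightarrow> (f has_derivative blinfun_apply (f' x)) (at x)"
    "\<And>x u. x \<in> S' \<Longrightarrow> blinfun_apply (f' x) u = dir_deriv u f x" "continuous_on S' f'"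
    using C1_on_blinfun[OF f] by metis
  have cf: "continuous_on S' f" using C1_on_continuous[OF f] .
  define F where "F x r = blinfun_mult_right (w r) o\<^sub>L f' (x + g r)" for x r
  have hd: "(shift_int w g a b f has_derivative (\<lambda>u. shift_int w g a b (dir_deriv u f) x)) (at x)" if x: "x \<in> S"
      for x
  proof -
    obtain e where e: "e > 0" "ball x e \<subseteq> S" using S x open_contains_ball by blast
    have c: "continuous_on (ball x e \<times> cbox a b) (\<lambda>(x, t). F x t)"
      unfolding F_def split_beta
      by (intro continuous_intros continuous_on_compose2[OF f'(3)] continuous_on_compose2[OF w]
       continuous_on_compose2[OF g] bounded_linear.continuous_on[OF bounded_linear_blinfun_mult_right]) (use m e
           in auto)
    have "((\<lambda>x. integral (cbox a b) (\<lambda>r. w r * f (x + g r))) has_derivative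
         blinfun_apply (integral (cbox a b) (F x))) (at x within ball x e)"
    proof (rule leibniz_rule[OF _ _ c])
      fix y r assume y: "y \<in> ball x e" "r \<in> cbox a b"
      have "((\<lambda>y. f (y + g r)) has_derivative blinfun_apply (f' (y + g r))) (at y within ball x e)"
        using f'(1)[of "y + g r"] m y e
        by (intro has_derivative_at_withinI[OF has_derivative_compose[where g=f and f="\<lambda>y. y + g r", THEN
            has_derivative_eq_rhs]])
          (auto intro!: derivative_eq_intros)
      then show "((\<lambda>y. w r * f (y + g r)) has_derivative blinfun_apply (F y r)) (at y within ball x e)"
        unfolding F_def
        by (auto intro!: derivative_eq_intros simp: blinfun_mult_right.rep_eq)
    next
      fix y assume y: "y \<in> ball x e"
      show "(\<lambda>r. w r * f (y + g r)) integrable_on cbox a b"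
        by (intro integrable_continuous continuous_intros continuous_on_compose2[OF cf])
          (use w g m y e in auto)
    qed (use e in auto)
    then have h: "((\<lambda>x. integral (cbox a b) (\<lambda>r. w r * f (x + g r))) has_derivative
         blinfun_apply (integral (cbox a b) (F x))) (at x)"
      unfolding at_within_open[OF centre_in_ball[THEN iffD2, OF e(1)] open_ball] .
    have "continuous_on (cbox a b) (\<lambda>r. (\<lambda>(x, t). F x t) (x, r))"
      by (rule continuous_on_compose2[OF c, where f="\<lambda>r. (x, r)"])
        (use e in \<open>auto intro!: continuous_on_Pair continuous_on_const continuous_on_id\<close>)
    then have Fi: "F x integrable_on cbox a b"
      by (intro integrable_continuous) simp
    have "blinfun_apply (integral (cbox a b) (F x)) u = shift_int w g a b (dir_deriv u f) x" for u
      unfolding shift_int_def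
      using m x f'(2) by (subst blinfun_apply_integral[OF Fi]) (auto simp: F_def intro!: integral_cong)
    then have "blinfun_apply (integral (cbox a b) (F x)) = (\<lambda>u. shift_int w g a b (dir_deriv u f) x)"
      by (rule ext)
    then show ?thesis using h unfolding shift_int_def[abs_def] by simp
  qed
  show "C1_on S (shift_int w g a b f)"
    by (rule C1_onI[OF hd]) (use f m in \<open>auto simp: C1_on_def intro: shift_int_continuous[OF w g, of _ S']\<close>)
  show "x \<in> S \<Longrightarrow> dir_deriv u (shift_int w g a b f) x = shift_int w g a b (dir_deriv u f) x"
    by (rule dir_deriv_eqI[OF hd])
qed

lemma dir_deriv_add: "f differentiable (at x) \<Longrightarrow> g differentiable (at x) \<Longrightarrow>
    dir_deriv u (\<lambda>x. f x + g x) x = dir_deriv u f x + dir_deriv u g x"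
  by (intro dir_deriv_eqI has_derivative_add has_derivative_dd)

lemma dir_deriv_mult: fixes f g :: "_ \<Rightarrow> 'b::real_normed_algebra"
  shows "f differentiable (at x) \<Longrightarrow> g differentiable (at x) \<Longrightarrow>
    dir_deriv u (\<lambda>x. f x * g x) x = f x * dir_deriv u g x + dir_deriv u f x * g x"
  by (rule dir_deriv_eqI[where D="\<lambda>u. f x * dir_deriv u g x + dir_deriv u f x * g x"]) (intro
      has_derivative_mult has_derivative_dd)

lemma dir_deriv_bounded_linear: "bounded_linear L \<Longrightarrow> f differentiable (at x) \<Longrightarrow> dir_deriv u (\<lambda>x. L (f x)) x = L
    (dir_deriv u f x)"
  by (rule dir_deriv_eqI[where D="\<lambda>u. L (dir_deriv u f x)"]) (rule bounded_linear.has_derivative[OF _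
      has_derivative_dd])

lemma dir_deriv_const: "dir_deriv u (\<lambda>x. c) x = 0"
  by (rule dir_deriv_eqI[where D="\<lambda>u. 0"]) auto

lemma C1_on_dd_continuous: "C1_on S f \<Longrightarrow> continuous_on S (\<lambda>x. dir_deriv u f x)"
  unfolding C1_on_def by (simp add: eta_contract_eq)

lemma C1_on_differentiable: "C1_on S f \<Longrightarrow> x \<in> S \<Longrightarrow> f differentiable (at x)"
  unfolding C1_on_def by blast

lemma C1_on_add: 
  assumes "C1_on S f" "C1_on S g" shows "C1_on S (\<lambda>x. f x + g x)"
  by (rule C1_onI[where D="\<lambda>u x. dir_deriv u f x + dir_deriv u g x"])
    (auto intro!: continuous_on_add has_derivative_add C1_on_has_derivative C1_on_dd_continuous assms)

lemma C1_on_mult: fixes f g :: "_ \<Rightarrow> 'b::real_normed_algebra"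
  assumes "C1_on S f" "C1_on S g" shows "C1_on S (\<lambda>x. f x * g x)"
proof (rule C1_onI[where D="\<lambda>u x. f x * dir_deriv u g x + dir_deriv u f x * g x"])
  show "((\<lambda>x. f x * g x) has_derivative (\<lambda>u. f x * dir_deriv u g x + dir_deriv u f x * g x)) (at x)" if "x \<in> S"
      for x
    by (rule has_derivative_mult[OF C1_on_has_derivative[OF assms(1) that] C1_on_has_derivative[OF assms(2)
        that]])
  show "continuous_on S (\<lambda>x. f x * dir_deriv u g x + dir_deriv u f x * g x)" for u
    by (rule continuous_on_add[OF continuous_on_mult[OF C1_on_continuous[OF assms(1)] C1_on_dd_continuous[OF
        assms(2)]]
          continuous_on_mult[OF C1_on_dd_continuous[OF assms(1)] C1_on_continuous[OF assms(2)]]])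
qed

lemma C1_on_bounded_linear:
  assumes "bounded_linear L" "C1_on S f" shows "C1_on S (\<lambda>x. L (f x))"
proof (rule C1_onI[where D="\<lambda>u x. L (dir_deriv u f x)"])
  show "((\<lambda>x. L (f x)) has_derivative (\<lambda>u. L (dir_deriv u f x))) (at x)" if "x \<in> S" for x
    by (rule bounded_linear.has_derivative[OF assms(1) C1_on_has_derivative[OF assms(2) that]])
  show "continuous_on S (\<lambda>x. L (dir_deriv u f x))" for u
    by (rule bounded_linear.continuous_on[OF assms(1) C1_on_dd_continuous[OF assms(2)]])
qed

lemma C1_on_const: "C1_on S (\<lambda>x. c)"
  by (rule C1_onI[where D="\<lambda>u x. 0"]) auto

section \<open>Averages along lattice vectors\<close>

abbreviation C1 :: "('e::euclidean_space \<Rightarrow> complex) \<Rightarrow> bool" where "C1 \<equiv> C1_on UNIV"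

text \<open>The weight \<open>1\<close> gives the average along the segment from \<open>x\<close> to \<open>x + v\<close>; for periodic \<open>f\<close>, the
  weight \<open>r\<close> gives a primitive of the deviation of \<open>f\<close> from its average.\<close>

definition wavg :: "(real \<Rightarrow> real) \<Rightarrow> 'e::euclidean_space \<Rightarrow> ('e \<Rightarrow> complex) \<Rightarrow> 'e \<Rightarrow> complex" where
  "wavg w v = shift_int (\<lambda>r. of_real (w r)) (\<lambda>r. r *\<^sub>R v) 0 1"

abbreviation avg :: "'e::euclidean_space \<Rightarrow> ('e \<Rightarrow> complex) \<Rightarrow> 'e \<Rightarrow> complex" where
  "avg \<equiv> wavg (\<lambda>_. 1)"

lemma wavg_eq: "wavg w v f x = integral {0..1} (\<lambda>r. of_real (w r) * f (x + r *\<^sub>R v))"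
  by (simp add: wavg_def shift_int_def)

lemma continuous_on_line: "continuous_on S (\<lambda>r. x + r *\<^sub>R v)" for x v :: "'e::real_normed_vector"
  by (rule continuous_on_add[OF continuous_on_const continuous_on_scaleR[OF continuous_on_id
      continuous_on_const]])

lemma wavg_integrable:
  fixes f :: "'e::euclidean_space \<Rightarrow> complex"
  assumes "continuous_on {0..1} w" "continuous_on UNIV f"
  shows "(\<lambda>r. of_real (w r) * f (x + r *\<^sub>R v)) integrable_on {0..1}"
proof -
  have "continuous_on {0..1} (\<lambda>r. f (x + r *\<^sub>R v))"
    by (rule continuous_on_compose2[OF assms(2) continuous_on_line]) simp
  then have "continuous_on {0..1} (\<lambda>r. of_real (w r) * f (x + r *\<^sub>R v))"
    by (rule continuous_on_mult[OF continuous_on_of_real[OF assms(1)]])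
  then show ?thesis by (rule integrable_continuous_real)
qed

lemma wavg_continuous:
  assumes "continuous_on {0..1} w" "continuous_on UNIV f"
  shows "continuous_on UNIV (wavg w v f)"
proof -
  have g: "continuous_on {0..1} (\<lambda>r::real. r *\<^sub>R v)"
    by (rule continuous_on_scaleR[OF continuous_on_id continuous_on_const])
  show ?thesis unfolding wavg_def
    by (rule shift_int_continuous[where S'=UNIV, OF continuous_on_of_real[OF assms(1)] g UNIV_I assms(2)])
qed

lemma
  assumes "continuous_on {0..1} w" "C1 f"
  shows wavg_C1: "C1 (wavg w v f)" and dir_deriv_wavg: "dir_deriv u (wavg w v f) = wavg w v (dir_deriv u f)"
proof -
  have g: "continuous_on {0..1} (\<lambda>r::real. r *\<^sub>R v)" by (rule continuous_on_scaleR[OF continuous_on_id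
      continuous_on_const])
  show "C1 (wavg w v f)" unfolding wavg_def
    by (rule shift_int_C1(1)[OF continuous_on_of_real[OF assms(1)] g open_UNIV UNIV_I assms(2)])
  show "dir_deriv u (wavg w v f) = wavg w v (dir_deriv u f)" unfolding wavg_def
    by (rule ext, rule shift_int_C1(2)[OF continuous_on_of_real[OF assms(1)] g open_UNIV UNIV_I assms(2)
        UNIV_I])
qed

lemma wavg_add:
  assumes "continuous_on {0..1} w" "continuous_on UNIV f" "continuous_on UNIV g"
  shows "wavg w v (\<lambda>x. f x + g x) = (\<lambda>x. wavg w v f x + wavg w v g x)"
  unfolding wavg_eq fun_eq_iff
  using integral_add[OF wavg_integrable[OF assms(1,2)] wavg_integrable[OF assms(1,3)]]
  by (simp add: distrib_left)

lemma wavg_cmult: "wavg w v (\<lambda>x. c * f x) = (\<lambda>x. c * wavg w v f x)"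
  unfolding wavg_eq fun_eq_iff by (simp add: mult.left_commute)

lemma wavg_cnj: "wavg w v (\<lambda>x. cnj (f x)) = (\<lambda>x. cnj (wavg w v f x))"
  unfolding wavg_eq fun_eq_iff by (simp add: integral_cnj)

lemma wavg_zero: "wavg w v (\<lambda>x. 0) = (\<lambda>x. 0)"
  unfolding wavg_eq fun_eq_iff by simp

lemma avg_const: "avg v (\<lambda>x. c) = (\<lambda>x. c)"
  unfolding wavg_eq fun_eq_iff by simp

lemma wavg_periodic: "(\<And>x. f (x + u) = f x) \<Longrightarrow> wavg w v f (x + u) = wavg w v f x"
  unfolding wavg_eq by (metis (no_types, lifting) add.assoc add.commute)

lemma has_vector_derivative_along_line:
  assumes "C1 f"
  shows "((\<lambda>r. f (x + r *\<^sub>R v)) has_vector_derivative dir_deriv v f (x + r *\<^sub>R v)) (at r within S)"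
proof -
  have l: "linear (\<lambda>u. dir_deriv u f (x + r *\<^sub>R v))"
    using C1_on_differentiable[OF assms] by (intro dir_deriv_linear) simp
  have "((\<lambda>r. x + r *\<^sub>R v) has_derivative (\<lambda>h. h *\<^sub>R v)) (at r within S)"
    by (auto intro!: derivative_eq_intros)
  then have "((\<lambda>r. f (x + r *\<^sub>R v)) has_derivative (\<lambda>h. dir_deriv (h *\<^sub>R v) f (x + r *\<^sub>R v))) (at r within S)"
    by (rule has_derivative_compose) (simp add: C1_on_has_derivative[OF assms])
  then show ?thesis
    unfolding has_vector_derivative_def by (simp add: linear_cmul[OF l])
qed

lemma avg_dd:
  assumes "C1 f"
  shows "avg v (dir_deriv v f) x = f (x + v) - f x"
proof -
  have "((\<lambda>r. dir_deriv v f (x + r *\<^sub>R v)) has_integral (f (x + 1 *\<^sub>R v) - f (x + 0 *\<^sub>R v))) {0..1}"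
    by (rule fundamental_theorem_of_calculus) (auto intro: has_vector_derivative_along_line[OF assms])
  then show ?thesis unfolding wavg_eq by (simp add: integral_unique)
qed

lemma avg_dd_periodic:
  assumes "C1 f" "\<And>x. f (x + v) = f x"
  shows "avg v (dir_deriv v f) = (\<lambda>x. 0)"
  using avg_dd[OF assms(1)] assms(2) by auto

text \<open>Integration by parts in \<open>r * f (x + r *\<^sub>R v)\<close>. A periodic function minus its average is thus
  a derivative, and the primitive is again a weighted average, so it keeps every property that is
  stable under averaging.\<close>

lemma dir_deriv_wavg_id:
  assumes "C1 f" "\<And>x. f (x + v) = f x"
  shows "dir_deriv v (wavg (\<lambda>r. r) v f) x = f x - avg v f x"
proof -
  have "((\<lambda>r. f (x + r *\<^sub>R v) + of_real r * dir_deriv v f (x + r *\<^sub>R v)) has_integral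
      (of_real 1 * f (x + 1 *\<^sub>R v) - of_real 0 * f (x + 0 *\<^sub>R v))) {0..1}"
    by (rule fundamental_theorem_of_calculus)
      (auto intro!: derivative_eq_intros has_vector_derivative_along_line[OF assms(1)])
  then have "f x = integral {0..1} (\<lambda>r. f (x + r *\<^sub>R v) + of_real r * dir_deriv v f (x + r *\<^sub>R v))"
    using assms(2) by (simp add: integral_unique)
  also have "\<dots> = integral {0..1} (\<lambda>r. f (x + r *\<^sub>R v)) + integral {0..1} (\<lambda>r. of_real r * dir_deriv v f (x + r
      *\<^sub>R v))"
    using wavg_integrable[of "\<lambda>_. 1" f x v] wavg_integrable[of "\<lambda>r. r" "dir_deriv v f" x v]
      C1_on_continuous[OF assms(1)] assms(1)
    by (intro integral_add) (auto simp: C1_on_def)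
  finally show ?thesis
    using dir_deriv_wavg[of "\<lambda>r. r" f v v] assms(1) by (simp add: wavg_eq)
qed

lemma dir_deriv_zero_invariant:
  assumes "C1 f" "\<And>x. dir_deriv v f x = 0"
  shows "f (x + r *\<^sub>R v) = f x"
proof -
  have "\<exists>c. \<forall>s\<in>UNIV. f (x + s *\<^sub>R v) = c"
    by (rule has_vector_derivative_zero_constant[of UNIV])
      (use has_vector_derivative_along_line[OF assms(1), of x v] assms(2) in \<open>auto\<close>)
  then show ?thesis by (metis UNIV_I add.right_neutral scale_zero_left)
qed

text \<open>Positivity is stated through a real function on both sides so that it can be iterated.\<close>

lemma avg_pos:
  assumes "continuous_on UNIV g" "\<And>x. 0 < g x"
  obtains h where "continuous_on UNIV h" "\<And>x. 0 < h x" "avg v (\<lambda>x. of_real (g x)) = (\<lambda>x. of_real (h x))"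
proof -
  let ?h = "\<lambda>x. integral {0..1} (\<lambda>r. g (x + r *\<^sub>R v))"
  have c: "continuous_on {0..1} (\<lambda>r. g (x + r *\<^sub>R v))" for x
    by (rule continuous_on_compose2[OF assms(1) continuous_on_line]) simp
  have e: "avg v (\<lambda>x. of_real (g x)) x = of_real (?h x)" for x
    using has_integral_of_real[OF integrable_continuous_real[OF c[of x], THEN integrable_integral], where
        'b=complex, THEN integral_unique]
    unfolding wavg_eq by simp
  have "?h x > 0" for x
  proof -
    have "?h x \<ge> 0" by (rule integral_nonneg) (auto intro: integrable_continuous_real[OF c] less_imp_le
        assms(2))
    moreover have "?h x \<noteq> 0"
      using integral_eq_0_iff[OF c, of x] assms(2) by (auto simp: less_imp_le less_imp_neq[symmetric] dest:
          spec[of _ 0] bspec[of _ _ 0])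
    ultimately show ?thesis by simp
  qed
  moreover have "continuous_on UNIV ?h"
  proof -
    have "continuous_on UNIV (\<lambda>x. Re (avg v (\<lambda>x. of_real (g x)) x))"
      by (intro continuous_on_Re wavg_continuous) (auto intro!: continuous_on_of_real assms(1))
    then show ?thesis unfolding e by simp
  qed
  ultimately show ?thesis using that[of ?h] e by auto
qed

definition avgs :: "'e::euclidean_space list \<Rightarrow> ('e \<Rightarrow> complex) \<Rightarrow> 'e \<Rightarrow> complex" where
  "avgs vs f = foldr avg vs f"

lemma avgs_simps: "avgs [] f = f" "avgs (v # vs) f = avg v (avgs vs f)"
  by (simp_all add: avgs_def)

lemma avgs_append: "avgs (vs @ ws) f = avgs vs (avgs ws f)"
  by (simp add: avgs_def)

lemma avgs_continuous: "continuous_on UNIV f \<Longrightarrow> continuous_on UNIV (avgs vs f)"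
  by (induction vs) (auto simp: avgs_simps intro!: wavg_continuous)

lemma avgs_C1: "C1 f \<Longrightarrow> C1 (avgs vs f)"
  by (induction vs) (auto simp: avgs_simps intro!: wavg_C1)

lemma dir_deriv_avgs: "C1 f \<Longrightarrow> dir_deriv u (avgs vs f) = avgs vs (dir_deriv u f)"
  by (induction vs) (auto simp: avgs_simps dir_deriv_wavg avgs_C1)

lemma avgs_add:
  "continuous_on UNIV f \<Longrightarrow> continuous_on UNIV g \<Longrightarrow>
    avgs vs (\<lambda>x. f x + g x) = (\<lambda>x. avgs vs f x + avgs vs g x)"
  by (induction vs) (auto simp: avgs_simps avgs_continuous wavg_add)

lemma avgs_cmult: "avgs vs (\<lambda>x. c * f x) = (\<lambda>x. c * avgs vs f x)"
  by (induction vs) (auto simp: avgs_simps wavg_cmult)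

lemma avgs_cnj: "avgs vs (\<lambda>x. cnj (f x)) = (\<lambda>x. cnj (avgs vs f x))"
  by (induction vs) (auto simp: avgs_simps wavg_cnj)

lemma avgs_zero: "avgs vs (\<lambda>x. 0) = (\<lambda>x. 0)"
  by (induction vs) (auto simp: avgs_simps wavg_zero)

lemma avgs_const: "avgs vs (\<lambda>x. c) = (\<lambda>x. c)"
  by (induction vs) (auto simp: avgs_simps avg_const)

lemma avgs_periodic: "(\<And>x. f (x + u) = f x) \<Longrightarrow> avgs vs f (x + u) = avgs vs f x"
  by (induction vs arbitrary: x) (auto simp: avgs_simps intro: wavg_periodic)

lemma avgs_pos:
  "continuous_on UNIV g \<Longrightarrow> (\<And>x. 0 < g x) \<Longrightarrow>
   \<exists>h. continuous_on UNIV h \<and> (\<forall>x. 0 < h x) \<and> avgs vs (\<lambda>x. of_real (g x)) = (\<lambda>x. of_real (h x))"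
proof (induction vs)
  case (Cons v vs)
  then obtain h where h: "continuous_on UNIV h" "\<And>x. 0 < h x"
      "avgs vs (\<lambda>x. of_real (g x)) = (\<lambda>x. of_real (h x))"
    by auto
  show ?case using avg_pos[OF h(1,2), of v] h(3) by (metis avgs_simps(2))
qed (auto simp: avgs_simps)

text \<open>The fundamental theorem of calculus makes the innermost average along \<open>v\<close> vanish, and
  the derivative commutes with the averages in between. This replaces Stokes' theorem.\<close>

lemma avgs_dd_periodic:
  assumes "C1 f" "\<And>x. f (x + v) = f x" "v \<in> set vs"
  shows "avgs vs (dir_deriv v f) = (\<lambda>x. 0)"
  using assms(3)
proof (induction vs)
  case (Cons u vs)
  show ?case
  proof (cases "v = u")
    case True
    have "avgs vs (dir_deriv v f) = dir_deriv v (avgs vs f)" using dir_deriv_avgs[OF assms(1)] by metis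
    then show ?thesis using avg_dd_periodic[OF avgs_C1[OF assms(1)] avgs_periodic[of f, OF assms(2)]] True
      by (simp add: avgs_simps)
  next
    case False
    then show ?thesis using Cons by (simp add: avgs_simps wavg_zero)
  qed
qed simp

section \<open>Equivariant Hermitian matrices and mixed determinants\<close>

definition gauss :: "complex set" where
  "gauss = {z. Re z \<in> \<int> \<and> Im z \<in> \<int>}"

text \<open>The action on the fibre over \<open>t\<close>, in holomorphic coordinates.\<close>

definition heis :: "complex \<Rightarrow> complex \<Rightarrow> complex \<Rightarrow> complex \<Rightarrow> complex ^ 3 \<Rightarrow> complex ^ 3" where
  "heis t a b c x = vector [x $ 1 + a, x $ 2 + b + t * cnj b, x $ 3 + c + cnj b * x $ 1]"

lemma heis_nth [simp]:
  "heis t a b c x $ 1 = x $ 1 + a" "heis t a b c x $ 2 = x $ 2 + b + t * cnj b"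
  "heis t a b c x $ 3 = x $ 3 + c + cnj b * x $ 1"
  by (simp_all add: heis_def)

lemma gauss_simps [simp]: "0 \<in> gauss" "1 \<in> gauss" "\<i> \<in> gauss" "-1 \<in> gauss"
  by (simp_all add: gauss_def)

lemma three_distinct [simp]: "(1::3) \<noteq> 2" "(1::3) \<noteq> 3" "(2::3) \<noteq> 1" "(2::3) \<noteq> 3" "(3::3) \<noteq> 1" "(3::3) \<noteq> 2"
  by simp_all

lemma three_arith: "(1::3) + 1 = 2" "(1::3) + 2 = 3" "(2::3) + 1 = 3" "(2::3) + 2 = 1" "(3::3) + 1 = 1"
    "(3::3) + 2 = 2"
  by simp_all

text \<open>The Wirtinger derivatives \<open>\<partial>\<^sub>j\<close> and, below, \<open>cnj \<partial>\<^sub>j\<close>, expressed by the real derivatives along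
  \<open>e\<^sub>j\<close> and \<open>\<i> e\<^sub>j\<close>.\<close>

definition wirtinger :: "3 \<Rightarrow> (complex ^ 3 \<Rightarrow> complex) \<Rightarrow> complex ^ 3 \<Rightarrow> complex" where
  "wirtinger j f x = (dir_deriv (axis j 1) f x - \<i> * dir_deriv (axis j \<i>) f x) / 2"

definition wirtinger_bar :: "3 \<Rightarrow> (complex ^ 3 \<Rightarrow> complex) \<Rightarrow> complex ^ 3 \<Rightarrow> complex" where
  "wirtinger_bar j f x = (dir_deriv (axis j 1) f x + \<i> * dir_deriv (axis j \<i>) f x) / 2"

lemma dir_deriv_axis_wd: "dir_deriv (axis j 1) f x = wirtinger j f x + wirtinger_bar j f x"
    "dir_deriv (axis j \<i>) f x = \<i> * (wirtinger j f x - wirtinger_bar j f x)"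
  by (simp_all add: wirtinger_def wirtinger_bar_def field_simps)

lemma dir_deriv_cnj: "C1 f \<Longrightarrow> dir_deriv u (\<lambda>x. cnj (f x)) x = cnj (dir_deriv u f x)"
  by (rule dir_deriv_bounded_linear[OF bounded_linear_cnj]) (rule C1_on_differentiable[OF _ UNIV_I])

lemma wirtinger_bar_cnj: "C1 f \<Longrightarrow> wirtinger_bar j f x = cnj (wirtinger j (\<lambda>x. cnj (f x)) x)"
  by (simp add: wirtinger_def wirtinger_bar_def dir_deriv_cnj)

lemma wirtinger_add: "C1 f \<Longrightarrow> C1 g \<Longrightarrow> wirtinger j (\<lambda>x. f x + g x) x = wirtinger j f x + wirtinger j g x"
  by (simp add: wirtinger_def dir_deriv_add C1_on_differentiable field_simps)

lemma wirtinger_mult: "C1 f \<Longrightarrow> C1 g \<Longrightarrow> wirtinger j (\<lambda>x. f x * g x) x = f x * wirtinger j g x + wirtinger j f x * g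
    x"
  by (simp add: wirtinger_def dir_deriv_mult C1_on_differentiable field_simps)

lemma wirtinger_continuous: "C1 f \<Longrightarrow> continuous_on UNIV (wirtinger j f)"
  unfolding wirtinger_def[abs_def] by (intro continuous_intros C1_on_dd_continuous) auto

lemma C1_uminus: "C1 f \<Longrightarrow> C1 (\<lambda>x. - f x)"
  by (rule C1_on_bounded_linear[OF bounded_linear_minus[OF bounded_linear_ident]])

lemma C1_diff: "C1 f \<Longrightarrow> C1 g \<Longrightarrow> C1 (\<lambda>x. f x - g x)"
  using C1_on_add[of UNIV f "\<lambda>x. - g x"] C1_uminus[of g] by simp

lemma wirtinger_uminus: "C1 f \<Longrightarrow> wirtinger j (\<lambda>x. - f x) x = - wirtinger j f x"
  using dir_deriv_bounded_linear[OF bounded_linear_minus[OF bounded_linear_ident] C1_on_differentiable[OF _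
      UNIV_I], where f=f and x=x]
  by (simp add: wirtinger_def field_simps)

lemma wirtinger_diff: "C1 f \<Longrightarrow> C1 g \<Longrightarrow> wirtinger j (\<lambda>x. f x - g x) x = wirtinger j f x - wirtinger j g x"
  using wirtinger_add[of f "\<lambda>x. - g x" j x] C1_uminus[of g] by (simp add: wirtinger_uminus)

lemma wirtinger_wavg:
  assumes "continuous_on {0..1} w" "C1 f" shows "wirtinger j (wavg w v f) x = wavg w v (wirtinger j f) x"
proof -
  have c: "continuous_on UNIV (\<lambda>x. dir_deriv u f x)" for u using assms(2) by (rule C1_on_dd_continuous)
  have "wirtinger j f = (\<lambda>x. (1/2) * dir_deriv (axis j 1) f x + (- \<i> / 2) * dir_deriv (axis j \<i>) f x)"
    by (simp add: wirtinger_def fun_eq_iff field_simps)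
  then have "wavg w v (wirtinger j f) = (\<lambda>x. (1/2) * wavg w v (dir_deriv (axis j 1) f) x + (- \<i> / 2) * wavg w v
      (dir_deriv (axis j \<i>) f) x)"
    by (simp only: wavg_add[OF assms(1) continuous_on_mult_left[OF c] continuous_on_mult_left[OF c]] wavg_cmult)
  then show ?thesis using dir_deriv_wavg[OF assms] by (simp add: wirtinger_def field_simps)
qed

text \<open>The pull-back of a sesquilinear form \<open>h\<close> under the differential of the group element
  \<open>(a, b, c)\<close>, which sends \<open>e\<^sub>1\<close> to \<open>e\<^sub>1 + cnj b e\<^sub>3\<close> and fixes \<open>e\<^sub>2\<close> and \<open>e\<^sub>3\<close>.\<close>

definition pull :: "complex \<Rightarrow> (3 \<Rightarrow> 3 \<Rightarrow> complex) \<Rightarrow> 3 \<Rightarrow> 3 \<Rightarrow> complex" where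
  "pull b h j k = h j k + (if j = 1 then cnj b * h 3 k else 0) + (if k = 1 then b * h j 3 else 0)
     + (if j = 1 \<and> k = 1 then b * cnj b * h 3 3 else 0)"

text \<open>Coefficient matrices of invariant closed real forms of type (1,1): Hermitian, closed and equivariant.
  The conjugate half of closedness follows from the Hermitian symmetry.\<close>

definition kaehler_matrix :: "complex \<Rightarrow> (3 \<Rightarrow> 3 \<Rightarrow> complex ^ 3 \<Rightarrow> complex) \<Rightarrow> bool" where
  "kaehler_matrix t H \<longleftrightarrow> (\<forall>j k. C1 (H j k)) \<and> (\<forall>j k x. H k j x = cnj (H j k x)) \<and>
     (\<forall>i j k x. wirtinger i (H j k) x = wirtinger j (H i k) x) \<and>
     (\<forall>a\<in>gauss. \<forall>b\<in>gauss. \<forall>c\<in>gauss. \<forall>j k x. H j k x = pull b (\<lambda>j k. H j k (heis t a b c x)) j k)"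

lemma kaehler_matrixD:
  assumes "kaehler_matrix t H"
  shows "C1 (H j k)" "H k j x = cnj (H j k x)" "wirtinger i (H j k) x = wirtinger j (H i k) x"
    "a \<in> gauss \<Longrightarrow> b \<in> gauss \<Longrightarrow> c \<in> gauss \<Longrightarrow> H j k x = pull b (\<lambda>j k. H j k (heis t a b c x)) j k"
  using assms unfolding kaehler_matrix_def by blast+

lemma kaehler_matrix_continuous: "kaehler_matrix t H \<Longrightarrow> continuous_on UNIV (H j k)"
  by (rule C1_on_continuous) (rule kaehler_matrixD)

lemma heis_shift3: "v = axis 3 s \<Longrightarrow> heis t a b c (x + r *\<^sub>R v) = heis t a b c x + r *\<^sub>R v"
  by (simp add: vec_eq_iff forall_3 axis_def)

text \<open>Translations in the third coordinate are central in the group, hence they commute with it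
  and preserve all four conditions.\<close>

lemma kaehler_matrix_wavg:
  assumes H: "kaehler_matrix t H" and w: "continuous_on {0..1} w" and v: "v = axis 3 s"
  shows "kaehler_matrix t (\<lambda>j k. wavg w v (H j k))"
  unfolding kaehler_matrix_def
proof (intro conjI allI ballI)
  note c = kaehler_matrix_continuous[OF H]
  show "C1 (wavg w v (H j k))" for j k by (rule wavg_C1[OF w kaehler_matrixD(1)[OF H]])
  show "wavg w v (H k j) x = cnj (wavg w v (H j k) x)" for j k x
  proof -
    have "H k j = (\<lambda>x. cnj (H j k x))" using kaehler_matrixD(2)[OF H, of k j] by (rule ext)
    then show ?thesis using wavg_cnj[of w v "H j k"] by simp
  qed
  show "wirtinger i (wavg w v (H j k)) x = wirtinger j (wavg w v (H i k)) x" for i j k x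
    using wirtinger_wavg[OF w kaehler_matrixD(1)[OF H]] kaehler_matrixD(3)[OF H, of i j k] by (simp add:
        wavg_eq)
  fix a b c j k x assume abc: "a \<in> gauss" "b \<in> gauss" "c \<in> gauss"
  let ?y = "heis t a b c x"
  have ad: "wavg w v (\<lambda>x. f x + g x) y = wavg w v f y + wavg w v g y" if "continuous_on UNIV f"
      "continuous_on UNIV g" for f g y
    using wavg_add[OF w that] by simp
  have cm: "wavg w v (\<lambda>x. d * f x) y = d * wavg w v f y" for d f y
    using wavg_cmult[of w v d f] by simp
  have ci: "continuous_on UNIV (\<lambda>y. H j k y)" for j k using c by simp
  have co: "continuous_on UNIV (\<lambda>y. if P then d * H j k y else 0)" for P d j k
    by (cases P) (auto intro!: continuous_on_mult_left ci)
  have "wavg w v (H j k) x = integral {0..1} (\<lambda>r. of_real (w r) * pull b (\<lambda>j k. H j k (?y + r *\<^sub>R v)) j k)"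
    unfolding wavg_eq by (subst kaehler_matrixD(4)[OF H abc]) (simp add: heis_shift3[OF v])
  also have "\<dots> = wavg w v (\<lambda>y. pull b (\<lambda>j k. H j k y) j k) ?y" by (simp add: wavg_eq)
  also have "\<dots> = pull b (\<lambda>j k. wavg w v (H j k) ?y) j k"
    unfolding pull_def
    by (subst ad, (intro continuous_on_add co ci)+)+ (auto simp: cm wavg_zero)
  finally show "wavg w v (H j k) x = pull b (\<lambda>j k. wavg w v (H j k) ?y) j k" .
qed

text \<open>The indices are taken modulo three in the type \<open>3\<close>, so the signs of the cofactors are all positive.\<close>

definition mixed_cofactor :: "(3 \<Rightarrow> 3 \<Rightarrow> 'e \<Rightarrow> complex) \<Rightarrow> (3 \<Rightarrow> 3 \<Rightarrow> 'e \<Rightarrow> complex) \<Rightarrow> 3 \<Rightarrow> 3 \<Rightarrow> 'e \<Rightarrow> complex" where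
  "mixed_cofactor Q R j k x = Q (j + 1) (k + 1) x * R (j + 2) (k + 2) x + Q (j + 2) (k + 2) x * R (j + 1) (k +
      1) x
     - Q (j + 1) (k + 2) x * R (j + 2) (k + 1) x - Q (j + 2) (k + 1) x * R (j + 1) (k + 2) x"

text \<open>The polarization of the determinant: \<open>mixed_det H H H\<close> is six times the determinant of \<open>H\<close>,
  and the expression is symmetric and linear in its three arguments.\<close>

definition mixed_det :: "(3 \<Rightarrow> 3 \<Rightarrow> 'e \<Rightarrow> complex) \<Rightarrow> (3 \<Rightarrow> 3 \<Rightarrow> 'e \<Rightarrow> complex) \<Rightarrow> (3 \<Rightarrow> 3 \<Rightarrow> 'e \<Rightarrow> complex) \<Rightarrow> 'e \<Rightarrow>
    complex" where
  "mixed_det P Q R x = (\<Sum>j\<in>UNIV. \<Sum>k\<in>UNIV. P j k x * mixed_cofactor Q R j k x)"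

lemma mixed_cofactor_C1: "(\<And>j k. C1 (Q j k)) \<Longrightarrow> (\<And>j k. C1 (R j k)) \<Longrightarrow> C1 (mixed_cofactor Q R j k)"
  unfolding mixed_cofactor_def[abs_def] by (intro C1_diff C1_on_add C1_on_mult) auto

lemma mixed_det_commute1: "mixed_det P Q R x = mixed_det Q P R x"
  unfolding mixed_det_def mixed_cofactor_def sum_3 three_arith by (simp add: algebra_simps)

lemma mixed_det_commute2: "mixed_det P Q R x = mixed_det P R Q x"
  unfolding mixed_det_def mixed_cofactor_def sum_3 three_arith by (simp add: algebra_simps)

lemma mixed_det_add: "mixed_det (\<lambda>j k x. P j k x + P' j k x) Q R x = mixed_det P Q R x + mixed_det P' Q R x"
  unfolding mixed_det_def by (simp add: distrib_right sum.distrib)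

lemma mixed_det_cmult: "mixed_det (\<lambda>j k x. d * P j k x) Q R x = d * mixed_det P Q R x"
  unfolding mixed_det_def by (simp add: sum_distrib_left mult.assoc)

lemma mixed_det_continuous:
  "(\<And>j k. continuous_on UNIV (P j k)) \<Longrightarrow> (\<And>j k. continuous_on UNIV (Q j k)) \<Longrightarrow> (\<And>j k. continuous_on UNIV (R j k))
      \<Longrightarrow>
     continuous_on UNIV (mixed_det P Q R)"
  unfolding mixed_det_def[abs_def] mixed_cofactor_def
  by (intro continuous_on_sum continuous_on_mult continuous_on_add continuous_on_diff) auto

lemma mixed_det_transpose_cnj:
  assumes "\<And>j k. Q k j x = cnj (Q j k x)" "\<And>j k. R k j x = cnj (R j k x)"
  shows "mixed_det (\<lambda>j k x. cnj (P k j x)) Q R x = cnj (mixed_det P Q R x)"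
proof -
  have "cnj (mixed_det P Q R x) = mixed_det (\<lambda>j k x. cnj (P j k x)) (\<lambda>j k x. cnj (Q j k x)) (\<lambda>j k x. cnj (R j k
      x)) x"
    unfolding mixed_det_def mixed_cofactor_def by simp
  also have "\<dots> = mixed_det (\<lambda>j k x. cnj (P j k x)) (\<lambda>j k x. Q k j x) (\<lambda>j k x. R k j x) x"
    unfolding mixed_det_def mixed_cofactor_def by (simp only: assms[symmetric])
  also have "\<dots> = mixed_det (\<lambda>j k x. cnj (P k j x)) Q R x"
    unfolding mixed_det_def mixed_cofactor_def sum_3 three_arith by (simp add: algebra_simps)
  finally show ?thesis by simp
qed

lemma wirtinger_cof:
  assumes "\<And>j k. C1 (Q j k)" "\<And>j k. C1 (R j k)"
  shows "wirtinger i (mixed_cofactor Q R j k) x = mixed_cofactor (\<lambda>j k. wirtinger i (Q j k)) R j k x +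
      mixed_cofactor Q (\<lambda>j k. wirtinger i (R j k)) j k x"
  unfolding mixed_cofactor_def[abs_def]
  by (simp add: wirtinger_diff wirtinger_add wirtinger_mult assms C1_diff C1_on_add C1_on_mult)

text \<open>Every product occurs twice, with the two indices \<open>i, j\<close> of a closed matrix exchanged and with
  opposite signs. This is closedness of the product of closed forms, in coordinates.\<close>

lemma mixed_cofactor_divergence:
  assumes "\<And>i j k. DQ i j k = DQ j i k" "\<And>i j k. DR i j k = DR j i k"
  shows "(\<Sum>j\<in>UNIV. mixed_cofactor (\<lambda>j' k x. DQ j j' k) R j k x + mixed_cofactor Q (\<lambda>j' k x. DR j j' k) j k x) =
      0"
  using assms(1)[of 2 1] assms(1)[of 3 1] assms(1)[of 3 2] assms(2)[of 2 1] assms(2)[of 3 1] assms(2)[of 3 2]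
  unfolding mixed_cofactor_def sum_3 three_arith by (simp add: algebra_simps)

text \<open>By closedness \<open>\<partial>\<^sub>3 K j k = \<partial>\<^sub>j K 3 k\<close>, so the product rule turns the mixed determinant into a
  divergence; the remaining terms vanish by the divergence lemma for cofactors.\<close>

lemma mixed_det_wd:
  assumes K: "kaehler_matrix t K" and Q: "kaehler_matrix t Q" and R: "kaehler_matrix t R"
  shows "mixed_det (\<lambda>j k. wirtinger 3 (K j k)) Q R x = (\<Sum>j\<in>UNIV. wirtinger j (\<lambda>x. \<Sum>k\<in>UNIV. K 3 k x *
      mixed_cofactor Q R j k x) x)"
proof -
  note c = mixed_cofactor_C1[of Q R, OF kaehler_matrixD(1)[OF Q] kaehler_matrixD(1)[OF R]] kaehler_matrixD(1)[OF
      K]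
  have "wirtinger j (\<lambda>x. \<Sum>k\<in>UNIV. K 3 k x * mixed_cofactor Q R j k x) x
      = (\<Sum>k\<in>UNIV. K 3 k x * wirtinger j (mixed_cofactor Q R j k) x + wirtinger j (K 3 k) x * mixed_cofactor Q R
          j k x)" for j
    unfolding sum_3 by (simp add: wirtinger_add wirtinger_mult c C1_on_add C1_on_mult)
  then have "(\<Sum>j\<in>UNIV. wirtinger j (\<lambda>x. \<Sum>k\<in>UNIV. K 3 k x * mixed_cofactor Q R j k x) x)
      = (\<Sum>j\<in>UNIV. \<Sum>k\<in>UNIV. K 3 k x * wirtinger j (mixed_cofactor Q R j k) x) + (\<Sum>j\<in>UNIV. \<Sum>k\<in>UNIV. wirtinger j (K
          3 k) x * mixed_cofactor Q R j k x)"
    by (simp add: sum.distrib)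
  also have "(\<Sum>j\<in>UNIV. \<Sum>k\<in>UNIV. K 3 k x * wirtinger j (mixed_cofactor Q R j k) x)
      = (\<Sum>k\<in>UNIV. K 3 k x * (\<Sum>j\<in>UNIV. wirtinger j (mixed_cofactor Q R j k) x))"
    by (subst sum.swap) (simp add: sum_distrib_left)
  also have "\<dots> = 0"
  proof (rule sum.neutral, rule ballI)
    fix k :: 3
    have "(\<Sum>j\<in>UNIV. wirtinger j (mixed_cofactor Q R j k) x) = 0"
      using mixed_cofactor_divergence[of "\<lambda>i j k. wirtinger i (Q j k) x" "\<lambda>i j k. wirtinger i (R j k) x" R k x
          Q, OF kaehler_matrixD(3)[OF Q] kaehler_matrixD(3)[OF R]]
      by (subst wirtinger_cof[OF kaehler_matrixD(1)[OF Q] kaehler_matrixD(1)[OF R]]) (simp add: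
          mixed_cofactor_def)
    then show "K 3 k x * (\<Sum>j\<in>UNIV. wirtinger j (mixed_cofactor Q R j k) x) = 0" by simp
  qed
  also have "(\<Sum>j\<in>UNIV. \<Sum>k\<in>UNIV. wirtinger j (K 3 k) x * mixed_cofactor Q R j k x) = mixed_det (\<lambda>j k. wirtinger 3
      (K j k)) Q R x"
    unfolding mixed_det_def using kaehler_matrixD(3)[OF K, of 3] by simp
  finally show ?thesis by simp
qed

section \<open>The mean over a fundamental domain\<close>

text \<open>The projection of the lattice to the first two coordinates is spanned by these vectors; the
  middle coordinate has the lattice of the numbers \<open>b + t * cnj b\<close>.\<close>

definition horizontal_cycles :: "complex \<Rightarrow> (complex ^ 3) list" where
  "horizontal_cycles t = [axis 2 (1 + t), axis 2 (\<i> * (1 - t)), axis 1 1, axis 1 \<i>]"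

definition vertical_cycles :: "(complex ^ 3) list" where
  "vertical_cycles = [axis 3 1, axis 3 \<i>]"

abbreviation mean :: "complex \<Rightarrow> (complex ^ 3 \<Rightarrow> complex) \<Rightarrow> complex ^ 3 \<Rightarrow> complex" where
  "mean t f \<equiv> avgs (horizontal_cycles t) (avgs vertical_cycles f)"

definition heis_invariant :: "complex \<Rightarrow> (complex ^ 3 \<Rightarrow> complex) \<Rightarrow> bool" where
  "heis_invariant t f \<longleftrightarrow> (\<forall>a\<in>gauss. \<forall>b\<in>gauss. \<forall>c\<in>gauss. \<forall>x. f (heis t a b c x) = f x)"

lemma heis_invariantD: "heis_invariant t f \<Longrightarrow> a \<in> gauss \<Longrightarrow> b \<in> gauss \<Longrightarrow> c \<in> gauss \<Longrightarrow> f (heis t a b c x) = f x"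
  unfolding heis_invariant_def by blast

lemma heis_translation:
  "heis t a 0 c x = x + axis 1 a + axis 3 c"
  "heis t 0 b 0 x = x + axis 2 (b + t * cnj b) + axis 3 (cnj b * x $ 1)"
  by (simp_all add: vec_eq_iff forall_3 axis_def)

lemma axis_0 [simp]: "axis j (0 :: complex) = 0"
  by (simp add: vec_eq_iff axis_def)

lemma axis_decompose: "axis j (z::complex) = Re z *\<^sub>R axis j 1 + Im z *\<^sub>R axis j \<i>"
  by (auto simp: vec_eq_iff axis_def complex_eq_iff)

lemma invariant_along_axis:
  fixes f :: "complex ^ 'n \<Rightarrow> complex"
  assumes "C1 f" "\<And>x. dir_deriv (axis j 1) f x = 0" "\<And>x. dir_deriv (axis j \<i>) f x = 0"
  shows "f (x + axis j z) = f x"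
proof -
  have "f (x + axis j z) = f (x + Re z *\<^sub>R axis j 1 + Im z *\<^sub>R axis j \<i>)"
    by (subst axis_decompose) (simp add: add.assoc)
  then show ?thesis using dir_deriv_zero_invariant[OF assms(1,2)] dir_deriv_zero_invariant[OF assms(1,3)] by
      simp
qed

lemma dir_deriv_real_comb:
  "C1 f \<Longrightarrow> dir_deriv (r *\<^sub>R u + s *\<^sub>R v) f x = of_real r * dir_deriv u f x + of_real s * dir_deriv v f x"
  using linear_add[OF dir_deriv_linear[OF C1_on_differentiable[OF _ UNIV_I]], of f "r *\<^sub>R u" "s *\<^sub>R v"]
    linear_cmul[OF dir_deriv_linear[OF C1_on_differentiable[OF _ UNIV_I]], of f r u]
    linear_cmul[OF dir_deriv_linear[OF C1_on_differentiable[OF _ UNIV_I]], of f s v]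
  by (simp add: scaleR_conv_of_real)

lemma dir_deriv_axis:
  fixes f :: "complex ^ 'n \<Rightarrow> complex"
  shows "C1 f \<Longrightarrow> dir_deriv (axis j z) f x = of_real (Re z) * dir_deriv (axis j 1) f x + of_real (Im z) *
      dir_deriv (axis j \<i>) f x"
  by (subst axis_decompose) (rule dir_deriv_real_comb)

lemma avgs_fib_dd:
  assumes "C1 f" "\<And>x. f (x + axis 3 1) = f x" "\<And>x. f (x + axis 3 \<i>) = f x" "v \<in> set vertical_cycles"
  shows "avgs vertical_cycles (dir_deriv v f) = (\<lambda>x. 0)"
  by (rule avgs_dd_periodic[OF assms(1) _ assms(4)]) (use assms(2-4) in \<open>auto simp: vertical_cycles_def\<close>)

text \<open>After averaging over the third coordinate, the twisting term \<open>cnj b * x\<^sub>1\<close> of the action becomes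
  invisible, and invariance turns into honest periodicity in the other coordinates.\<close>

lemma fib_average_properties:
  assumes f: "C1 f" "heis_invariant t f"
  shows "avgs vertical_cycles f (x + axis 3 z) = avgs vertical_cycles f x"
    and "a \<in> gauss \<Longrightarrow> avgs vertical_cycles f (x + axis 1 a) = avgs vertical_cycles f x"
    and "b \<in> gauss \<Longrightarrow> avgs vertical_cycles f (x + axis 2 (b + t * cnj b)) = avgs vertical_cycles f x"
proof -
  let ?g = "avgs vertical_cycles f"
  have p3: "f (x + axis 3 c) = f x" if "c \<in> gauss" for c x
    using heis_invariantD[OF f(2), of 0 0 c x] that heis_translation(1)[of t 0 c x] by simp
  have dd0: "dir_deriv v ?g x = 0" if "v \<in> set vertical_cycles" for v x
    using avgs_fib_dd[OF f(1) p3 p3 that] dir_deriv_avgs[OF f(1), of v vertical_cycles] by simp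
  have inv3: "?g (x + axis 3 z) = ?g x" for x z
    by (rule invariant_along_axis[OF avgs_C1[OF f(1)] dd0 dd0]) (auto simp: vertical_cycles_def)
  then show "?g (x + axis 3 z) = ?g x" .
  show "?g (x + axis 1 a) = ?g x" if "a \<in> gauss"
    by (rule avgs_periodic) (use heis_invariantD[OF f(2), of a 0 0] that heis_translation(1)[of t a 0] in simp)
  assume b: "b \<in> gauss"
  have sh: "heis t 0 b 0 (x + r *\<^sub>R axis 3 s) = heis t 0 b 0 x + r *\<^sub>R axis 3 s" for x r and s :: complex
    by (rule heis_shift3[OF refl])
  have "?g (heis t 0 b 0 x) = ?g x"
  proof -
    have "avg (axis 3 s) h (heis t 0 b 0 x) = avg (axis 3 s) h x" if "\<And>x. h (heis t 0 b 0 x) = h x" for h s x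
      unfolding wavg_eq sh[symmetric] that ..
    then show ?thesis using heis_invariantD[OF f(2), of 0 b 0] b
      by (simp add: vertical_cycles_def avgs_simps)
  qed
  then show "?g (x + axis 2 (b + t * cnj b)) = ?g x"
    unfolding heis_translation(2) inv3 .
qed

text \<open>The two lattice vectors in the second coordinate are linearly independent over the reals because
  the determinant \<open>1 - (Re t)\<^sup>2 - (Im t)\<^sup>2\<close> is positive, so they reach every direction.\<close>

lemma mean_dd:
  assumes t: "norm t < 1" and f: "C1 f" "heis_invariant t f" and j: "j = 1 \<or> j = 2"
  shows "mean t (dir_deriv (axis j z) f) = (\<lambda>x. 0)"
proof -
  let ?g = "avgs vertical_cycles f"
  have g: "C1 ?g" by (rule avgs_C1[OF f(1)])
  have eq: "mean t (dir_deriv v f) = avgs (horizontal_cycles t) (dir_deriv v ?g)" for v using dir_deriv_avgs[OF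
      f(1)] by simp
  have z: "avgs (horizontal_cycles t) (dir_deriv v ?g) = (\<lambda>x. 0)" if "v \<in> set (horizontal_cycles t)" for v
  proof (rule avgs_dd_periodic[OF g _ that])
    show "?g (x + v) = ?g x" for x
      using that fib_average_properties(2)[OF f, of 1] fib_average_properties(2)[OF f, of \<i>]
        fib_average_properties(3)[OF f, of 1] fib_average_properties(3)[OF f, of \<i>]
      by (auto simp: horizontal_cycles_def algebra_simps)
  qed
  have comb: "avgs (horizontal_cycles t) (dir_deriv (r *\<^sub>R u + s *\<^sub>R v) ?g) = (\<lambda>x. 0)"
    if "u \<in> set (horizontal_cycles t)" "v \<in> set (horizontal_cycles t)" for r s u v
  proof -
    have c: "continuous_on UNIV (\<lambda>x. dir_deriv u ?g x)" for u using g by (rule C1_on_dd_continuous)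
    have "dir_deriv (r *\<^sub>R u + s *\<^sub>R v) ?g = (\<lambda>x. of_real r * dir_deriv u ?g x + of_real s * dir_deriv v ?g x)"
      using dir_deriv_real_comb[OF g] by blast
    then show ?thesis
      by (simp add: avgs_add[OF continuous_on_mult_left[OF c] continuous_on_mult_left[OF c]] avgs_cmult z that)
  qed
  show ?thesis
  proof (cases "j = 1")
    case True
    show ?thesis unfolding eq True by (subst axis_decompose, rule comb) (simp_all add: horizontal_cycles_def)
  next
    case False
    define d where "d = 1 - (Re t)\<^sup>2 - (Im t)\<^sup>2"
    have "d > 0" using t by (simp add: d_def cmod_def real_sqrt_lt_1_iff)
    \<comment> \<open>Cramer's rule for the coordinates of \<open>z\<close> in the real basis \<open>1 + t\<close>, \<open>\<i> * (1 - t)\<close>\<close>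
    define r where "r = (Re z * (1 - Re t) - Im z * Im t) / d"
    define s where "s = (Im z * (1 + Re t) - Re z * Im t) / d"
    have "r * d = Re z * (1 - Re t) - Im z * Im t" "s * d = Im z * (1 + Re t) - Re z * Im t"
      using \<open>d > 0\<close> by (simp_all add: r_def s_def)
    then have "d * (r * (1 + Re t) + s * Im t) = d * Re z" "d * (r * Im t + s * (1 - Re t)) = d * Im z"
      unfolding d_def by algebra+
    then have "r * (1 + Re t) + s * Im t = Re z" "r * Im t + s * (1 - Re t) = Im z"
      using \<open>d > 0\<close> by simp_all
    then have "axis j z = r *\<^sub>R axis 2 (1 + t) + s *\<^sub>R axis 2 (\<i> * (1 - t))"
      using False j by (auto simp: vec_eq_iff axis_def complex_eq_iff)
    then have "axis j z \<in> {r *\<^sub>R axis 2 (1 + t) + s *\<^sub>R axis 2 (\<i> * (1 - t))}" by simp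
    moreover have "avgs (horizontal_cycles t) (dir_deriv (r *\<^sub>R axis 2 (1 + t) + s *\<^sub>R axis 2 (\<i> * (1 - t))) ?g)
        = (\<lambda>x. 0)"
      by (rule comb) (simp_all add: horizontal_cycles_def)
    ultimately show ?thesis unfolding eq by simp
  qed
qed

lemma avgs_wd:
  assumes "C1 f" "avgs vs (dir_deriv (axis j 1) f) = (\<lambda>x. 0)" "avgs vs (dir_deriv (axis j \<i>) f) = (\<lambda>x. 0)"
  shows "avgs vs (wirtinger j f) = (\<lambda>x. 0)"
proof -
  have c: "continuous_on UNIV (\<lambda>x. dir_deriv u f x)" for u using assms(1) by (rule C1_on_dd_continuous)
  have "wirtinger j f = (\<lambda>x. (1/2) * dir_deriv (axis j 1) f x + (- \<i> / 2) * dir_deriv (axis j \<i>) f x)"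
    by (simp add: wirtinger_def fun_eq_iff field_simps)
  then show ?thesis
    using assms(2,3) by (simp only: avgs_add[OF continuous_on_mult_left[OF c] continuous_on_mult_left[OF c]]
        avgs_cmult) simp
qed

text \<open>The first two components of the vector field \<open>W\<close> are invariant functions. The third one is not, but
  it is periodic in the third coordinate, and only its derivative in that direction occurs.\<close>

lemma mean_mix_wd:
  assumes t: "norm t < 1" and K: "kaehler_matrix t K" and Q: "kaehler_matrix t Q" and R: "kaehler_matrix t R"
  shows "mean t (mixed_det (\<lambda>j k. wirtinger 3 (K j k)) Q R) = (\<lambda>x. 0)"
proof -
  define W where "W j x = (\<Sum>k\<in>UNIV. K 3 k x * mixed_cofactor Q R j k x)" for j x
  have C: "C1 (W j)" for j
    unfolding W_def[abs_def] sum_3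
    by (intro C1_on_add C1_on_mult mixed_cofactor_C1 kaehler_matrixD(1)[OF K] kaehler_matrixD(1)[OF Q]
        kaehler_matrixD(1)[OF R])
  have eqv: "W j x = (if j = 3 \<and> b \<noteq> 0 then W j x else W j (heis t a b c x))" 
    if abc: "a \<in> gauss" "b \<in> gauss" "c \<in> gauss" for a b c j x
  proof -
    note eK = kaehler_matrixD(4)[OF K abc, of _ _ x] and eQ = kaehler_matrixD(4)[OF Q abc, of _ _ x] and eR =
        kaehler_matrixD(4)[OF R abc, of _ _ x]
    consider "j = 1" | "j = 2" | "j = 3" using exhaust_3[of j] by blast
    then show ?thesis
    proof cases
      case 1
      show ?thesis unfolding W_def mixed_cofactor_def sum_3 1 three_arith
        unfolding eK[of 3 1] eK[of 3 2] eK[of 3 3] eQ[of 2 1] eQ[of 2 2] eQ[of 2 3] eQ[of 3 1] eQ[of 3 2] eQ[of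
            3 3]
          eR[of 2 1] eR[of 2 2] eR[of 2 3] eR[of 3 1] eR[of 3 2] eR[of 3 3] pull_def
        by (simp add: algebra_simps)
    next
      case 2
      show ?thesis unfolding W_def mixed_cofactor_def sum_3 2 three_arith
        unfolding eK[of 3 1] eK[of 3 2] eK[of 3 3] eQ[of 1 1] eQ[of 1 2] eQ[of 1 3] eQ[of 3 1] eQ[of 3 2] eQ[of
            3 3]
          eR[of 1 1] eR[of 1 2] eR[of 1 3] eR[of 3 1] eR[of 3 2] eR[of 3 3] pull_def
        by (simp add: algebra_simps)
    next
      case 3
      have p0: "pull 0 h j k = h j k" for h j k by (simp add: pull_def)
      show ?thesis
      proof (cases "b = 0")
        case True
        then show ?thesis using eK eQ eR unfolding True p0 W_def mixed_cofactor_def by simp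
      qed (simp add: 3)
    qed
  qed
  have "avgs vertical_cycles (dir_deriv v (W 3)) = (\<lambda>x. 0)" if "v \<in> set vertical_cycles" for v
    using eqv[of 0 0 1 3] eqv[of 0 0 \<i> 3] heis_translation(1)[of t 0]
    by (intro avgs_fib_dd[OF C _ _ that]) simp_all
  then have m3: "mean t (wirtinger 3 (W 3)) = (\<lambda>x. 0)"
    by (subst avgs_wd[OF C]) (auto simp: vertical_cycles_def avgs_zero)
  have m: "mean t (wirtinger j (W j)) = (\<lambda>x. 0)" if "j \<noteq> 3" for j
  proof -
    have "W j (heis t a b c x) = W j x" if "a \<in> gauss" "b \<in> gauss" "c \<in> gauss" for a b c x
      using eqv[OF that, of j x] \<open>j \<noteq> 3\<close> by simp
    then have "heis_invariant t (W j)" unfolding heis_invariant_def by blast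
    moreover have "j = 1 \<or> j = 2" using exhaust_3[of j] that by auto
    ultimately show ?thesis
      using avgs_wd[OF C, of "horizontal_cycles t @ vertical_cycles" j j] mean_dd[OF t C, of j j] by (simp add:
          avgs_append)
  qed
  have c: "continuous_on UNIV (wirtinger j (W j))" for j by (rule wirtinger_continuous[OF C])
  have "mixed_det (\<lambda>j k. wirtinger 3 (K j k)) Q R x = (\<Sum>j\<in>UNIV. wirtinger j (W j) x)" for x
    unfolding W_def[abs_def] by (rule mixed_det_wd[OF K Q R])
  then have "mixed_det (\<lambda>j k. wirtinger 3 (K j k)) Q R = (\<lambda>x. (wirtinger 1 (W 1) x + wirtinger 2 (W 2) x) +
      wirtinger 3 (W 3) x)"
    unfolding sum_3 by blast
  then have "avgs (horizontal_cycles t @ vertical_cycles) (mixed_det (\<lambda>j k. wirtinger 3 (K j k)) Q R) = (\<lambda>x. 0)"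
    using c m[of 1] m[of 2] m3 by (simp add: avgs_add continuous_on_add avgs_append[symmetric])
  then show ?thesis by (simp add: avgs_append)
qed

text \<open>Each of the two real directions in the third coordinate is a combination of \<open>\<partial>\<^sub>3\<close> and its conjugate,
  and conjugation exchanges the two contributions by Hermitian symmetry.\<close>

lemma mean_mix_dd:
  assumes t: "norm t < 1" and K: "kaehler_matrix t K" and Q: "kaehler_matrix t Q" and R: "kaehler_matrix t R"
      and v: "v \<in> set vertical_cycles"
  shows "mean t (mixed_det (\<lambda>j k. dir_deriv v (K j k)) Q R) = (\<lambda>x. 0)"
proof -
  let ?W = "\<lambda>j k. wirtinger 3 (K j k)"
  have b: "wirtinger_bar 3 (K j k) x = cnj (wirtinger 3 (K k j) x)" for j k x
  proof -
    have "(\<lambda>x. cnj (K j k x)) = K k j" using kaehler_matrixD(2)[OF K, of k j] by (simp add: fun_eq_iff)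
    then show ?thesis using wirtinger_bar_cnj[OF kaehler_matrixD(1)[OF K], of 3 j k x] by simp
  qed
  have "\<exists>d e. \<forall>f x. dir_deriv v f x = d * wirtinger 3 f x + e * wirtinger_bar 3 f x"
  proof (cases "v = axis 3 1")
    case True
    then show ?thesis using dir_deriv_axis_wd(1)[of 3] by (intro exI[of _ 1]) simp
  next
    case False
    then have "v = axis 3 \<i>" using v by (simp add: vertical_cycles_def)
    then show ?thesis using dir_deriv_axis_wd(2)[of 3]
      by (intro exI[of _ \<i>] exI[of _ "-\<i>"]) (simp add: right_diff_distrib)
  qed
  then obtain d e where de: "\<And>f x. dir_deriv v f x = d * wirtinger 3 f x + e * wirtinger_bar 3 f x" by blast
  have "mixed_det (\<lambda>j k. dir_deriv v (K j k)) Q R x = d * mixed_det ?W Q R x + e * cnj (mixed_det ?W Q R x)" for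
      x
  proof -
    have "mixed_det (\<lambda>j k. dir_deriv v (K j k)) Q R x = mixed_det (\<lambda>j k x. d * ?W j k x + e * cnj (?W k j x)) Q
        R x"
      by (simp add: mixed_det_def de b)
    then show ?thesis
      using mixed_det_transpose_cnj[of Q x R ?W, OF kaehler_matrixD(2)[OF Q] kaehler_matrixD(2)[OF R]] by (simp
          only: mixed_det_add mixed_det_cmult)
  qed
  then have e: "mixed_det (\<lambda>j k. dir_deriv v (K j k)) Q R = (\<lambda>x. d * mixed_det ?W Q R x + e * cnj (mixed_det ?W
      Q R x))" by blast
  have c: "continuous_on UNIV (mixed_det ?W Q R)"
    by (intro mixed_det_continuous wirtinger_continuous kaehler_matrixD(1)[OF K] kaehler_matrix_continuous[OF Q]
        kaehler_matrix_continuous[OF R])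
  have "avgs (horizontal_cycles t @ vertical_cycles) (mixed_det ?W Q R) = (\<lambda>x. 0)"
    using mean_mix_wd[OF t K Q R] by (simp add: avgs_append)
  then have "avgs (horizontal_cycles t @ vertical_cycles) (\<lambda>x. d * mixed_det ?W Q R x + e * cnj (mixed_det ?W Q
      R x)) = (\<lambda>x. 0)"
    using c by (subst avgs_add) (auto simp: avgs_cmult avgs_cnj intro!: continuous_on_mult_left
        continuous_on_cnj)
  then show ?thesis unfolding e avgs_append .
qed

text \<open>With \<open>H = G + D\<close>, where \<open>D\<close> is a derivative, expand the determinant by multilinearity:
  every term that contains \<open>D\<close> has mean zero.\<close>

lemma mean_mix_avg:
  assumes t: "norm t < 1" and H: "kaehler_matrix t H" and v: "v \<in> set vertical_cycles"
  defines "G \<equiv> \<lambda>j k. avg v (H j k)"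
  shows "kaehler_matrix t G" and "mean t (mixed_det H H H) = mean t (mixed_det G G G)"
proof -
  define K where "K = (\<lambda>j k. wavg (\<lambda>r. r) v (H j k))"
  define D where "D = (\<lambda>j k. dir_deriv v (K j k))"
  obtain s where s: "v = axis 3 s" "s \<in> gauss" using v by (auto simp: vertical_cycles_def)
  show G: "kaehler_matrix t G" unfolding G_def by (rule kaehler_matrix_wavg[OF H _ s(1)]) simp
  have K: "kaehler_matrix t K" unfolding K_def by (rule kaehler_matrix_wavg[OF H _ s(1)]) (simp add:
      continuous_on_id)
  have per: "H j k (x + v) = H j k x" for j k x
    using kaehler_matrixD(4)[OF H, of 0 0 s j k x] s heis_translation(1)[of t 0 s x]
    by (simp add: pull_def del: axis_eq_axis split: if_splits)
  have HG: "H j k x = G j k x + D j k x" for j k x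
    using dir_deriv_wavg_id[OF kaehler_matrixD(1)[OF H] per] by (simp add: G_def D_def K_def)
  have sp: "mixed_det H A B x = mixed_det G A B x + mixed_det D A B x" for A B x
    unfolding mixed_det_add[symmetric] HG[symmetric] ..
  have "mixed_det H H H x = mixed_det G G G x + (mixed_det D H H x + (mixed_det D G H x + mixed_det D G G x))"
      for x
    using sp[of H H x] mixed_det_commute1[of G H H x] sp[of G H x] mixed_det_commute1[of G G H x]
        mixed_det_commute2[of G G H x]
      mixed_det_commute1[of G H G x] sp[of G G x] by simp
  then have e: "mixed_det H H H = (\<lambda>x. mixed_det G G G x + (mixed_det D H H x + (mixed_det D G H x + mixed_det D
      G G x)))" by blast
  have z: "avgs (horizontal_cycles t @ vertical_cycles) (mixed_det D A B) = (\<lambda>x. 0)" if "kaehler_matrix t A"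
      "kaehler_matrix t B" for A B
    using mean_mix_dd[OF t K that v] unfolding D_def by (simp add: avgs_append)
  have Dc: "continuous_on UNIV (D j k)" for j k
    using C1_on_dd_continuous[OF kaehler_matrixD(1)[OF K]] unfolding D_def by simp
  note c = kaehler_matrix_continuous[OF H] kaehler_matrix_continuous[OF G] Dc
  have "avgs (horizontal_cycles t @ vertical_cycles) (mixed_det H H H) = avgs (horizontal_cycles t @
      vertical_cycles) (mixed_det G G G)"
    unfolding e by (simp add: avgs_add continuous_on_add mixed_det_continuous c z H G)
  then show "mean t (mixed_det H H H) = mean t (mixed_det G G G)" by (simp add: avgs_append)
qed

section \<open>Fundamental domain and Liouville theorem\<close>

definition unit_square :: "complex set" where
  "unit_square = cbox 0 (Complex 1 1)"

text \<open>A real linear parametrization that carries the standard unit cube to a fundamental domain.\<close>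

definition torus_param :: "complex \<Rightarrow> complex ^ 3 \<Rightarrow> complex ^ 3" where
  "torus_param t z = vector [z $ 1, z $ 2 + t * cnj (z $ 2), z $ 3]"

definition unit_cube :: "(complex ^ 3) set" where
  "unit_cube = cbox 0 (\<chi> i. Complex 1 1)"

lemma unit_cubeI: "(\<And>j. x $ j \<in> unit_square) \<Longrightarrow> x \<in> unit_cube"
  unfolding unit_cube_def unit_square_def
  by (auto simp: mem_box Basis_vec_def inner_axis)

lemma gauss_reduction: "\<exists>a\<in>gauss. z + a \<in> unit_square"
proof (rule bexI)
  show "Complex (- of_int \<lfloor>Re z\<rfloor>) (- of_int \<lfloor>Im z\<rfloor>) \<in> gauss" by (simp add: gauss_def)
  show "z + Complex (- of_int \<lfloor>Re z\<rfloor>) (- of_int \<lfloor>Im z\<rfloor>) \<in> unit_square"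
    unfolding unit_square_def in_cbox_complex_iff by simp linarith
qed

text \<open>The inverse of the real linear map \<open>z \<mapsto> z + t * cnj z\<close>.\<close>

definition untwist :: "complex \<Rightarrow> complex \<Rightarrow> complex" where
  "untwist t w = (w - t * cnj w) / (1 - t * cnj t)"

lemma untwist_denominator:
  assumes "norm t < 1" shows "1 - t * cnj t \<noteq> 0"
proof -
  have "norm (t * cnj t) < 1"
    using assms by (simp add: norm_mult abs_square_less_1 flip: power2_eq_square)
  then show ?thesis by auto
qed

lemma untwist_twist: "norm t < 1 \<Longrightarrow> untwist t (z + t * cnj z) = z"
  using untwist_denominator[of t] by (simp add: untwist_def field_simps)

lemma twist_untwist:
  assumes "norm t < 1" shows "untwist t w + t * cnj (untwist t w) = w"
proof -
  have "cnj (untwist t w) = (cnj w - cnj t * w) / (1 - t * cnj t)" by (simp add: untwist_def mult.commute)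
  then have "untwist t w + t * cnj (untwist t w) = (w - t * cnj w + t * (cnj w - cnj t * w)) / (1 - t * cnj t)"
    by (simp add: untwist_def add_divide_distrib)
  also have "w - t * cnj w + t * (cnj w - cnj t * w) = w * (1 - t * cnj t)" by (simp add: algebra_simps)
  finally show ?thesis using untwist_denominator[OF assms] by simp
qed

lemma untwist_add: "untwist t (v + w) = untwist t v + untwist t w"
  by (simp add: untwist_def add_divide_distrib[symmetric] algebra_simps)

lemma fundamental_domain:
  assumes "norm t < 1"
  shows "\<exists>a\<in>gauss. \<exists>b\<in>gauss. \<exists>c\<in>gauss. \<exists>z\<in>unit_cube. heis t a b c x = torus_param t z"
proof -
  obtain a where a: "a \<in> gauss" "x $ 1 + a \<in> unit_square" using gauss_reduction by blast
  obtain b where b: "b \<in> gauss" "untwist t (x $ 2) + b \<in> unit_square" using gauss_reduction by blast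
  obtain c where c: "c \<in> gauss" "(x $ 3 + cnj b * x $ 1) + c \<in> unit_square" using gauss_reduction by blast
  let ?z = "vector [x $ 1 + a, untwist t (x $ 2) + b, (x $ 3 + cnj b * x $ 1) + c] :: complex ^ 3"
  have "?z \<in> unit_cube"
  proof (rule unit_cubeI)
    fix j :: 3 show "?z $ j \<in> unit_square" using exhaust_3[of j] a b c by auto
  qed
  moreover have "heis t a b c x = torus_param t ?z"
    using twist_untwist[OF assms, of "x $ 2"]
    by (simp add: vec_eq_iff forall_3 torus_param_def algebra_simps)
  ultimately show ?thesis using a b c by blast
qed

lemma torus_param_bounded: "compact (torus_param t ` unit_cube)"
proof (rule compact_continuous_image)
  have "linear (torus_param t)"
    by (rule linearI) (auto simp: vec_eq_iff forall_3 torus_param_def complex_eq_iff algebra_simps)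
  then show "continuous_on unit_cube (torus_param t)" by (simp add: linear_continuous_on linear_linear)
  show "compact unit_cube" by (simp add: unit_cube_def)
qed

lemma heis_invariant_bounded:
  assumes "norm t < 1" "heis_invariant t f" "continuous_on UNIV f"
  shows "bounded (range f)"
proof (rule bounded_subset)
  show "bounded (f ` torus_param t ` unit_cube)"
    using compact_imp_bounded[OF compact_continuous_image[OF continuous_on_subset[OF assms(3)]
        torus_param_bounded[of t]]]
    by simp
  show "range f \<subseteq> f ` torus_param t ` unit_cube"
  proof
    fix y assume "y \<in> range f"
    then obtain x where x: "y = f x" by blast
    obtain a b c z where "a \<in> gauss" "b \<in> gauss" "c \<in> gauss" "z \<in> unit_cube" "heis t a b c x = torus_param t z"
      using fundamental_domain[OF assms(1)] by blast
    then show "y \<in> f ` torus_param t ` unit_cube"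
      using heis_invariantD[OF assms(2), of a b c x] x by (metis imageI)
  qed
qed

lemma dir_deriv_axis_complex: "C1 f \<Longrightarrow> dir_deriv (axis j z) f x = z * wirtinger j f x + cnj z * wirtinger_bar j f
    x"
proof -
  assume f: "C1 f"
  have "dir_deriv (axis j z) f x = (of_real (Re z) + \<i> * of_real (Im z)) * wirtinger j f x + (of_real (Re z) - \<i>
      * of_real (Im z)) * wirtinger_bar j f x"
    unfolding dir_deriv_axis[OF f, of j z] dir_deriv_axis_wd by (simp add: algebra_simps)
  moreover have "of_real (Re z) + \<i> * of_real (Im z) = z" "of_real (Re z) - \<i> * of_real (Im z) = cnj z"
    by (simp_all add: complex_eq_iff)
  ultimately show ?thesis by simp
qed

lemma axis_sum_3: "u = axis 1 (u $ 1) + axis 2 (u $ 2) + axis 3 (u $ 3)" for u :: "complex ^ 3"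
  by (simp add: vec_eq_iff forall_3 axis_def)

lemma dir_deriv_holomorphic:
  assumes "C1 f" "\<And>j. wirtinger_bar j f x = 0"
  shows "dir_deriv u f x = u $ 1 * wirtinger 1 f x + u $ 2 * wirtinger 2 f x + u $ 3 * wirtinger 3 f x"
proof -
  have l: "linear (\<lambda>u. dir_deriv u f x)" using C1_on_differentiable[OF assms(1)] by (intro dir_deriv_linear)
      simp
  have "dir_deriv u f x = dir_deriv (axis 1 (u $ 1) + axis 2 (u $ 2) + axis 3 (u $ 3)) f x" using axis_sum_3[of
      u] by simp
  also have "\<dots> = dir_deriv (axis 1 (u $ 1)) f x + dir_deriv (axis 2 (u $ 2)) f x + dir_deriv (axis 3 (u $ 3)) f
      x"
    using linear_add[OF l] by simp
  finally show ?thesis unfolding dir_deriv_axis_complex[OF assms(1)] assms(2) by simp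
qed

text \<open>An invariant function is determined by its values on a compact fundamental domain, so it is bounded;
  Liouville's theorem applies along every complex line.\<close>

lemma holomorphic_invariant_const:
  assumes t: "norm t < 1" and f: "C1 f" "heis_invariant t f" and h: "\<And>j x. wirtinger_bar j f x = 0"
  shows "f x = f y"
proof -
  define g where "g z = f (x + z *s (y - x))" for z
  have "(g has_field_derivative dir_deriv (y - x) f (x + z *s (y - x))) (at z)" for z
  proof -
    have "((\<lambda>z. x + z *s (y - x)) has_derivative (\<lambda>d. d *s (y - x))) (at z)"
    proof -
      have "bounded_linear (\<lambda>d::complex. d *s (y - x))"
        by (rule linear_conv_bounded_linear[THEN iffD1], rule linearI)
          (auto simp: vec_eq_iff complex_eq_iff algebra_simps)
      then have "((\<lambda>z. z *s (y - x)) has_derivative (\<lambda>d. d *s (y - x))) (at z)"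
        by (rule bounded_linear_imp_has_derivative)
      then show ?thesis using has_derivative_add[OF has_derivative_const] by fastforce
    qed
    then have "(g has_derivative (\<lambda>d. dir_deriv (d *s (y - x)) f (x + z *s (y - x)))) (at z)"
      unfolding g_def by (rule has_derivative_compose) (simp add: C1_on_has_derivative[OF f(1)])
    moreover have "dir_deriv (d *s (y - x)) f (x + z *s (y - x)) = dir_deriv (y - x) f (x + z *s (y - x)) * d"
        for d
      unfolding dir_deriv_holomorphic[OF f(1) h] by (simp add: algebra_simps)
    ultimately show ?thesis unfolding has_field_derivative_def by simp
  qed
  then have "g holomorphic_on UNIV" unfolding holomorphic_on_def field_differentiable_def by (auto intro:
      has_field_derivative_at_within)
  moreover have "bounded (range g)"
    by (rule bounded_subset[OF heis_invariant_bounded[OF t f(2) C1_on_continuous[OF f(1)]]]) (auto simp: g_def)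
  ultimately obtain c where "\<And>z. g z = c" using Liouville_theorem[of g] unfolding constant_on_def by auto
  then have "g 0 = g 1" by simp
  then show ?thesis by (simp add: g_def)
qed

lemma const_of_dd_axis_zero:
  fixes f :: "complex ^ 3 \<Rightarrow> complex"
  assumes "C1 f" "\<And>j x. wirtinger j f x = 0" "\<And>j x. wirtinger_bar j f x = 0"
  shows "f x = f y"
proof -
  have inv: "f (x + axis j z) = f x" for j x z
    by (rule invariant_along_axis[OF assms(1)]) (simp_all add: dir_deriv_axis_wd assms)
  have "x = y + axis 1 ((x - y) $ 1) + axis 2 ((x - y) $ 2) + axis 3 ((x - y) $ 3)"
    unfolding add.assoc axis_sum_3[of "x - y", unfolded add.assoc, symmetric] by simp
  then have "f x = f (y + axis 1 ((x - y) $ 1) + axis 2 ((x - y) $ 2) + axis 3 ((x - y) $ 3))" by (rule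
      arg_cong)
  then show ?thesis unfolding inv .
qed

lemma avgs_shift: "avgs vs (\<lambda>x. f (x + u)) x = avgs vs f (x + u)"
proof (induction vs arbitrary: x)
  case (Cons v vs)
  have "x + r *\<^sub>R v + u = x + u + r *\<^sub>R v" for r by (simp add: add_ac)
  then show ?case unfolding avgs_simps wavg_eq Cons.IH by presburger
qed (simp add: avgs_simps)

lemma wirtinger_avgs: "C1 f \<Longrightarrow> wirtinger j (avgs vs f) x = avgs vs (wirtinger j f) x"
proof (induction vs arbitrary: x)
  case (Cons v vs)
  have "wirtinger j (avgs vs f) = avgs vs (wirtinger j f)" using Cons by blast
  then show ?case using wirtinger_wavg[of "\<lambda>_. 1", OF _ avgs_C1[OF Cons.prems]] by (simp add: avgs_simps)
qed (simp add: avgs_simps)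

section \<open>Degeneracy of closed equivariant Hermitian matrices\<close>

text \<open>Independence of \<open>w\<^sub>3\<close> and closedness make the last row of \<open>G\<close> holomorphic up to conjugation, so
  its entries are constant as soon as they are invariant. Equivariance of the entry \<open>G 1 1\<close>, averaged
  over \<open>w\<^sub>1\<close>, kills \<open>G 3 3\<close> and \<open>G 1 3\<close>. The assumption \<open>t \<noteq> 0\<close> enters through the entry
  \<open>G 2 3\<close>, which is the one that pairs \<open>\<omega>\<^sub>2\<close> with \<open>\<omega>\<^sub>3\<close> on the central fibre.\<close>

lemma average_vertical_vanishes:
  assumes t: "norm t < 1" "t \<noteq> 0" and G: "kaehler_matrix t G"
    and v: "\<And>j k v x. v \<in> set vertical_cycles \<Longrightarrow> dir_deriv v (G j k) x = 0"
  shows "G 3 3 x = 0" "G 1 3 x = 0" "G 2 3 x = 0"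
proof -
  note C = kaehler_matrixD(1)[OF G] and cl = kaehler_matrixD(3)[OF G] and eqv = kaehler_matrixD(4)[OF G]
  have inv3: "G j k (x + axis 3 z) = G j k x" for j k x z
    by (rule invariant_along_axis[OF C]) (auto simp: vertical_cycles_def intro!: v)
  have w3: "wirtinger 3 (G j k) x = 0" for j k x
    using v[of "axis 3 1"] v[of "axis 3 \<i>"] by (simp add: wirtinger_def vertical_cycles_def)
  have cj: "(\<lambda>x. cnj (G j k x)) = G k j" for j k
    using kaehler_matrixD(2)[OF G, of k j] by (simp add: fun_eq_iff)
  have wirtinger_bar_wd: "wirtinger_bar i (G j k) x = cnj (wirtinger i (G k j) x)" for i j k x
    using wirtinger_bar_cnj[OF C, of i j k x] unfolding cj .
  have row3: "wirtinger i (G 3 k) x = 0" for i k x using cl[of i 3 k x] w3 by simp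
  have col3: "wirtinger_bar i (G k 3) x = 0" for i k x using wirtinger_bar_wd[of i k 3 x] row3 by simp
  have c33: "G 3 3 x = G 3 3 y" for x y by (rule const_of_dd_axis_zero[OF C row3 col3])
  have per1: "G j k (x + axis 1 a) = G j k x" if "a \<in> gauss" for j k x a
    using eqv[of a 0 0 j k x] that heis_translation(1)[of t a 0 x] by (simp add: pull_def)
  \<comment> \<open>Averaging over the first variable as well leaves functions of the second one only, so
    closedness makes the entries of the first row constant or antiholomorphic.\<close>
  define A where "A = avgs [axis 1 1, axis 1 \<i> :: complex ^ 3]"
  have AC: "C1 (A (G j k))" for j k unfolding A_def by (rule avgs_C1[OF C])
  have Awd: "wirtinger i (A (G j k)) x = A (wirtinger i (G j k)) x" for i j k x unfolding A_def by (rule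
      wirtinger_avgs[OF C])
  have A0: "A (\<lambda>x. 0) = (\<lambda>x. 0)" unfolding A_def by (rule avgs_zero)
  have Acj: "(\<lambda>x. cnj (A (G j k) x)) = A (G k j)" for j k
    unfolding A_def avgs_cnj[symmetric] cj ..
  have Awdb: "wirtinger_bar i (A (G j k)) x = cnj (wirtinger i (A (G k j)) x)" for i j k x
    using wirtinger_bar_cnj[OF AC, of i j k x] unfolding Acj .
  have A1: "wirtinger 1 (A (G j k)) x = 0" for j k x
  proof -
    have "A (dir_deriv u (G j k)) = (\<lambda>x. 0)" if "u \<in> {axis 1 1, axis 1 \<i>}" for u
      unfolding A_def using that per1[of 1] per1[of \<i>] by (intro avgs_dd_periodic[OF C]) auto
    then have "A (wirtinger 1 (G j k)) = (\<lambda>x. 0)" unfolding A_def by (intro avgs_wd[OF C]) auto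
    then show ?thesis by (simp add: Awd)
  qed
  have A3: "wirtinger 3 (A (G j k)) x = 0" for j k x
  proof -
    have "wirtinger 3 (G j k) = (\<lambda>x. 0)" using w3 by blast
    then show ?thesis using A0 by (simp add: Awd)
  qed
  have A2: "wirtinger 2 (A (G 1 k)) x = 0" for k x
  proof -
    have "wirtinger 2 (G 1 k) = wirtinger 1 (G 2 k)" using cl[of 2 1 k] by blast
    then show ?thesis using A1[of 2 k x] by (simp add: Awd)
  qed
  have Arow1: "wirtinger i (A (G 1 k)) x = 0" for i k x using exhaust_3[of i] A1 A2 A3 by auto
  have Acol1: "wirtinger_bar i (A (G k 1)) x = 0" for i k x using Arow1 by (simp add: Awdb)
  have Acol3: "wirtinger_bar i (A (G k 3)) x = 0" for i k x
  proof -
    have "wirtinger i (G 3 k) = (\<lambda>x. 0)" using row3 by blast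
    then show ?thesis using A0 by (simp add: Awdb Awd)
  qed
  have c11: "A (G 1 1) x = A (G 1 1) y" for x y by (rule const_of_dd_axis_zero[OF AC Arow1 Acol1])
  have c13: "A (G 1 3) x = A (G 1 3) y" for x y by (rule const_of_dd_axis_zero[OF AC Arow1 Acol3])
  have Aconst: "A f = f" if "\<And>x y. f x = f y" for f
  proof -
    have "f = (\<lambda>x. f 0)" using that by blast
    moreover have "A (\<lambda>x. f 0) = (\<lambda>x. f 0)" unfolding A_def by (rule avgs_const)
    ultimately show ?thesis by simp
  qed
  have A33: "A (G 3 3) = G 3 3" by (rule Aconst) (rule c33)
  have add: "A (\<lambda>x. f x + g x) = (\<lambda>x. A f x + A g x)" if "continuous_on UNIV f" "continuous_on UNIV g" for f g
    unfolding A_def by (rule avgs_add[OF that])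
  have cm: "A (\<lambda>x. d * f x) = (\<lambda>x. d * A f x)" for d f unfolding A_def by (rule avgs_cmult)
  have sh: "A (\<lambda>x. G j k (x + u)) x = A (G j k) (x + u)" for j k u x unfolding A_def by (rule avgs_shift)
  have cont: "continuous_on UNIV (\<lambda>x. G j k (x + u))" for j k u
    by (rule continuous_on_compose2[OF kaehler_matrix_continuous[OF G]]) (auto intro!: continuous_on_add
        continuous_on_const continuous_on_id)
  have eqb: "G j k x = pull b (\<lambda>j k. G j k (x + axis 2 (b + t * cnj b))) j k" if "b \<in> gauss" for b j k x
    using eqv[of 0 b 0 j k x] that unfolding heis_translation(2) inv3 by simp
  have e11: "A (G 1 1) x = A (G 1 1) (x + u) + cnj b * A (G 3 1) (x + u) + b * A (G 1 3) (x + u) + (b * cnj b) *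
      G 3 3 (x + u)"
    if b: "b \<in> gauss" and u: "u = axis 2 (b + t * cnj b)" for b u x
  proof -
    have e: "G 1 1 = (\<lambda>x. ((G 1 1 (x + u) + cnj b * G 3 1 (x + u)) + b * G 1 3 (x + u)) + (b * cnj b) * G 3 3 (x
        + u))"
      by (rule ext, rule trans[OF eqb[OF b, of 1 1]]) (simp add: pull_def u)
    have c2: "continuous_on UNIV (\<lambda>x. G 1 1 (x + u) + cnj b * G 3 1 (x + u))"
      by (rule continuous_on_add[OF cont continuous_on_mult_left[OF cont]])
    have c3: "continuous_on UNIV (\<lambda>x. (G 1 1 (x + u) + cnj b * G 3 1 (x + u)) + b * G 1 3 (x + u))"
      by (rule continuous_on_add[OF c2 continuous_on_mult_left[OF cont]])
    have c4: "continuous_on UNIV (\<lambda>x. (b * cnj b) * G 3 3 (x + u))"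
      by (rule continuous_on_mult_left[OF cont])
    have "A (G 1 1) = (\<lambda>x. ((A (\<lambda>x. G 1 1 (x + u)) x + cnj b * A (\<lambda>x. G 3 1 (x + u)) x) + b * A (\<lambda>x. G 1 3 (x +
        u)) x) + (b * cnj b) * A (\<lambda>x. G 3 3 (x + u)) x)"
      using arg_cong[OF e, of A] unfolding add[OF c3 c4] add[OF c2 continuous_on_mult_left[OF cont]]
        add[OF cont continuous_on_mult_left[OF cont]] cm .
    from fun_cong[OF this, of x] show ?thesis unfolding sh A33 .
  qed
  have c31: "A (G 3 1) x = cnj (A (G 1 3) x)" for x using Acj[of 1 3] by metis
  have lin: "cnj b * cnj (A (G 1 3) x) + b * A (G 1 3) x + (b * cnj b) * G 3 3 x = 0" if "b \<in> gauss" for b x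
  proof -
    let ?u = "axis 2 (b + t * cnj b) :: complex ^ 3"
    have "A (G 1 1) x = A (G 1 1) x + cnj b * cnj (A (G 1 3) x) + b * A (G 1 3) x + (b * cnj b) * G 3 3 x"
      using e11[OF that refl, of x] c11[of "x + ?u" x] c13[of "x + ?u" x] c33[of "x + ?u" x] unfolding c31 by
          simp
    then show ?thesis by (simp add: algebra_simps)
  qed
  have z33: "G 3 3 x = 0" for x
  proof -
    let ?a = "A (G 1 3) x"
    have "(cnj ?a + ?a + G 3 3 x) + (- cnj ?a - ?a + G 3 3 x) = 0"
      using lin[of 1 x] lin[of "-1" x] by simp
    then show ?thesis by simp
  qed
  have z13: "A (G 1 3) x = 0" for x
  proof -
    have "cnj (A (G 1 3) x) + A (G 1 3) x = 0" "\<i> * (A (G 1 3) x - cnj (A (G 1 3) x)) = 0"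
      using lin[of 1 x] lin[of \<i> x] z33 by (simp_all add: algebra_simps)
    then show ?thesis by auto
  qed
  have i13: "heis_invariant t (G 1 3)" "heis_invariant t (G 2 3)"
  proof -
    have "G 1 3 (heis t a b c x) = G 1 3 x \<and> G 2 3 (heis t a b c x) = G 2 3 x"
      if "a \<in> gauss" "b \<in> gauss" "c \<in> gauss" for a b c x
      using eqv[OF that, of 1 3 x] eqv[OF that, of 2 3 x] z33 by (simp add: pull_def)
    then show "heis_invariant t (G 1 3)" "heis_invariant t (G 2 3)" unfolding heis_invariant_def by blast+
  qed
  have k13: "G 1 3 x = G 1 3 y" for x y by (rule holomorphic_invariant_const[OF t(1) C i13(1) col3])
  have k23: "G 2 3 x = G 2 3 y" for x y by (rule holomorphic_invariant_const[OF t(1) C i13(2) col3])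
  show "G 3 3 x = 0" by (rule z33)
  show "G 1 3 x = 0" using z13 Aconst[of "G 1 3"] k13 by metis
  \<comment> \<open>The averaged entry \<open>h\<close> of \<open>G 2 1\<close> is periodic only up to the constant \<open>\<kappa> = G 2 3\<close>: along the
    lattice vectors \<open>1 + t\<close> and \<open>\<i> * (1 - t)\<close> it drops by \<open>\<kappa>\<close> and \<open>\<i> * \<kappa>\<close>. Since \<open>h\<close> is holomorphic,
    both drops are multiples of the mean \<open>m\<close> of one complex derivative, which forces \<open>t * m = 0\<close>.\<close>
  define \<kappa> where "\<kappa> = G 2 3 0"
  have \<kappa>: "G 2 3 = (\<lambda>x. \<kappa>)" unfolding \<kappa>_def using k23 by blast
  define h where "h = A (G 2 1)"
  have hC: "C1 h" unfolding h_def by (rule AC)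
  have hb: "wirtinger_bar i h x = 0" for i x unfolding h_def by (rule Acol1)
  have e21: "h (x + axis 2 (b + t * cnj b)) = h x - b * \<kappa>" if b: "b \<in> gauss" for b x
  proof -
    let ?u = "axis 2 (b + t * cnj b) :: complex ^ 3"
    have e: "G 2 1 = (\<lambda>x. G 2 1 (x + ?u) + b * G 2 3 (x + ?u))"
      by (rule ext, rule trans[OF eqb[OF b, of 2 1]]) (simp add: pull_def)
    have "A (G 2 1) = (\<lambda>x. A (\<lambda>x. G 2 1 (x + ?u)) x + b * A (\<lambda>x. G 2 3 (x + ?u)) x)"
      using arg_cong[OF e, of A] unfolding add[OF cont continuous_on_mult_left[OF cont]] cm .
    from fun_cong[OF this, of x] have "h x = h (x + ?u) + b * A (G 2 3) (x + ?u)" unfolding sh h_def .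
    then show ?thesis using Aconst[of "G 2 3"] k23 \<kappa> by simp
  qed
  define u where "u = (axis 2 (1 + t) :: complex ^ 3)"
  define w where "w = (axis 2 (\<i> * (1 - t)) :: complex ^ 3)"
  have hu: "h (x + u) = h x - \<kappa>" and hw: "h (x + w) = h x - \<i> * \<kappa>" for x
    using e21[of 1 x] e21[of \<i> x] unfolding u_def w_def by (simp_all add: algebra_simps)
  define m where "m = avg u (avg w (wirtinger 2 h)) 0"
  have dz: "dir_deriv (axis 2 z) h = (\<lambda>x. z * wirtinger 2 h x)" for z
    using dir_deriv_axis_complex[OF hC, of 2 z] hb by auto
  have "avg w (dir_deriv w h) = (\<lambda>x. - \<i> * \<kappa>)" using avg_dd[OF hC, of w] hw by auto
  moreover have "dir_deriv w h = (\<lambda>x. (\<i> * (1 - t)) * wirtinger 2 h x)" unfolding w_def by (rule dz)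
  ultimately have "(\<lambda>x. (\<i> * (1 - t)) * avg w (wirtinger 2 h) x) = (\<lambda>x. - \<i> * \<kappa>)"
    by (simp only: wavg_cmult)
  from arg_cong[OF this, of "avg u"] have "(\<i> * (1 - t)) * m = - \<i> * \<kappa>"
    unfolding m_def wavg_cmult avg_const by (rule fun_cong)
  moreover have "(1 + t) * m = - \<kappa>"
  proof -
    have wC: "C1 (avg w h)" by (rule wavg_C1[OF _ hC]) simp
    have "avg w (\<lambda>x. h (x + u)) x = avg w h (x + u)" for x
      using avgs_shift[of "[w]" h u x] by (simp add: avgs_simps)
    moreover have "avg w (\<lambda>x. h x + (- \<kappa>)) = (\<lambda>x. avg w h x + avg w (\<lambda>x. - \<kappa>) x)"
      by (rule wavg_add) (auto intro: C1_on_continuous[OF hC])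
    ultimately have sh: "avg w h (x + u) = avg w h x - \<kappa>" for x
      unfolding hu avg_const diff_conv_add_uminus by metis
    have "avg u (avg w (dir_deriv u h)) 0 = avg u (dir_deriv u (avg w h)) 0"
      using dir_deriv_wavg[OF _ hC, of "\<lambda>_. 1" u w] by simp
    also have "\<dots> = - \<kappa>" using avg_dd[OF wC, of u 0] sh[of 0] by simp
    finally have "avg u (avg w (dir_deriv u h)) 0 = - \<kappa>" .
    moreover have "dir_deriv u h = (\<lambda>x. (1 + t) * wirtinger 2 h x)" unfolding u_def by (rule dz)
    ultimately show ?thesis unfolding m_def by (simp only: wavg_cmult)
  qed
  ultimately have "\<i> * ((1 - t) * m) = \<i> * ((1 + t) * m)" by (simp add: mult.assoc)
  then have "(1 - t) * m = (1 + t) * m" by simp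
  then have "t * m = 0" by (simp add: algebra_simps)
  then have "m = 0" using t(2) by simp
  then have "\<kappa> = 0" using \<open>(1 + t) * m = - \<kappa>\<close> by simp
  then show "G 2 3 x = 0" using \<kappa> by simp
qed

lemma mixed_det_real: "kaehler_matrix t H \<Longrightarrow> mixed_det H H H x = of_real (Re (mixed_det H H H x))"
proof -
  assume H: "kaehler_matrix t H"
  have "(\<lambda>j k x. cnj (H k j x)) = H" by (intro ext, rule sym, rule kaehler_matrixD(2)[OF H])
  then have "cnj (mixed_det H H H x) = mixed_det H H H x"
    using mixed_det_transpose_cnj[of H x H H, OF kaehler_matrixD(2)[OF H] kaehler_matrixD(2)[OF H]] by simp
  then show ?thesis by (simp add: complex_eq_iff)
qed

text \<open>By the intermediate value theorem the function has a constant sign, and averages preserve it.\<close>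

lemma nonvanishing_mean:
  assumes "continuous_on UNIV (g :: complex ^ 3 \<Rightarrow> real)" "\<And>x. g x \<noteq> 0"
  shows "avgs vs (\<lambda>x. of_real (g x)) x \<noteq> 0"
proof -
  have "connected (range g)" by (rule connected_continuous_image[OF assms(1) connected_UNIV])
  then have ivt: "a \<le> c \<Longrightarrow> c \<le> b \<Longrightarrow> c \<in> range g" if "a \<in> range g" "b \<in> range g" for a b c
    using that connected_contains_Icc[of "range g" a b] by auto
  have "0 \<notin> range g" using assms(2) by auto
  then have "(\<forall>x. 0 < g x) \<or> (\<forall>x. 0 < - g x)"
    using ivt[OF rangeI rangeI, where c=0] by (metis linorder_not_le neg_0_less_iff_less less_imp_le)
  then show ?thesis
  proof
    assume "\<forall>x. 0 < g x"
    then obtain h where "\<forall>x. 0 < h x" "avgs vs (\<lambda>x. of_real (g x)) = (\<lambda>x. of_real (h x))"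
      using avgs_pos[OF assms(1)] by blast
    then show ?thesis by (simp add: less_imp_neq[symmetric])
  next
    assume "\<forall>x. 0 < - g x"
    then obtain h where h: "\<forall>x. 0 < h x" "avgs vs (\<lambda>x. of_real (- g x)) = (\<lambda>x. of_real (h x))"
      using avgs_pos[OF continuous_on_minus[OF assms(1)]] by blast
    have "avgs vs (\<lambda>x. of_real (- g x)) = (\<lambda>x. (-1) * avgs vs (\<lambda>x. of_real (g x)) x)"
      using avgs_cmult[of vs "-1" "\<lambda>x. of_real (g x)"] by simp
    then have "- avgs vs (\<lambda>x. of_real (g x)) x = of_real (h x)" using h(2) by (metis mult_minus1)
    then show ?thesis using h(1) by (metis add.inverse_neutral of_real_eq_0_iff order_less_irrefl)
  qed
qed

theorem kaehler_matrix_degenerate: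
  assumes t: "norm t < 1" "t \<noteq> 0" and H: "kaehler_matrix t H"
  shows "\<exists>x. mixed_det H H H x = 0"
proof (rule ccontr)
  assume n: "\<not> ?thesis"
  define G1 where "G1 = (\<lambda>j k. avg (axis 3 \<i>) (H j k))"
  define G where "G = (\<lambda>j k. avg (axis 3 1) (G1 j k))"
  have v: "axis 3 1 \<in> set vertical_cycles" "axis 3 \<i> \<in> set vertical_cycles" by (simp_all add:
      vertical_cycles_def)
  have G1: "kaehler_matrix t G1" unfolding G1_def by (rule mean_mix_avg[OF t(1) H v(2)])
  have G: "kaehler_matrix t G" unfolding G_def by (rule mean_mix_avg[OF t(1) G1 v(1)])
  have "mean t (mixed_det H H H) = mean t (mixed_det G1 G1 G1)" unfolding G1_def by (rule mean_mix_avg[OF t(1) H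
      v(2)])
  also have "\<dots> = mean t (mixed_det G G G)" unfolding G_def by (rule mean_mix_avg[OF t(1) G1 v(1)])
  finally have eq: "mean t (mixed_det H H H) = mean t (mixed_det G G G)" .
  have Gf: "G j k = avgs vertical_cycles (H j k)" for j k by (simp add: G_def G1_def vertical_cycles_def
      avgs_simps)
  have per: "H j k (x + axis 3 c) = H j k x" if "c \<in> gauss" for j k x c
    using kaehler_matrixD(4)[OF H, of 0 0 c j k x] that heis_translation(1)[of t 0 c x] by (simp add: pull_def)
  have dd0: "dir_deriv w (G j k) x = 0" if "w \<in> set vertical_cycles" for w j k x
    using avgs_fib_dd[OF kaehler_matrixD(1)[OF H, of j k] _ _ that] per dir_deriv_avgs[OF kaehler_matrixD(1)[OF
        H], of w vertical_cycles j k]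
    unfolding Gf by simp
  have z: "G 3 3 x = 0" "G 1 3 x = 0" "G 2 3 x = 0" for x
    using average_vertical_vanishes[OF t G, of x] dd0 by simp_all
  have "G 3 1 x = 0" "G 3 2 x = 0" for x using kaehler_matrixD(2)[OF G, of 3 1 x] kaehler_matrixD(2)[OF G, of 3
      2 x] z by simp_all
  then have "mixed_det G G G = (\<lambda>x. 0)" unfolding mixed_det_def mixed_cofactor_def sum_3 three_arith using z by
      simp
  then have "mean t (mixed_det H H H) 0 = 0" by (simp add: eq avgs_zero)
  moreover have "continuous_on UNIV (mixed_det H H H)" by (intro mixed_det_continuous
      kaehler_matrix_continuous[OF H])
  then have "avgs (horizontal_cycles t @ vertical_cycles) (\<lambda>x. of_real (Re (mixed_det H H H x))) 0 \<noteq> 0"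
    using n mixed_det_real[OF H] by (intro nonvanishing_mean continuous_on_Re) (auto, metis of_real_0)
  ultimately show False using mixed_det_real[OF H] by (simp add: avgs_append)
qed

section \<open>Smoothness of holomorphic functions of several variables\<close>

text \<open>Complex differentiability at every point. Continuity of the derivative and differentiability of all
  orders follow from Cauchy's formula below.\<close>

definition hol_fun_on :: "(complex ^ 'n::finite) set \<Rightarrow> (complex ^ 'n \<Rightarrow> complex) \<Rightarrow> bool" where
  "hol_fun_on S f \<longleftrightarrow> (\<forall>z\<in>S. f differentiable (at z) \<and> (\<forall>a v. dir_deriv (a *s v) f z = a * dir_deriv v f z))"

text \<open>The circle of radius \<open>r\<close>, parametrized by the unit interval.\<close>

definition circ :: "real \<Rightarrow> real \<Rightarrow> complex" where
  "circ r x = of_real r * exp (2 * of_real pi * \<i> * of_real x)"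

lemma circ_norm: "norm (circ r x) = \<bar>r\<bar>"
  unfolding circ_def by (simp add: norm_mult)

lemma circ_continuous: "continuous_on S (circ r)"
  unfolding circ_def[abs_def] by (intro continuous_intros)

lemma circ_nonzero: "r > 0 \<Longrightarrow> circ r x \<noteq> 0"
  by (simp add: circ_def)

lemma norm_complex_scale: "norm (a *s (v :: complex ^ 'n)) = norm a * norm v"
  by (simp add: norm_vec_def norm_mult L2_set_right_distrib)

lemma cscale_bounded_linear: "bounded_linear (\<lambda>a::complex. a *s (v :: complex ^ 'n))"
  by (rule linear_conv_bounded_linear[THEN iffD1], rule linearI)
    (auto simp: vec_eq_iff complex_eq_iff algebra_simps)

abbreviation circle_mean :: "real \<Rightarrow> complex ^ 'n::finite \<Rightarrow> (complex ^ 'n \<Rightarrow> complex) \<Rightarrow> complex ^ 'n \<Rightarrow> complex"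
    where
  "circle_mean r v \<equiv> shift_int (\<lambda>x. 1 / circ r x) (\<lambda>x. circ r x *s v) 0 1"

text \<open>Cauchy's formula for the first derivative on the complex line through \<open>z\<close> in direction \<open>v\<close>.\<close>

lemma cauchy_directional:
  fixes f :: "complex ^ 'n::finite \<Rightarrow> complex"
  assumes f: "hol_fun_on S f" and S: "\<And>a. norm a \<le> R \<Longrightarrow> z + a *s v \<in> S" and r: "0 < r" "r < R"
  shows "dir_deriv v f z = circle_mean r v f z"
proof -
  define h where "h a = f (z + a *s v)" for a
  have hd: "(h has_field_derivative dir_deriv v f (z + a *s v)) (at a)" if "norm a \<le> R" for a
  proof -
    have "((\<lambda>a. z + a *s v) has_derivative (\<lambda>d. d *s v)) (at a)"
      using has_derivative_add[OF has_derivative_const bounded_linear_imp_has_derivative[OF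
          cscale_bounded_linear]]
      by fastforce
    then have "(h has_derivative (\<lambda>d. dir_deriv (d *s v) f (z + a *s v))) (at a)"
      unfolding h_def
    proof (rule has_derivative_compose)
      show "(f has_derivative (\<lambda>u. dir_deriv u f (z + a *s v))) (at (z + a *s v))"
        using f S[OF that] unfolding hol_fun_on_def by (intro has_derivative_dd) auto
    qed
    moreover have "dir_deriv (d *s v) f (z + a *s v) = dir_deriv v f (z + a *s v) * d" for d
      using f S[OF that] unfolding hol_fun_on_def by simp
    ultimately show ?thesis unfolding has_field_derivative_def by simp
  qed
  have hol: "h holomorphic_on ball 0 R"
    unfolding holomorphic_on_def field_differentiable_def
    using hd by (meson has_field_derivative_at_within mem_ball_0 less_imp_le)
  have "cball 0 r \<subseteq> ball (0::complex) R" using r by auto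
  then have c: "continuous_on (cball 0 r) h" "h holomorphic_on ball 0 r"
    using hol holomorphic_on_imp_continuous_on holomorphic_on_subset ball_subset_cball by (blast, blast)
  have "(deriv ^^ 1) h 0 = (fact 1) / (2 * pi * \<i>) * contour_integral (circlepath 0 r) (\<lambda>u. h u / (u - 0) ^ Suc
      1)"
    using Cauchy_higher_derivative_integral_circlepath(2)[OF c, of 0 1] r
    by (simp add: Cauchy_higher_derivative_integral_circlepath[OF c])
  also have "contour_integral (circlepath 0 r) (\<lambda>u. h u / (u - 0) ^ Suc 1)
      = integral {0..1} (\<lambda>x. h (circ r x) / circ r x ^ 2 * (2 * of_real pi * \<i> * circ r x))"
    unfolding contour_integral_integral
    unfolding vector_derivative_circlepath
    by (rule integral_cong) (simp add: circlepath circ_def power2_eq_square mult_ac)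
  also have "\<dots> = integral {0..1} (\<lambda>x. (2 * of_real pi * \<i>) * (1 / circ r x * h (circ r x)))"
    by (rule integral_cong) (simp add: circ_nonzero[OF r(1)] power2_eq_square)
  also have "\<dots> = (2 * of_real pi * \<i>) * circle_mean r v f z"
    unfolding integral_mult_right shift_int_def h_def ..
  finally have "deriv h 0 = circle_mean r v f z" by simp
  moreover have "deriv h 0 = dir_deriv v f z" using DERIV_imp_deriv[OF hd[of 0]] r by simp
  ultimately show ?thesis by simp
qed

lemma hol_fun_continuous: "hol_fun_on S f \<Longrightarrow> continuous_on S f"
  unfolding hol_fun_on_def
  by (intro continuous_at_imp_continuous_on ballI differentiable_imp_continuous_within) auto

text \<open>The radius can be chosen uniformly for all points near \<open>z\<close> and all holomorphic functions, so the
  formula may be differentiated in \<open>y\<close>.\<close>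

lemma hol_fun_local_mean:
  assumes S: "open S" and z: "z \<in> S"
  obtains T r where "open T" "z \<in> T" "T \<subseteq> S" "r > 0"
    "\<And>y x. y \<in> T \<Longrightarrow> y + circ r x *s v \<in> S"
    "\<And>f y. hol_fun_on S f \<Longrightarrow> y \<in> T \<Longrightarrow> dir_deriv v f y = circle_mean r v f y"
proof -
  obtain e where e: "e > 0" "ball z e \<subseteq> S" using S z open_contains_ball by blast
  define n where "n = norm v + 1"
  have n: "n > 0" unfolding n_def using norm_ge_zero[of v] by linarith
  define R where "R = e / (2 * n)"
  have R: "R > 0" using e n by (simp add: R_def)
  \<comment> \<open>From a point at distance less than \<open>e / 2\<close> from \<open>z\<close>, moving by a multiple of \<open>v\<close> with factor at most
    \<open>R\<close> does not leave the ball; adding one to the norm of \<open>v\<close> covers \<open>v = 0\<close>.\<close>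
  have "R * n = e / 2" using n by (simp add: R_def)
  then have "R * norm v < e / 2" using R unfolding n_def by (simp add: distrib_left)
  have m: "y + a *s v \<in> S" if y: "y \<in> ball z (e / 2)" and a: "norm a \<le> R" for y a
  proof -
    have "norm (a *s v) < e / 2"
      unfolding norm_complex_scale using mult_right_mono[OF a norm_ge_zero[of v]] \<open>R * norm v < e / 2\<close> by
          linarith
    moreover have "norm (y - z) < e / 2" using y by (simp add: dist_norm norm_minus_commute)
    ultimately have "norm ((y - z) + a *s v) < e" using norm_triangle_ineq[of "y - z" "a *s v"] by linarith
    then have "dist z (y + a *s v) < e" by (simp add: dist_norm norm_minus_commute algebra_simps)
    then show ?thesis using e(2) by auto
  qed
  show ?thesis
  proof (rule that[of "ball z (e / 2)" "R / 2"])
    show "ball z (e / 2) \<subseteq> S" using m[of _ 0] R by auto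
    show "y + circ (R / 2) x *s v \<in> S" if "y \<in> ball z (e / 2)" for y x
      using m[OF that] R by (simp add: circ_norm)
    show "dir_deriv v f y = circle_mean (R / 2) v f y" if "hol_fun_on S f" "y \<in> ball z (e / 2)" for f y
      by (rule cauchy_directional[OF that(1) m[OF that(2)]]) (use R in auto)
  qed (use e R in auto)
qed

lemma circ_weight_continuous: "r > 0 \<Longrightarrow> continuous_on {0..1} (\<lambda>x. 1 / circ r x)"
  by (intro continuous_on_divide continuous_on_const circ_continuous) (simp add: circ_nonzero)

lemma circ_shift_continuous: "continuous_on {0..1} (\<lambda>x. circ r x *s (v :: complex ^ 'n))"
  by (rule bounded_linear.continuous_on[OF cscale_bounded_linear circ_continuous])

lemma hol_fun_C1:
  assumes S: "open S" and f: "hol_fun_on S f"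
  shows "C1_on S f"
  unfolding C1_on_def
proof (intro conjI ballI allI)
  show "f differentiable at x" if "x \<in> S" for x using f that by (simp add: hol_fun_on_def)
  fix v
  show "continuous_on S (dir_deriv v f)"
  proof (rule continuous_at_imp_continuous_on, rule ballI)
    fix z assume "z \<in> S"
    from hol_fun_local_mean[OF S this, of v] obtain T r where T: "open T" "z \<in> T" "T \<subseteq> S" "r > 0"
      "\<And>y x. y \<in> T \<Longrightarrow> y + circ r x *s v \<in> S"
      "\<And>f y. hol_fun_on S f \<Longrightarrow> y \<in> T \<Longrightarrow> dir_deriv v f y = circle_mean r v f y" by metis
    have "continuous_on T (circle_mean r v f)"
      by (rule shift_int_continuous[OF circ_weight_continuous[OF T(4)] circ_shift_continuous T(5)
          hol_fun_continuous[OF f]])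
    then have "continuous_on T (dir_deriv v f)" using T(6)[OF f] by (simp cong: continuous_on_cong)
    then show "continuous (at z) (dir_deriv v f)" using T(1,2) continuous_on_eq_continuous_at by blast
  qed
qed

text \<open>Differentiate Cauchy's formula for direction \<open>v\<close> under the integral in direction \<open>u\<close>. The result is
  Cauchy's formula for direction \<open>v\<close> applied to \<open>dir_deriv u f\<close>, which gives the symmetry of second
  derivatives without any further argument.\<close>

lemma
  assumes S: "open S" and f: "hol_fun_on S f"
  shows hol_fun_dd: "hol_fun_on S (dir_deriv v f)"
    and dir_deriv_symmetric: "z \<in> S \<Longrightarrow> dir_deriv u (dir_deriv v f) z = dir_deriv v (dir_deriv u f) z"
proof -
  have key: "dir_deriv v f differentiable (at z) \<and> (\<exists>r. r > 0 \<and> (\<forall>u. dir_deriv u (dir_deriv v f) z = circle_mean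
      r v (dir_deriv u f) z)
      \<and> (\<forall>f. hol_fun_on S f \<longrightarrow> dir_deriv v f z = circle_mean r v f z) \<and> (\<forall>x. z + circ r x *s v \<in> S))" if "z \<in>
          S" for z v
  proof -
    from hol_fun_local_mean[OF S that, of v] obtain T r where T: "open T" "z \<in> T" "T \<subseteq> S" "r > 0"
      "\<And>y x. y \<in> T \<Longrightarrow> y + circ r x *s v \<in> S"
      "\<And>f y. hol_fun_on S f \<Longrightarrow> y \<in> T \<Longrightarrow> dir_deriv v f y = circle_mean r v f y" by metis
    note C = shift_int_C1[OF circ_weight_continuous[OF T(4)] circ_shift_continuous T(1) T(5) hol_fun_C1[OF S f]]
    have eq: "dir_deriv v f y = circle_mean r v f y" if "y \<in> T" for y using T(6)[OF f that] .
    have "circle_mean r v f differentiable (at z)" using C1_on_differentiable[OF C(1) T(2)] by simp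
    then have 1: "dir_deriv v f differentiable (at z)"
      using differentiable_cong_open[OF T(1,2), of "dir_deriv v f" "circle_mean r v f"] eq by simp
    have 2: "dir_deriv u (dir_deriv v f) z = circle_mean r v (dir_deriv u f) z" for u
      using dir_deriv_cong[OF T(1,2), of "dir_deriv v f" "circle_mean r v f" u] eq C(2)[OF _ T(2), of u] by simp
    show ?thesis using 1 2 T by blast
  qed
  have lin: "dir_deriv (a *s u) (dir_deriv v f) z = a * dir_deriv u (dir_deriv v f) z" if z: "z \<in> S" for a u v z
  proof -
    obtain r where r: "r > 0" "\<And>u. dir_deriv u (dir_deriv v f) z = circle_mean r v (dir_deriv u f) z"
        "\<And>x. z + circ r x *s v \<in> S"
      using key[OF z, of v] by blast
    have "circle_mean r v (dir_deriv (a *s u) f) z = integral {0..1} (\<lambda>x. a * (1 / circ r x * dir_deriv u f (z +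
        circ r x *s v)))"
      unfolding shift_int_def
      by (rule integral_cong) (use f r(3) in \<open>simp add: hol_fun_on_def\<close>)
    then show ?thesis unfolding r(2) integral_mult_right shift_int_def .
  qed
  show hd: "hol_fun_on S (dir_deriv v f)" for v
    unfolding hol_fun_on_def using key lin by blast
  show "z \<in> S \<Longrightarrow> dir_deriv u (dir_deriv v f) z = dir_deriv v (dir_deriv u f) z"
    using key[of z v] hd[of u] by metis
qed

lemma Ck_on_cong: "open S \<Longrightarrow> (\<And>x. x \<in> S \<Longrightarrow> f x = g x) \<Longrightarrow> Ck_on k S f \<longleftrightarrow> Ck_on k S g"
proof (induction k arbitrary: f g)
  case 0
  then show ?case by (simp cong: continuous_on_cong)
next
  case (Suc k)
  have "Ck_on k S (\<lambda>x. frechet_derivative f (at x) v) \<longleftrightarrow> Ck_on k S (\<lambda>x. frechet_derivative g (at x) v)" for v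
    by (rule Suc.IH[OF Suc.prems(1)]) (rule dir_deriv_cong[OF Suc.prems(1) _ Suc.prems(2), unfolded
        dir_deriv_def])
  moreover have "f differentiable (at x) \<longleftrightarrow> g differentiable (at x)" if "x \<in> S" for x
    by (rule differentiable_cong_open[OF Suc.prems(1) that Suc.prems(2)])
  ultimately show ?case by simp
qed

text \<open>The derivatives only have to be known on the open set itself.\<close>

lemma Ck_on_SucI:
  assumes "open S" "\<And>x. x \<in> S \<Longrightarrow> f differentiable (at x)"
    and "\<And>v. Ck_on k S (D v)" "\<And>v x. x \<in> S \<Longrightarrow> dir_deriv v f x = D v x"
  shows "Ck_on (Suc k) S f"
proof -
  have "Ck_on k S (\<lambda>x. frechet_derivative f (at x) v)" for v
    using Ck_on_cong[OF assms(1), of "\<lambda>x. frechet_derivative f (at x) v" "D v" k] assms(3,4) unfolding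
        dir_deriv_def by simp
  then show ?thesis using assms(2) by simp
qed

lemma Ck_on_SucD: "Ck_on (Suc k) S f \<Longrightarrow> Ck_on k S f"
proof (induction k arbitrary: f)
  case 0
  then show ?case
    by (auto intro!: continuous_at_imp_continuous_on differentiable_imp_continuous_within)
next
  case (Suc k)
  then show ?case by (metis Ck_on.simps(2))
qed

lemma Ck_on_dd: "Ck_on (Suc k) S f \<Longrightarrow> Ck_on k S (dir_deriv v f)"
  by (simp add: dir_deriv_def[abs_def])

lemma Ck_on_add: "open S \<Longrightarrow> Ck_on k S f \<Longrightarrow> Ck_on k S g \<Longrightarrow> Ck_on k S (\<lambda>x. f x + g x)"
proof (induction k arbitrary: f g)
  case 0
  then show ?case by (simp add: continuous_on_add)
next
  case (Suc k)
  have d: "f differentiable (at x)" "g differentiable (at x)" if "x \<in> S" for x using Suc.prems that by auto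
  show ?case
  proof (rule Ck_on_SucI[OF Suc.prems(1)])
    show "Ck_on k S (\<lambda>x. dir_deriv v f x + dir_deriv v g x)" for v
      by (rule Suc.IH[OF Suc.prems(1) Ck_on_dd[OF Suc.prems(2)] Ck_on_dd[OF Suc.prems(3)]])
  qed (simp_all add: d dir_deriv_add)
qed

lemma Ck_on_mult: "open S \<Longrightarrow> Ck_on k S f \<Longrightarrow> Ck_on k S g \<Longrightarrow> Ck_on k S (\<lambda>x. f x * g x)"
proof (induction k arbitrary: f g)
  case 0
  then show ?case by (simp add: continuous_on_mult)
next
  case (Suc k)
  have d: "f differentiable (at x)" "g differentiable (at x)" if "x \<in> S" for x using Suc.prems that by auto
  show ?case
  proof (rule Ck_on_SucI[OF Suc.prems(1)])
    show "Ck_on k S (\<lambda>x. f x * dir_deriv v g x + dir_deriv v f x * g x)" for v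
      by (rule Ck_on_add[OF Suc.prems(1) Suc.IH[OF Suc.prems(1) Ck_on_SucD[OF Suc.prems(2)] Ck_on_dd[OF
          Suc.prems(3)]]
            Suc.IH[OF Suc.prems(1) Ck_on_dd[OF Suc.prems(2)] Ck_on_SucD[OF Suc.prems(3)]]])
  qed (simp_all add: d dir_deriv_mult)
qed

lemma Ck_on_const: "open S \<Longrightarrow> Ck_on k S (\<lambda>x. c)"
  by (induction k arbitrary: c) auto

lemma Ck_on_cmult: "open S \<Longrightarrow> Ck_on k S f \<Longrightarrow> Ck_on k S (\<lambda>x. c * f x)"
  by (rule Ck_on_mult[OF _ Ck_on_const])

lemma Ck_on_local:
  assumes "\<And>z. z \<in> S \<Longrightarrow> \<exists>N. open N \<and> z \<in> N \<and> N \<subseteq> S \<and> Ck_on k N f"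
  shows "Ck_on k S f"
  using assms
proof (induction k arbitrary: f)
  case 0
  show ?case unfolding Ck_on.simps
  proof (rule continuous_at_imp_continuous_on, rule ballI)
    fix z assume "z \<in> S"
    then obtain N where "open N" "z \<in> N" "continuous_on N f" using 0 by force
    then show "continuous (at z) f" using continuous_on_eq_continuous_at by blast
  qed
next
  case (Suc k)
  have "f differentiable (at z)" if "z \<in> S" for z using Suc.prems[OF that] by auto
  moreover have "Ck_on k S (\<lambda>x. frechet_derivative f (at x) v)" for v
  proof (rule Suc.IH)
    fix z assume "z \<in> S"
    then show "\<exists>N. open N \<and> z \<in> N \<and> N \<subseteq> S \<and> Ck_on k N (\<lambda>x. frechet_derivative f (at x) v)"
      using Suc.prems[of z] by auto
  qed
  ultimately show ?case by simp
qed

definition complex_smooth_on :: "'e::euclidean_space set \<Rightarrow> ('e \<Rightarrow> complex) \<Rightarrow> bool" where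
  "complex_smooth_on S f \<longleftrightarrow> (\<forall>k. Ck_on k S (\<lambda>x. Re (f x)) \<and> Ck_on k S (\<lambda>x. Im (f x)))"

lemma complex_smooth_add:
  "open S \<Longrightarrow> complex_smooth_on S f \<Longrightarrow> complex_smooth_on S g \<Longrightarrow> complex_smooth_on S (\<lambda>x. f x + g x)"
  unfolding complex_smooth_on_def by (simp add: Ck_on_add)

lemma complex_smooth_const: "open S \<Longrightarrow> complex_smooth_on S (\<lambda>x. c)"
  unfolding complex_smooth_on_def by (simp add: Ck_on_const)

lemma complex_smooth_mult:
  assumes "open S" "complex_smooth_on S f" "complex_smooth_on S g"
  shows "complex_smooth_on S (\<lambda>x. f x * g x)"
proof -
  have "Ck_on k S (\<lambda>x. Re (f x) * Re (g x) + (- 1) * (Im (f x) * Im (g x)))"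
    "Ck_on k S (\<lambda>x. Re (f x) * Im (g x) + Im (f x) * Re (g x))" for k
    using assms unfolding complex_smooth_on_def by (simp_all only: Ck_on_add Ck_on_mult Ck_on_cmult)
  then show ?thesis unfolding complex_smooth_on_def by simp
qed

lemma complex_smooth_cnj:
  assumes "open S" "complex_smooth_on S f" shows "complex_smooth_on S (\<lambda>x. cnj (f x))"
proof -
  have "Ck_on k S (\<lambda>x. (- 1) * Im (f x))" for k
    using assms unfolding complex_smooth_on_def by (simp only: Ck_on_cmult)
  then show ?thesis using assms unfolding complex_smooth_on_def by simp
qed

lemma hol_fun_Ck:
  assumes S: "open S" and L: "bounded_linear L"
  shows "hol_fun_on S f \<Longrightarrow> Ck_on k S (\<lambda>x. L (f x))"
proof (induction k arbitrary: f)
  case 0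
  show ?case unfolding Ck_on.simps by (rule bounded_linear.continuous_on[OF L hol_fun_continuous[OF 0]])
next
  case (Suc k)
  have d: "f differentiable (at x)" if "x \<in> S" for x using Suc.prems that by (simp add: hol_fun_on_def)
  show ?case
  proof (rule Ck_on_SucI[OF S])
    show "(\<lambda>x. L (f x)) differentiable (at x)" if "x \<in> S" for x
      using bounded_linear.has_derivative[OF L has_derivative_dd[OF d[OF that]]] unfolding differentiable_def by
          blast
    show "Ck_on k S (\<lambda>x. L (dir_deriv v f x))" for v by (rule Suc.IH[OF hol_fun_dd[OF S Suc.prems]])
  qed (rule dir_deriv_bounded_linear[OF L d])
qed

lemma hol_fun_smooth: "open S \<Longrightarrow> hol_fun_on S f \<Longrightarrow> complex_smooth_on S f"
  unfolding complex_smooth_on_def by (simp add: hol_fun_Ck bounded_linear_Re bounded_linear_Im)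

text \<open>Three holomorphic functions give \<open>- (\<i>/2) \<partial>f1 \<otimes> cnj \<partial>f1 + \<partial>f2 \<otimes> cnj \<partial>f3 - f2 \<partial>f2 \<otimes> cnj \<partial>f1\<close>. The
  real part of its antisymmetrization is the model form pulled back by \<open>(f1, f2, f3)\<close>.\<close>

definition model_term :: "(complex ^ 'n::finite \<Rightarrow> complex) \<Rightarrow> (complex ^ 'n \<Rightarrow> complex) \<Rightarrow> (complex ^ 'n \<Rightarrow> complex)
    \<Rightarrow>
    complex ^ 'n \<Rightarrow> complex ^ 'n \<Rightarrow> complex ^ 'n \<Rightarrow> complex" where
  "model_term f1 f2 f3 u v z = (- \<i> / 2) * (dir_deriv u f1 z * cnj (dir_deriv v f1 z)) + dir_deriv u f2 z * cnj
      (dir_deriv v f3 z)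
     + (- 1) * (f2 z * (dir_deriv u f2 z * cnj (dir_deriv v f1 z)))"

lemma model_smooth:
  assumes S: "open S" and f: "hol_fun_on S f1" "hol_fun_on S f2" "hol_fun_on S f3"
  shows "smooth_on S (\<lambda>z. Re (model_term f1 f2 f3 u v z - model_term f1 f2 f3 v u z))"
proof -
  note h = hol_fun_smooth[OF S]
  have T: "complex_smooth_on S (model_term f1 f2 f3 u v)" for u v
    unfolding model_term_def[abs_def]
    by (intro complex_smooth_add[OF S] complex_smooth_mult[OF S] complex_smooth_cnj[OF S]
        complex_smooth_const[OF S]
        h[OF hol_fun_dd[OF S f(1)]] h[OF hol_fun_dd[OF S f(2)]] h[OF hol_fun_dd[OF S f(3)]] h[OF f(2)])
  have "complex_smooth_on S (\<lambda>z. model_term f1 f2 f3 u v z + (- 1) * model_term f1 f2 f3 v u z)"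
    by (intro complex_smooth_add[OF S] complex_smooth_mult[OF S] complex_smooth_const[OF S] T)
  then show ?thesis unfolding complex_smooth_on_def smooth_on_def by simp
qed

text \<open>The second derivatives cancel by symmetry. The derivative of the coefficient \<open>f2\<close> contributes only
  terms containing \<open>df2 \<and> df2 = 0\<close>.\<close>

lemma model_closed:
  assumes S: "open S" and z: "z \<in> S" and f: "hol_fun_on S f1" "hol_fun_on S f2" "hol_fun_on S f3"
  defines "F \<equiv> \<lambda>u v z. Re (model_term f1 f2 f3 u v z - model_term f1 f2 f3 v u z)"
  shows "dir_deriv u (F v w) z - dir_deriv v (F u w) z + dir_deriv w (F u v) z = 0"
proof -
  let ?T = "model_term f1 f2 f3"
  have d: "f differentiable (at z)" "dir_deriv v f differentiable (at z)"
      "(\<lambda>z. cnj (dir_deriv v f z)) differentiable (at z)"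
      "dir_deriv a (\<lambda>z. cnj (dir_deriv v f z)) z = cnj (dir_deriv a (dir_deriv v f) z)" if "hol_fun_on S f" for
          f v a
  proof -
    show "f differentiable (at z)" "dir_deriv v f differentiable (at z)"
      using that hol_fun_dd[OF S that] z by (simp_all add: hol_fun_on_def)
    then show "(\<lambda>z. cnj (dir_deriv v f z)) differentiable (at z)"
        "dir_deriv a (\<lambda>z. cnj (dir_deriv v f z)) z = cnj (dir_deriv a (dir_deriv v f) z)"
      using bounded_linear.has_derivative[OF bounded_linear_cnj has_derivative_dd] dir_deriv_bounded_linear[OF
          bounded_linear_cnj]
      unfolding differentiable_def by blast+
  qed
  note dir_deriv' = d[OF f(1)] d[OF f(2)] d[OF f(3)]
  have T: "?T u v differentiable (at z)" for u v
    unfolding model_term_def[abs_def] by (intro differentiable_add differentiable_mult differentiable_const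
        dir_deriv')
  have dT: "dir_deriv a (?T u v) z = (- \<i> / 2) * (dir_deriv u f1 z * cnj (dir_deriv a (dir_deriv v f1) z) +
      dir_deriv a (dir_deriv u f1) z * cnj (dir_deriv v f1 z))
      + (dir_deriv u f2 z * cnj (dir_deriv a (dir_deriv v f3) z) + dir_deriv a (dir_deriv u f2) z * cnj
          (dir_deriv v f3 z))
      - (f2 z * (dir_deriv u f2 z * cnj (dir_deriv a (dir_deriv v f1) z) + dir_deriv a (dir_deriv u f2) z * cnj
          (dir_deriv v f1 z)) + dir_deriv a f2 z * (dir_deriv u f2 z * cnj (dir_deriv v f1 z)))"
    for a u v
    unfolding model_term_def[abs_def]
    by (simp only: dir_deriv_add dir_deriv_mult dir_deriv_const dir_deriv' differentiable_mult
        differentiable_add differentiable_const) simp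
  have dF: "dir_deriv a (F u v) z = Re (dir_deriv a (?T u v) z - dir_deriv a (?T v u) z)" for a u v
  proof -
    have "dir_deriv a (\<lambda>z. ?T u v z - ?T v u z) z = dir_deriv a (?T u v) z - dir_deriv a (?T v u) z"
      by (rule dir_deriv_eqI[where D="\<lambda>a. dir_deriv a (?T u v) z - dir_deriv a (?T v u) z"]) (intro
          has_derivative_diff has_derivative_dd T)
    moreover have "(\<lambda>z. ?T u v z - ?T v u z) differentiable (at z)" by (intro differentiable_diff T)
    ultimately show ?thesis unfolding F_def using dir_deriv_bounded_linear[OF bounded_linear_Re, of
        "\<lambda>z. ?T u v z - ?T v u z" z a] by simp
  qed
  note sy = dir_deriv_symmetric[OF S _ z]
  have "(dir_deriv u (?T v w) z - dir_deriv u (?T w v) z) - (dir_deriv v (?T u w) z - dir_deriv v (?T w u) z) +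
      (dir_deriv w (?T u v) z - dir_deriv w (?T v u) z) = 0"
    unfolding dT sy[OF f(1), of v u] sy[OF f(1), of w u] sy[OF f(1), of w v]
      sy[OF f(2), of v u] sy[OF f(2), of w u] sy[OF f(2), of w v]
      sy[OF f(3), of v u] sy[OF f(3), of w u] sy[OF f(3), of w v]
    by (simp add: algebra_simps)
  then show ?thesis unfolding dF by (simp flip: minus_complex.sel plus_complex.sel)
qed

section \<open>Complex derivatives of maps\<close>

definition has_cderiv :: "(complex ^ 'n::finite \<Rightarrow> complex ^ 'm::finite) \<Rightarrow> (complex ^ 'n \<Rightarrow> complex ^ 'm) \<Rightarrow>
    complex ^ 'n \<Rightarrow> bool" where
  "has_cderiv f D z \<longleftrightarrow> (f has_derivative D) (at z) \<and> (\<forall>(a::complex) v. D (a *s v) = a *s D v)"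

lemma holomorphic_map_on_iff: "holomorphic_map_on S f \<longleftrightarrow> (\<forall>z\<in>S. \<exists>D. has_cderiv f D z)"
  by (simp add: holomorphic_map_on_def has_cderiv_def)

lemma holomorphic_immersion_on_iff: "holomorphic_immersion_on S f \<longleftrightarrow> (\<forall>z\<in>S. \<exists>D. has_cderiv f D z \<and> inj D)"
  by (simp add: holomorphic_immersion_on_def has_cderiv_def conj_assoc)

lemma has_cderiv_compose: "has_cderiv f D z \<Longrightarrow> has_cderiv g D' (f z) \<Longrightarrow> has_cderiv (g \<circ> f) (D' \<circ> D) z"
  unfolding has_cderiv_def by (simp add: diff_chain_at)

lemma has_cderiv_cong:
  assumes "has_cderiv f D z" "open N" "z \<in> N" "\<And>y. y \<in> N \<Longrightarrow> f y = g y"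
  shows "has_cderiv g D z"
  using assms has_derivative_transform_within_open[of f D z UNIV N g] unfolding has_cderiv_def by auto

lemma has_cderiv_id: "has_cderiv id id z"
  by (simp add: has_cderiv_def has_derivative_id)

lemma has_cderiv_unique: "has_cderiv f D z \<Longrightarrow> has_cderiv f D' z \<Longrightarrow> D = D'"
  unfolding has_cderiv_def using has_derivative_unique by blast

lemma has_cderiv_linear: "has_cderiv f D z \<Longrightarrow> linear D"
  unfolding has_cderiv_def using has_derivative_linear by blast

text \<open>Equality of dimensions makes an injective derivative bijective. A continuous inverse is then
  differentiable, with the inverse derivative, which is again complex linear.\<close>

lemma has_cderiv_inverse:
  fixes f :: "complex ^ 'n::finite \<Rightarrow> complex ^ 'n"
  assumes f: "has_cderiv f D (g y)" and D: "inj D" and g: "continuous (at y) g"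
    and T: "open T" "y \<in> T" "\<And>z. z \<in> T \<Longrightarrow> f (g z) = z"
  obtains D' where "has_cderiv g D' y" "inj D'"
proof -
  note l = has_cderiv_linear[OF f]
  then obtain D' where D': "linear D'" "D' \<circ> D = id"
    using linear_injective_left_inverse D by blast
  then have D2: "D \<circ> D' = id" using linear_inverse_left[OF l D'(1)] by simp
  have "D' (a *s v) = a *s D' v" for a v
  proof -
    have "D' (a *s v) = D' (a *s D (D' v))" using D2 by (metis comp_apply id_apply)
    also have "\<dots> = D' (D (a *s D' v))" using f by (simp add: has_cderiv_def)
    also have "\<dots> = a *s D' v" using D'(2) by (metis comp_apply id_apply)
    finally show ?thesis .
  qed
  moreover have "(g has_derivative D') (at y)"
    by (rule has_derivative_inverse_basic[OF _ _ D'(2) g T])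
      (use f D'(1) in \<open>simp_all add: has_cderiv_def linear_linear\<close>)
  moreover have "inj D'" using D2 by (metis comp_apply id_apply injI)
  ultimately show ?thesis using that[of D'] by (simp add: has_cderiv_def)
qed

section \<open>Charts\<close>

context
  fixes T :: "'a topology" and c :: "('a, 'n::finite) chart"
  assumes c: "is_chart T c"
begin

lemma chart_inj: "inj_on (snd c) (fst c)"
proof -
  have "topspace (subtopology T (fst c)) = fst c"
    using c openin_subset unfolding is_chart_def by fastforce
  then show ?thesis using c homeomorphic_imp_injective_map unfolding is_chart_def by metis
qed

lemma chart_inv_left: "p \<in> fst c \<Longrightarrow> chart_inv c (snd c p) = p"
  unfolding chart_inv_def by (rule inv_into_f_f[OF chart_inj])

lemma chart_inv_right: "z \<in> snd c ` fst c \<Longrightarrow> chart_inv c z \<in> fst c \<and> snd c (chart_inv c z) = z"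
  unfolding chart_inv_def by (simp add: f_inv_into_f inv_into_into)

lemma chart_image_open: "openin T W \<Longrightarrow> W \<subseteq> fst c \<Longrightarrow> open (snd c ` W)"
proof -
  assume W: "openin T W" "W \<subseteq> fst c"
  have "openin (subtopology T (fst c)) W" using W c by (simp add: is_chart_def openin_open_subtopology)
  then have "openin (top_of_set (snd c ` fst c)) (snd c ` W)"
    using c homeomorphic_imp_open_map unfolding is_chart_def open_map_def by blast
  then show ?thesis using c openin_open_trans unfolding is_chart_def by blast
qed

lemma chart_preimage_open: "open Q \<Longrightarrow> openin T {p \<in> fst c. snd c p \<in> Q}"
proof -
  assume Q: "open Q"
  have co: "continuous_map (subtopology T (fst c)) (top_of_set (snd c ` fst c)) (snd c)"
    using c homeomorphic_imp_continuous_map unfolding is_chart_def by blast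
  have "openin (top_of_set (snd c ` fst c)) (snd c ` fst c \<inter> Q)" using Q by (simp add: openin_open_Int)
  from openin_continuous_map_preimage[OF co this]
  have "openin (subtopology T (fst c)) {p \<in> topspace (subtopology T (fst c)). snd c p \<in> snd c ` fst c \<inter> Q}" .
  moreover have "topspace (subtopology T (fst c)) = fst c"
    using c openin_subset unfolding is_chart_def by fastforce
  then have "{p \<in> topspace (subtopology T (fst c)). snd c p \<in> snd c ` fst c \<inter> Q} = {p \<in> fst c. snd c p \<in> Q}"
    by auto
  moreover have "openin T (fst c)" using c by (simp add: is_chart_def)
  ultimately show ?thesis by (metis openin_open_subtopology)
qed

lemma chart_domain_open: "openin T (fst c)"
  using c by (simp add: is_chart_def)

text \<open>Statements about transition maps are local; this supplies the neighbourhood, in coordinates, on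
  which a composition through a third chart makes sense.\<close>

lemma chart_neighbourhood:
  assumes "openin T W" "p \<in> fst c" "p \<in> W"
  obtains N where "open N" "snd c p \<in> N" "N \<subseteq> snd c ` fst c" "\<And>y. y \<in> N \<Longrightarrow> chart_inv c y \<in> W"
proof (rule that[of "snd c ` (fst c \<inter> W)"])
  show "open (snd c ` (fst c \<inter> W))"
    by (rule chart_image_open) (use assms chart_domain_open in auto)
  show "chart_inv c y \<in> W" if "y \<in> snd c ` (fst c \<inter> W)" for y
    using that chart_inv_left by auto
qed (use assms in auto)

end

text \<open>A maximal atlas as soon as the charts in \<open>B\<close> cover the space and are compatible with each other.\<close>

definition generated_atlas :: "'a topology \<Rightarrow> ('a, 'n::finite) chart set \<Rightarrow> ('a, 'n) chart set" where
  "generated_atlas T B = {c. is_chart T c \<and> (\<forall>d\<in>B. holomorphically_compatible c d)}"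

lemma compatible_iff:
  assumes "is_chart T c" "is_chart T d"
  shows "holomorphically_compatible c d \<longleftrightarrow>
    (\<forall>p\<in>fst c \<inter> fst d. (\<exists>D. has_cderiv (snd d \<circ> chart_inv c) D (snd c p)) \<and> (\<exists>D. has_cderiv (snd c \<circ> chart_inv
        d) D (snd d p)))"
  unfolding holomorphically_compatible_def holomorphic_map_on_iff by blast

text \<open>The two transition maps are inverse to each other, hence so are their derivatives.\<close>

lemma compatible_derivative:
  assumes c: "is_chart T c" and d: "is_chart T d" and cd: "holomorphically_compatible c d"
    and p: "p \<in> fst c" "p \<in> fst d"
  obtains D where "has_cderiv (snd d \<circ> chart_inv c) D (snd c p)" "bij D"
proof -
  obtain D D' where D: "has_cderiv (snd d \<circ> chart_inv c) D (snd c p)"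
      "has_cderiv (snd c \<circ> chart_inv d) D' (snd d p)"
    using cd p unfolding compatible_iff[OF c d] by blast
  have *: "D2 \<circ> D1 = id"
    if c: "is_chart T c" and d: "is_chart T d" and p: "p \<in> fst c" "p \<in> fst d"
      and D1: "has_cderiv (snd d \<circ> chart_inv c) D1 (snd c p)" and D2:
          "has_cderiv (snd c \<circ> chart_inv d) D2 (snd d p)"
    for c d :: "('a, 'b) chart" and D1 D2
  proof -
    obtain N where N: "open N" "snd c p \<in> N" "N \<subseteq> snd c ` fst c" "\<And>y. y \<in> N \<Longrightarrow> chart_inv c y \<in> fst d"
      using chart_neighbourhood[OF c chart_domain_open[OF d] p] by blast
    have "(snd d \<circ> chart_inv c) (snd c p) = snd d p" by (simp add: chart_inv_left[OF c p(1)])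
    then have "has_cderiv ((snd c \<circ> chart_inv d) \<circ> (snd d \<circ> chart_inv c)) (D2 \<circ> D1) (snd c p)"
      using has_cderiv_compose[OF D1] D2 by metis
    moreover have "((snd c \<circ> chart_inv d) \<circ> (snd d \<circ> chart_inv c)) y = id y" if "y \<in> N" for y
      using N(3,4) that chart_inv_left[OF d] chart_inv_right[OF c] by auto
    ultimately have "has_cderiv id (D2 \<circ> D1) (snd c p)" using has_cderiv_cong[OF _ N(1,2)] by blast
    then show ?thesis using has_cderiv_unique has_cderiv_id by blast
  qed
  have "D' \<circ> D = id" "D \<circ> D' = id" using *[OF c d p D] *[OF d c p(2,1) D(2,1)] .
  then show ?thesis using that[OF D(1)] o_bij by blast
qed

text \<open>At each common point, factor the transition map through a chart that is compatible with both.\<close>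

lemma compatible_transitive:
  assumes c: "is_chart T c" and e: "is_chart T e"
    and B: "\<And>p. p \<in> fst c \<inter> fst e \<Longrightarrow>
      \<exists>d. is_chart T d \<and> p \<in> fst d \<and> holomorphically_compatible c d \<and> holomorphically_compatible e d"
  shows "holomorphically_compatible c e"
proof -
  have *: "\<exists>D. has_cderiv (snd e \<circ> chart_inv c) D (snd c p)"
    if c: "is_chart T c" and e: "is_chart T e" and d: "is_chart T d" and p: "p \<in> fst c" "p \<in> fst e" "p \<in> fst d"
      and cd: "holomorphically_compatible c d" and ed: "holomorphically_compatible e d" for c d e ::
          "('a, 'b) chart" and p
  proof -
    obtain D1 D2 where D: "has_cderiv (snd d \<circ> chart_inv c) D1 (snd c p)"
        "has_cderiv (snd e \<circ> chart_inv d) D2 (snd d p)"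
      using cd ed p unfolding compatible_iff[OF c d] compatible_iff[OF e d] by blast
    obtain N where N: "open N" "snd c p \<in> N" "N \<subseteq> snd c ` fst c" "\<And>y. y \<in> N \<Longrightarrow> chart_inv c y \<in> fst d"
      using chart_neighbourhood[OF c chart_domain_open[OF d] p(1,3)] by blast
    have "(snd d \<circ> chart_inv c) (snd c p) = snd d p" by (simp add: chart_inv_left[OF c p(1)])
    then have "has_cderiv ((snd e \<circ> chart_inv d) \<circ> (snd d \<circ> chart_inv c)) (D2 \<circ> D1) (snd c p)"
      using has_cderiv_compose[OF D(1)] D(2) by metis
    moreover have "((snd e \<circ> chart_inv d) \<circ> (snd d \<circ> chart_inv c)) y = (snd e \<circ> chart_inv c) y" if "y \<in> N" for y
      using N(4)[OF that] chart_inv_left[OF d] by auto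
    ultimately show ?thesis using has_cderiv_cong[OF _ N(1,2)] by blast
  qed
  show ?thesis unfolding compatible_iff[OF c e] using *[OF c e] *[OF e c] B by blast
qed

lemma generated_atlas_complex_manifold:
  assumes T: "Hausdorff_space T" "second_countable T"
    and B: "\<And>c. c \<in> B \<Longrightarrow> is_chart T c" "\<And>c d. c \<in> B \<Longrightarrow> d \<in> B \<Longrightarrow> holomorphically_compatible c d"
    and cover: "topspace T \<subseteq> (\<Union>c\<in>B. fst c)"
  shows "complex_manifold \<lparr>mtop = T, atlas = generated_atlas T B\<rparr>"
  unfolding complex_manifold_def cmfd.simps
proof (intro conjI ballI allI impI T)
  have sub: "B \<subseteq> generated_atlas T B" using B by (auto simp: generated_atlas_def)
  have ch: "is_chart T c" if "c \<in> generated_atlas T B" for c using that by (simp add: generated_atlas_def)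
  show "(\<Union>c\<in>generated_atlas T B. fst c) = topspace T"
  proof
    show "(\<Union>c\<in>generated_atlas T B. fst c) \<subseteq> topspace T"
      using ch openin_subset unfolding is_chart_def by blast
    show "topspace T \<subseteq> (\<Union>c\<in>generated_atlas T B. fst c)" using sub cover by blast
  qed
  show "holomorphically_compatible c d" if cd: "c \<in> generated_atlas T B" "d \<in> generated_atlas T B" for c d
  proof (rule compatible_transitive[OF ch[OF cd(1)] ch[OF cd(2)]])
    fix p assume p: "p \<in> fst c \<inter> fst d"
    then have "p \<in> topspace T" using ch[OF cd(1)] openin_subset unfolding is_chart_def by blast
    then obtain b where "b \<in> B" "p \<in> fst b" using cover by blast
    then show "\<exists>b. is_chart T b \<and> p \<in> fst b \<and> holomorphically_compatible c b \<and> holomorphically_compatible d b"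
      using cd B(1) unfolding generated_atlas_def by blast
  qed
  show "c \<in> generated_atlas T B" if "is_chart T c \<and> (\<forall>d\<in>generated_atlas T B. holomorphically_compatible c d)"
      for c
    using that sub by (auto simp: generated_atlas_def)
qed (simp add: generated_atlas_def)

section \<open>Quotients\<close>

text \<open>The local inverses of the quotient map serve as charts.\<close>

definition section_chart :: "(complex ^ 'n::finite \<Rightarrow> 'a) \<Rightarrow> (complex ^ 'n) set \<Rightarrow> ('a, 'n) chart" where
  "section_chart q U = (q ` U, inv_into U q)"

definition section_charts :: "(complex ^ 'n::finite) set \<Rightarrow> (complex ^ 'n \<Rightarrow> 'a) \<Rightarrow> ('a, 'n) chart set" where
  "section_charts E q = section_chart q ` {U. open U \<and> U \<subseteq> E \<and> inj_on q U}"

text \<open>Quotients of open subsets of complex space by a properly discontinuous holomorphic action, without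
  mentioning the group: the condition \<open>deck\<close> says that two points with the same image are related by a
  local holomorphic map over the quotient.\<close>

locale holomorphic_quotient =
  fixes E :: "(complex ^ 'n::finite) set" and q :: "complex ^ 'n \<Rightarrow> 'a" and T :: "'a topology"
  assumes E_open: "open E" and topspace_eq: "topspace T = q ` E"
    and q_continuous: "continuous_map (top_of_set E) T q" and q_open: "open_map (top_of_set E) T q"
    and locally_inj: "x \<in> E \<Longrightarrow> \<exists>U. open U \<and> x \<in> U \<and> U \<subseteq> E \<and> inj_on q U"
    and deck: "x \<in> E \<Longrightarrow> y \<in> E \<Longrightarrow> q x = q y \<Longrightarrow>
      \<exists>N g. open N \<and> x \<in> N \<and> N \<subseteq> E \<and> g x = y \<and> g ` N \<subseteq> E \<and> (\<forall>n\<in>N. q (g n) = q n) \<and> holomorphic_map_on N g"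
begin

abbreviation "good U \<equiv> open U \<and> U \<subseteq> E \<and> inj_on q U"

lemma section_chart_apply: "good U \<Longrightarrow> x \<in> U \<Longrightarrow> snd (section_chart q U) (q x) = x"
  by (simp add: section_chart_def)

lemma section_chart_dom: "fst (section_chart q U) = q ` U"
  by (simp add: section_chart_def)

lemma section_chart_image: "good U \<Longrightarrow> snd (section_chart q U) ` fst (section_chart q U) = U"
  by (auto simp: section_chart_def image_image)

lemma section_chart_inv: "good U \<Longrightarrow> x \<in> U \<Longrightarrow> chart_inv (section_chart q U) x = q x"
proof -
  assume U: "good U" "x \<in> U"
  have "inj_on (inv_into U q) (q ` U)" by (rule inj_on_inv_into) simp
  then have "inv_into (q ` U) (inv_into U q) (inv_into U q (q x)) = q x"
    by (rule inv_into_f_f) (use U in simp)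
  then show ?thesis using U by (simp add: chart_inv_def section_chart_def)
qed

lemma image_open: "open U \<Longrightarrow> U \<subseteq> E \<Longrightarrow> openin T (q ` U)"
  using q_open E_open unfolding open_map_def by (simp add: openin_open_eq)

lemma preimage_open: "openin T W \<Longrightarrow> open {x \<in> E. q x \<in> W}"
  using openin_continuous_map_preimage[OF q_continuous] E_open by (auto simp: openin_open_eq)

lemma section_chart_is_chart: "good U \<Longrightarrow> is_chart T (section_chart q U)"
proof -
  assume U: "good U"
  have ET: "openin (top_of_set E) U" using U by (simp add: openin_open_eq E_open)
  have hom: "homeomorphic_map (top_of_set U) (subtopology T (q ` U)) q"
  proof (rule bijective_open_imp_homeomorphic_map)
    have s: "top_of_set U = subtopology (top_of_set E) U" using U by (simp add: subtopology_subtopology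
        Int_absorb1)
    show "continuous_map (top_of_set U) (subtopology T (q ` U)) q"
      unfolding s using continuous_map_from_subtopology[OF q_continuous, of U]
      by (auto simp: continuous_map_in_subtopology)
    show "open_map (top_of_set U) (subtopology T (q ` U)) q"
      unfolding s using U by (intro open_map_into_subtopology open_map_from_subtopology[OF q_open ET]) auto
    show "q ` topspace (top_of_set U) = topspace (subtopology T (q ` U))" using U topspace_eq by auto
    show "inj_on q (topspace (top_of_set U))" using U by simp
  qed
  then obtain g where g: "homeomorphic_maps (top_of_set U) (subtopology T (q ` U)) q g"
    using homeomorphic_map_maps by blast
  then have "homeomorphic_map (subtopology T (q ` U)) (top_of_set U) g" by (simp add: homeomorphic_maps_map)
  then have "homeomorphic_map (subtopology T (q ` U)) (top_of_set U) (inv_into U q)"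
  proof (rule homeomorphic_map_eq)
    fix p assume "p \<in> topspace (subtopology T (q ` U))"
    then obtain x where "x \<in> U" "p = q x" using U topspace_eq by auto
    then show "g p = inv_into U q p" using g U by (auto simp: homeomorphic_maps_def)
  qed
  then show ?thesis using U section_chart_image[OF U] image_open[of U]
    by (simp add: is_chart_def section_chart_def)
qed

text \<open>Near \<open>x\<close> the transition map agrees with the deck transformation \<open>g\<close>, so it has the same derivative.\<close>

lemma section_chart_transition:
  assumes U: "good U" and V: "good V" and x: "x \<in> U" "y \<in> V" and g: "open N" "x \<in> N" "N \<subseteq> E" "g x = y"
    "\<forall>n\<in>N. q (g n) = q n" "has_cderiv g D x"
  shows "has_cderiv (snd (section_chart q V) \<circ> chart_inv (section_chart q U)) D x"
proof -
  have "continuous (at x) g" using g(6) has_derivative_continuous unfolding has_cderiv_def by blast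
  then obtain A where A: "open A" "x \<in> A" "\<And>n. n \<in> A \<Longrightarrow> g n \<in> V"
  proof -
    have "open V" "g x \<in> V" using V x g(4) by auto
    then show ?thesis using \<open>continuous (at x) g\<close> that unfolding continuous_at_open by metis
  qed
  show ?thesis
  proof (rule has_cderiv_cong[OF g(6)])
    show "open (N \<inter> A \<inter> U)" by (intro open_Int g(1) A(1)) (use U in simp)
    show "x \<in> N \<inter> A \<inter> U" using g(2) A(2) x(1) by simp
    fix n assume n: "n \<in> N \<inter> A \<inter> U"
    then have "snd (section_chart q V) (q n) = g n"
      using section_chart_apply[OF V, of "g n"] A(3)[of n] g(5) by simp
    then show "g n = (snd (section_chart q V) \<circ> chart_inv (section_chart q U)) n"
      using section_chart_inv[OF U, of n] n by simp
  qed
qed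

lemma section_charts_compatible:
  assumes U: "good U" and V: "good V"
  shows "holomorphically_compatible (section_chart q U) (section_chart q V)"
proof -
  have *: "\<exists>D. has_cderiv (snd (section_chart q V) \<circ> chart_inv (section_chart q U)) D (snd (section_chart q U)
      p)"
    if U: "good U" and V: "good V" and p: "p \<in> q ` U" "p \<in> q ` V" for U V p
  proof -
    obtain x y where xy: "x \<in> U" "y \<in> V" "p = q x" "p = q y" using p by blast
    have "x \<in> E" "y \<in> E" "q x = q y" using xy U V by auto
    from deck[OF this] obtain N g where g: "open N" "x \<in> N" "N \<subseteq> E" "g x = y" "\<forall>n\<in>N. q (g n) = q n"
        "holomorphic_map_on N g"
      by blast
    then obtain D where "has_cderiv g D x" using holomorphic_map_on_iff by blast
    from section_chart_transition[OF U V xy(1,2) g(1-5) this] show ?thesis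
      using section_chart_apply[OF U xy(1)] xy(3) by auto
  qed
  show ?thesis
    unfolding compatible_iff[OF section_chart_is_chart[OF U] section_chart_is_chart[OF V]] section_chart_dom
    using *[OF U V] *[OF V U] by blast
qed

lemma good_exists: "p \<in> topspace T \<Longrightarrow> \<exists>x U. good U \<and> x \<in> U \<and> p = q x"
  using topspace_eq locally_inj by (metis imageE)

lemma section_charts_atlas: "good U \<Longrightarrow> section_chart q U \<in> generated_atlas T (section_charts E q)"
  by (auto simp: generated_atlas_def section_charts_def section_chart_is_chart section_charts_compatible)

lemma complex_manifold:
  assumes "Hausdorff_space T"
  shows "complex_manifold \<lparr>mtop = T, atlas = generated_atlas T (section_charts E q)\<rparr>"
proof (rule generated_atlas_complex_manifold[OF assms])
  have "second_countable (top_of_set E)"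
  proof (rule second_countable_subtopology)
    obtain \<B> :: "(complex ^ 'n) set set" where "countable \<B>" "topological_basis \<B>"
      using ex_countable_basis by blast
    then have B: "countable \<B>" "topological_basis \<B>" .
    show "second_countable (euclidean :: (complex ^ 'n) topology)"
      unfolding second_countable_def
    proof (intro exI[of _ \<B>] conjI B(1) ballI allI impI)
      show "openin euclidean V" if "V \<in> \<B>" for V
        using topological_basis_open[OF B(2) that] by simp
      show "\<exists>V\<in>\<B>. x \<in> V \<and> V \<subseteq> U" if "openin euclidean U \<and> x \<in> U" for U x
        using topological_basisE[OF B(2), of U x] that by auto
    qed
  qed
  then show "second_countable T"
    by (rule second_countable_open_map_image[OF q_continuous q_open, rotated]) (simp add: topspace_eq)
  show "topspace T \<subseteq> (\<Union>c\<in>section_charts E q. fst c)"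
    using good_exists by (fastforce simp: section_charts_def section_chart_dom)
qed (auto simp: section_charts_def section_chart_is_chart section_charts_compatible)

end

section \<open>Fibres of a quotient over a base\<close>

text \<open>The index type \<open>'n + 1\<close> is a disjoint sum, so its elements are \<open>Inl j\<close> and \<open>Inr 1\<close>; the last one
  is the coordinate of the base.\<close>

definition emb :: "complex ^ 'n::finite \<Rightarrow> complex \<Rightarrow> complex ^ ('n + 1)" where
  "emb z t = (\<chi> i. case i of Inl j \<Rightarrow> z $ j | Inr _ \<Rightarrow> t)"

definition fibre_coords :: "complex ^ ('n::finite + 1) \<Rightarrow> complex ^ 'n" where
  "fibre_coords x = (\<chi> j. x $ Inl j)"

abbreviation base_coord :: "complex ^ ('n::finite + 1) \<Rightarrow> complex" where
  "base_coord x \<equiv> x $ Inr 1"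

lemma emb_nth [simp]: "emb z t $ Inl j = z $ j" "emb z t $ Inr i = t"
  by (simp_all add: emb_def)

lemma fibre_coords_nth [simp]: "fibre_coords x $ j = x $ Inl j"
  by (simp add: fibre_coords_def)

lemma vec_sum_eqI: "(\<And>j. x $ Inl j = y $ Inl j) \<Longrightarrow> base_coord x = base_coord y \<Longrightarrow> x = (y :: complex ^ ('n::finite
    + 1))"
  unfolding vec_eq_iff by (metis (full_types) num1_eq1 sum.exhaust)

lemma fibre_coords_emb [simp]: "fibre_coords (emb z t) = z"
  by (simp add: vec_eq_iff)

lemma emb_pr: "base_coord x = t \<Longrightarrow> emb (fibre_coords x) t = x"
  by (rule vec_sum_eqI) auto

lemma fibre_coords_bounded_linear: "bounded_linear (fibre_coords :: complex ^ ('n::finite + 1) \<Rightarrow> _)"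
  by (rule linear_conv_bounded_linear[THEN iffD1], rule linearI) (auto simp: vec_eq_iff)

lemma emb_bounded_linear: "bounded_linear (\<lambda>u :: complex ^ 'n::finite. emb u 0)"
  by (rule linear_conv_bounded_linear[THEN iffD1], rule linearI) (auto intro!: vec_sum_eqI)

lemma has_cderiv_pr: "has_cderiv fibre_coords fibre_coords x"
  unfolding has_cderiv_def
  by (auto simp: vec_eq_iff intro: bounded_linear_imp_has_derivative fibre_coords_bounded_linear)

lemma has_cderiv_emb: "has_cderiv (\<lambda>z. emb z t) (\<lambda>u. emb u 0) z"
  unfolding has_cderiv_def
proof (intro conjI allI)
  have e: "(\<lambda>z. emb z t) = (\<lambda>z. emb z 0 + emb 0 t)" by (intro ext vec_sum_eqI) auto
  show "((\<lambda>z. emb z t) has_derivative (\<lambda>u. emb u 0)) (at z)"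
    unfolding e using has_derivative_add[OF bounded_linear_imp_has_derivative[OF emb_bounded_linear]
        has_derivative_const]
    by fastforce
  show "emb (a *s v) 0 = a *s emb v 0" for a v by (rule vec_sum_eqI) auto
qed

lemma has_cderiv_continuous: "has_cderiv f D z \<Longrightarrow> continuous (at z) f"
  unfolding has_cderiv_def using has_derivative_continuous by blast

lemma emb_continuous: "continuous_on S (\<lambda>z. emb z t)"
  by (intro continuous_at_imp_continuous_on ballI has_cderiv_continuous[OF has_cderiv_emb])

lemma fibre_coords_continuous: "continuous_on S fibre_coords"
  by (rule bounded_linear.continuous_on[OF fibre_coords_bounded_linear continuous_on_id])

lemma compatible_sym: "holomorphically_compatible c d \<longleftrightarrow> holomorphically_compatible d c"
  unfolding holomorphically_compatible_def by (auto simp: Int_commute)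

text \<open>A quotient over a base: the last coordinate is constant on the fibres of the quotient map.\<close>

locale fibred_quotient = holomorphic_quotient E q T
  for E :: "(complex ^ ('n::finite + 1)) set" and q :: "complex ^ ('n + 1) \<Rightarrow> 'a" and T +
  fixes \<pi> :: "'a \<Rightarrow> complex"
  assumes \<pi>_q: "x \<in> E \<Longrightarrow> \<pi> (q x) = base_coord x"
begin

definition total :: "('a, 'n + 1) cmfd" where
  "total = \<lparr>mtop = T, atlas = generated_atlas T (section_charts E q)\<rparr>"

definition slice :: "complex \<Rightarrow> (complex ^ 'n) set" where
  "slice t = {z. emb z t \<in> E}"

definition slice_map :: "complex \<Rightarrow> complex ^ 'n \<Rightarrow> 'a" where
  "slice_map t z = q (emb z t)"

definition slice_top :: "complex \<Rightarrow> 'a topology" where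
  "slice_top t = subtopology T {p \<in> topspace T. \<pi> p = t}"

lemma slice_preimage_open: "open U \<Longrightarrow> open {z. emb z t \<in> U}"
  using open_vimage[OF _ emb_continuous[of UNIV t], of U] by (simp add: vimage_def)

lemma fibre_points: "{p \<in> topspace T. \<pi> p = t} = slice_map t ` slice t"
proof (intro set_eqI iffI)
  fix p assume "p \<in> {p \<in> topspace T. \<pi> p = t}"
  then obtain x where x: "x \<in> E" "p = q x" "base_coord x = t" using topspace_eq \<pi>_q by auto
  then show "p \<in> slice_map t ` slice t" using emb_pr[OF x(3)]
    by (auto simp: slice_map_def slice_def intro!: image_eqI[of _ _ "fibre_coords x"])
next
  fix p assume "p \<in> slice_map t ` slice t"
  then show "p \<in> {p \<in> topspace T. \<pi> p = t}" using topspace_eq \<pi>_q by (auto simp: slice_map_def slice_def)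
qed

lemma deck_slice: "x \<in> E \<Longrightarrow> y \<in> E \<Longrightarrow> q y = q x \<Longrightarrow> base_coord y = base_coord x"
  using \<pi>_q by metis

text \<open>Deck transformations preserve the last coordinate, so they restrict to slices. Openness of the
  restricted quotient map holds because the slice is a full preimage of the fibre.\<close>

lemma slice_quotient: "holomorphic_quotient (slice t) (slice_map t) (slice_top t)"
proof
  show "open (slice t)" unfolding slice_def by (rule slice_preimage_open[OF E_open])
  show ts: "topspace (slice_top t) = slice_map t ` slice t"
    unfolding slice_top_def fibre_points[symmetric] by auto
  show "continuous_map (top_of_set (slice t)) (slice_top t) (slice_map t)"
    unfolding slice_top_def continuous_map_in_subtopology
  proof
    have "continuous_map (top_of_set (slice t)) (top_of_set E) (\<lambda>z. emb z t)"
      using emb_continuous[of "slice t" t] by (auto simp: slice_def continuous_map_in_subtopology)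
    then have "continuous_map (top_of_set (slice t)) T (q \<circ> (\<lambda>z. emb z t))"
      using q_continuous continuous_map_compose by blast
    then show "continuous_map (top_of_set (slice t)) T (slice_map t)"
      by (simp add: comp_def slice_map_def[abs_def])
    show "slice_map t \<in> topspace (top_of_set (slice t)) \<rightarrow> {p \<in> topspace T. \<pi> p = t}"
      unfolding fibre_points by auto
  qed
  show "open_map (top_of_set (slice t)) (slice_top t) (slice_map t)"
    unfolding open_map_def
  proof (intro allI impI)
    fix W assume W: "openin (top_of_set (slice t)) W"
    then have Wo: "open W" "W \<subseteq> slice t"
      using openin_open_eq[OF slice_preimage_open[OF E_open, of t]] unfolding slice_def by auto
    have "openin T (q ` {x \<in> E. fibre_coords x \<in> W})"
    proof (rule image_open)
      have "{x \<in> E. fibre_coords x \<in> W} = E \<inter> fibre_coords -` W" by auto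
      then show "open {x \<in> E. fibre_coords x \<in> W}"
        using E_open open_vimage[OF Wo(1) fibre_coords_continuous] by auto
    qed auto
    moreover have "slice_map t ` W = q ` {x \<in> E. fibre_coords x \<in> W} \<inter> {p \<in> topspace T. \<pi> p = t}"
    proof (intro set_eqI iffI)
      fix p assume "p \<in> slice_map t ` W"
      then obtain w where w: "w \<in> W" "p = q (emb w t)" by (auto simp: slice_map_def)
      then have "emb w t \<in> E" using Wo(2) by (auto simp: slice_def)
      then show "p \<in> q ` {x \<in> E. fibre_coords x \<in> W} \<inter> {p \<in> topspace T. \<pi> p = t}"
        using w \<pi>_q[of "emb w t"] topspace_eq by (auto intro!: image_eqI[of _ q "emb w t"])
    next
      fix p assume "p \<in> q ` {x \<in> E. fibre_coords x \<in> W} \<inter> {p \<in> topspace T. \<pi> p = t}"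
      then obtain x where x: "x \<in> E" "fibre_coords x \<in> W" "p = q x" "base_coord x = t" using \<pi>_q by auto
      then show "p \<in> slice_map t ` W" using emb_pr[OF x(4)] by (auto simp: slice_map_def intro!: image_eqI[of _
          _ "fibre_coords x"])
    qed
    ultimately show "openin (slice_top t) (slice_map t ` W)"
      unfolding slice_top_def openin_subtopology by blast
  qed
  fix x assume x: "x \<in> slice t"
  then have xE: "emb x t \<in> E" by (simp add: slice_def)
  show "\<exists>U. open U \<and> x \<in> U \<and> U \<subseteq> slice t \<and> inj_on (slice_map t) U"
  proof -
    obtain U where U: "open U" "emb x t \<in> U" "U \<subseteq> E" "inj_on q U" using locally_inj[OF xE] by blast
    have "inj_on (slice_map t) {z. emb z t \<in> U}"
      using U(4) by (auto simp: inj_on_def slice_map_def) (metis fibre_coords_emb)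
    then show ?thesis using U slice_preimage_open[OF U(1), of t]
      by (intro exI[of _ "{z. emb z t \<in> U}"]) (auto simp: slice_def)
  qed
  fix y assume y: "y \<in> slice t" and xy: "slice_map t x = slice_map t y"
  then have yE: "emb y t \<in> E" "q (emb x t) = q (emb y t)" by (simp_all add: slice_def slice_map_def)
  obtain N g where g: "open N" "emb x t \<in> N" "N \<subseteq> E" "g (emb x t) = emb y t" "g ` N \<subseteq> E" "\<forall>n\<in>N. q (g n) = q n"
    "holomorphic_map_on N g" using deck[OF xE yE] by blast
  let ?N = "{z. emb z t \<in> N}" and ?g = "\<lambda>z. fibre_coords (g (emb z t))"
  have gt: "emb (?g z) t = g (emb z t)" if "z \<in> ?N" for z
    using deck_slice[of "emb z t" "g (emb z t)"] g that by (intro emb_pr) auto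
  have "holomorphic_map_on ?N ?g"
    unfolding holomorphic_map_on_iff
  proof
    fix z assume "z \<in> ?N"
    then obtain D where D: "has_cderiv g D (emb z t)" using g(7) unfolding holomorphic_map_on_iff by blast
    have "has_cderiv (fibre_coords \<circ> (g \<circ> (\<lambda>z. emb z t))) (fibre_coords \<circ> (D \<circ> (\<lambda>u. emb u 0))) z"
      by (rule has_cderiv_compose[OF has_cderiv_compose[OF has_cderiv_emb D] has_cderiv_pr])
    then show "\<exists>D. has_cderiv ?g D z" by (auto simp: comp_def)
  qed
  moreover have "?g ` ?N \<subseteq> slice t" using gt g(5) by (auto simp: slice_def)
  moreover have "slice_map t (?g z) = slice_map t z" if "z \<in> ?N" for z
    using gt[OF that] g(6) that by (simp add: slice_map_def)
  ultimately show "\<exists>N g. open N \<and> x \<in> N \<and> N \<subseteq> slice t \<and> g x = y \<and> g ` N \<subseteq> slice t \<and>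
      (\<forall>n\<in>N. slice_map t (g n) = slice_map t n) \<and> holomorphic_map_on N g"
    using g slice_preimage_open[OF g(1), of t]
    by (intro exI[of _ ?N] exI[of _ ?g]) (auto simp: slice_def)
qed

lemma slice_good:
  assumes "good U"
  shows "holomorphic_quotient.good (slice t) (slice_map t) {z. emb z t \<in> U}"
  using assms slice_preimage_open[of U t]
  by (auto simp: slice_def slice_map_def inj_on_def) (metis fibre_coords_emb)

lemma section_chart_of_slice:
  assumes U: "good U" and w: "emb w t \<in> U"
  shows "snd (section_chart q U) (slice_map t w) = emb w t"
      "chart_inv (section_chart q U) (emb w t) = slice_map t w"
  using section_chart_apply[OF U w] section_chart_inv[OF U w] by (simp_all add: slice_map_def)

text \<open>The atlas of the fibre is defined through immersions into the total space, the right-hand side through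
  compatibility with section charts. For one inclusion, compose the transition maps with the affine
  inclusion of the slice. For the other one, an immersion into the total space has values in the
  slice; so it is an immersion into the slice between spaces of equal dimension, and its given
  inverse is holomorphic, too.\<close>

lemma fibre_atlas:
  "atlas (fibre total \<pi> t) = generated_atlas (slice_top t) (section_charts (slice t) (slice_map t))"
proof -
  interpret S: holomorphic_quotient "slice t" "slice_map t" "slice_top t" by (rule slice_quotient)
  let ?gen = "generated_atlas (slice_top t) (section_charts (slice t) (slice_map t))"
  have at: "atlas (fibre total \<pi> t) = {c. is_chart (slice_top t) c \<and>
      (\<forall>d\<in>generated_atlas T (section_charts E q). holomorphic_immersion_on (snd c ` (fst c \<inter> fst d)) (snd d \<circ>
          chart_inv c))}"
    by (simp add: fibre_def total_def slice_top_def Let_def)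
  have "holomorphic_immersion_on (snd c ` (fst c \<inter> fst d)) (snd d \<circ> chart_inv c)"
    if c: "c \<in> ?gen" and d: "d \<in> generated_atlas T (section_charts E q)" for c d
    unfolding holomorphic_immersion_on_iff
  proof
    fix z assume "z \<in> snd c ` (fst c \<inter> fst d)"
    then obtain p where p: "p \<in> fst c" "p \<in> fst d" "z = snd c p" by blast
    have cc: "is_chart (slice_top t) c" and dc: "is_chart T d" using c d by (simp_all add: generated_atlas_def)
    have "p \<in> topspace (slice_top t)" using chart_domain_open[OF cc] p openin_subset by blast
    then obtain x where x: "x \<in> slice t" "p = slice_map t x" using S.topspace_eq by auto
    then obtain U where U: "good U" "emb x t \<in> U" using locally_inj[of "emb x t"] by (auto simp: slice_def)
    let ?V = "{z. emb z t \<in> U}"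
    have V: "S.good ?V" by (rule slice_good[OF U(1)])
    let ?b = "section_chart (slice_map t) ?V" and ?\<beta> = "section_chart q U"
    have pb: "p \<in> fst ?b" "p \<in> fst ?\<beta>" using x U by (auto simp: section_chart_def slice_map_def)
    have "holomorphically_compatible c ?b" using c V by (auto simp: generated_atlas_def section_charts_def)
    then obtain D1 where D1: "has_cderiv (snd ?b \<circ> chart_inv c) D1 (snd c p)" "bij D1"
      using compatible_derivative[OF cc S.section_chart_is_chart[OF V] _ p(1) pb(1)] by blast
    have "holomorphically_compatible d ?\<beta>" using d U(1) by (auto simp: generated_atlas_def section_charts_def)
    then have "holomorphically_compatible ?\<beta> d" by (rule compatible_sym[THEN iffD1])
    then obtain D3 where "has_cderiv (snd d \<circ> chart_inv ?\<beta>) D3 (snd ?\<beta> p)" and D3: "bij D3"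
      using compatible_derivative[OF section_chart_is_chart[OF U(1)] dc _ pb(2) p(2)] by blast
    then have D3': "has_cderiv (snd d \<circ> chart_inv ?\<beta>) D3 (emb x t)"
      using section_chart_of_slice(1)[OF U] x by simp
    have sb: "snd ?b (slice_map t w) = w" if "emb w t \<in> U" for w using S.section_chart_apply[OF V] that by simp
    have "(snd ?b \<circ> chart_inv c) (snd c p) = x" using chart_inv_left[OF cc p(1)] sb[OF U(2)] x by simp
    then have comp: "has_cderiv ((snd d \<circ> chart_inv ?\<beta>) \<circ> ((\<lambda>z. emb z t) \<circ> (snd ?b \<circ> chart_inv c))) (D3 \<circ> ((\<lambda>u.
        emb u 0) \<circ> D1)) (snd c p)"
      using D3' by (intro has_cderiv_compose[OF has_cderiv_compose[OF D1(1) has_cderiv_emb]]) simp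
    obtain N where N: "open N" "snd c p \<in> N" "N \<subseteq> snd c ` fst c" "\<And>y. y \<in> N \<Longrightarrow> chart_inv c y \<in> fst ?b"
      using chart_neighbourhood[OF cc chart_domain_open[OF S.section_chart_is_chart[OF V]] p(1) pb(1)] by blast
    have eq: "((snd d \<circ> chart_inv ?\<beta>) \<circ> ((\<lambda>z. emb z t) \<circ> (snd ?b \<circ> chart_inv c))) y = (snd d \<circ> chart_inv c) y"
        if y: "y \<in> N" for y
    proof -
      obtain w where "emb w t \<in> U" "chart_inv c y = slice_map t w"
        using N(4)[OF y] by (auto simp: section_chart_def)
      then show ?thesis using sb section_chart_of_slice(2)[OF U(1)] by simp
    qed
    have "has_cderiv (snd d \<circ> chart_inv c) (D3 \<circ> ((\<lambda>u. emb u 0) \<circ> D1)) z"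
      unfolding p(3) by (rule has_cderiv_cong[OF comp N(1,2) eq])
    moreover have "inj (\<lambda>u :: complex ^ 'n. emb u 0)" by (rule inj_on_inverseI[where g=fibre_coords]) simp
    then have "inj (D3 \<circ> ((\<lambda>u. emb u 0) \<circ> D1))" using D1(2) D3 by (intro inj_compose) (auto simp: bij_def)
    ultimately show "\<exists>D. has_cderiv (snd d \<circ> chart_inv c) D z \<and> inj D" by blast
  qed
  moreover have "holomorphically_compatible c b"
    if c: "c \<in> atlas (fibre total \<pi> t)" and b: "b \<in> section_charts (slice t) (slice_map t)" for c b
  proof -
    obtain V where V: "S.good V" "b = section_chart (slice_map t) V" using b by (auto simp: section_charts_def)
    have cc: "is_chart (slice_top t) c" using c at by simp
    have bc: "is_chart (slice_top t) b" using V S.section_chart_is_chart by simp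
    have sb: "snd b (slice_map t w) = w" "chart_inv b w = slice_map t w" if "w \<in> V" for w
      using S.section_chart_apply[OF V(1) that] S.section_chart_inv[OF V(1) that] V(2) by simp_all
    have fb: "fst b = slice_map t ` V" using V(2) by (simp add: section_chart_def)
    show ?thesis unfolding compatible_iff[OF cc bc]
    proof
      fix p assume p: "p \<in> fst c \<inter> fst b"
      then obtain x where x: "x \<in> V" "p = slice_map t x" using fb by blast
      then have "emb x t \<in> E" using V by (auto simp: slice_def)
      then obtain U where U: "good U" "emb x t \<in> U" using locally_inj by blast
      let ?\<beta> = "section_chart q U"
      have p\<beta>: "p \<in> fst ?\<beta>" using x U by (auto simp: section_chart_def slice_map_def)
      have "holomorphic_immersion_on (snd c ` (fst c \<inter> fst ?\<beta>)) (snd ?\<beta> \<circ> chart_inv c)"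
        using c at section_charts_atlas[OF U(1)] by blast
      then obtain D where D: "has_cderiv (snd ?\<beta> \<circ> chart_inv c) D (snd c p)" "inj D"
        using p p\<beta> unfolding holomorphic_immersion_on_iff by blast
      let ?W = "slice_map t ` (V \<inter> {z. emb z t \<in> U})"
      have "openin (slice_top t) ?W" using V(1) slice_good[OF U(1), of t] by (intro S.image_open) auto
      then obtain N where N: "open N" "snd c p \<in> N" "N \<subseteq> snd c ` fst c" "\<And>y. y \<in> N \<Longrightarrow> chart_inv c y \<in> ?W"
        using chart_neighbourhood[OF cc, of ?W p] p x U by blast
      have near: "snd ?\<beta> (chart_inv c y) = emb (snd b (chart_inv c y)) t" if "y \<in> N" for y
        using N(4)[OF that] sb section_chart_of_slice(1)[OF U(1)] by auto
      have f: "has_cderiv (snd b \<circ> chart_inv c) (fibre_coords \<circ> D) (snd c p)"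
        by (rule has_cderiv_cong[OF has_cderiv_compose[OF D(1) has_cderiv_pr] N(1,2)]) (simp add: near)
      \<comment> \<open>The last coordinate is constant on the fibre, so the derivative takes values in the slice.\<close>
      have tpD: "base_coord (D v) = 0" for v
      proof -
        have "((\<lambda>y. base_coord ((snd ?\<beta> \<circ> chart_inv c) y)) has_derivative (\<lambda>v. base_coord (D v))) (at (snd c
            p))"
          using D(1) unfolding has_cderiv_def
          by (intro bounded_linear.has_derivative[OF bounded_linear_vec_nth]) (simp add: comp_def)
        then have "((\<lambda>y. t) has_derivative (\<lambda>v. base_coord (D v))) (at (snd c p))"
          by (rule has_derivative_transform_within_open[OF _ N(1,2)]) (simp add: near)
        then have "(\<lambda>v. base_coord (D v)) = (\<lambda>v. 0)" by (rule has_derivative_unique[OF _ has_derivative_const])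
        then show ?thesis by (rule fun_cong)
      qed
      have emb_D: "emb (fibre_coords (D v)) 0 = D v" for v by (rule emb_pr[OF tpD])
      have "inj (fibre_coords \<circ> D)"
      proof (rule injI)
        fix u v assume "(fibre_coords \<circ> D) u = (fibre_coords \<circ> D) v"
        then have "emb (fibre_coords (D u)) 0 = emb (fibre_coords (D v)) 0" by (simp only: comp_apply)
        then have "D u = D v" unfolding emb_D .
        then show "u = v" by (rule injD[OF D(2)])
      qed
      have "continuous (at x) (snd c \<circ> chart_inv b)"
        unfolding continuous_at_open
      proof (intro allI impI)
        fix Q assume Q: "open Q \<and> (snd c \<circ> chart_inv b) x \<in> Q"
        let ?A = "{w \<in> slice t. slice_map t w \<in> {r \<in> fst c. snd c r \<in> Q}} \<inter> V"
        have "open ?A" using S.preimage_open[OF chart_preimage_open[OF cc, of Q]] Q V(1) by blast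
        moreover have "x \<in> ?A" using x p V Q sb by auto
        moreover have "(snd c \<circ> chart_inv b) w \<in> Q" if "w \<in> ?A" for w using that sb by auto
        ultimately show "\<exists>A. open A \<and> x \<in> A \<and> (\<forall>w\<in>A. (snd c \<circ> chart_inv b) w \<in> Q)" by blast
      qed
      moreover have "open ({w \<in> slice t. slice_map t w \<in> fst c} \<inter> V)"
        using S.preimage_open[OF chart_domain_open[OF cc]] V(1) by blast
      moreover have "x \<in> {w \<in> slice t. slice_map t w \<in> fst c} \<inter> V" using x p V by auto
      moreover have "(snd b \<circ> chart_inv c) ((snd c \<circ> chart_inv b) w) = w" if
          "w \<in> {w \<in> slice t. slice_map t w \<in> fst c} \<inter> V" for w
        using that sb chart_inv_left[OF cc] by simp
      moreover have "has_cderiv (snd b \<circ> chart_inv c) (fibre_coords \<circ> D) ((snd c \<circ> chart_inv b) x)"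
        using f sb x by simp
      ultimately obtain D' where "has_cderiv (snd c \<circ> chart_inv b) D' x"
        using has_cderiv_inverse[OF _ \<open>inj (fibre_coords \<circ> D)\<close>,
            where g="snd c \<circ> chart_inv b" and y=x and T="{w \<in> slice t. slice_map t w \<in> fst c} \<inter> V"] by blast
      then show "(\<exists>D. has_cderiv (snd b \<circ> chart_inv c) D (snd c p)) \<and> (\<exists>D. has_cderiv (snd c \<circ> chart_inv b) D
          (snd b p))"
        using f sb x by auto
    qed
  qed
  ultimately show ?thesis unfolding at by (auto simp: generated_atlas_def)
qed

lemma fibre_eq:
  "fibre total \<pi> t = \<lparr>mtop = slice_top t, atlas = generated_atlas (slice_top t) (section_charts (slice t)
      (slice_map t))\<rparr>"
proof -
  have "mtop (fibre total \<pi> t) = slice_top t" by (simp add: fibre_def total_def slice_top_def Let_def)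
  then show ?thesis using fibre_atlas by (metis (full_types) cmfd.surjective old.unit.exhaust)
qed

lemma fibre_compact_complex_manifold:
  assumes "Hausdorff_space T" "proper_map T (top_of_set B) \<pi>" "t \<in> B"
  shows "compact_complex_manifold (fibre total \<pi> t)"
proof -
  have "Hausdorff_space (slice_top t)" unfolding slice_top_def by (rule Hausdorff_space_subtopology[OF
      assms(1)])
  moreover have "compactin T {p \<in> topspace T. \<pi> p = t}" using assms(2,3) by (simp add: proper_map_def)
  then have "compact_space (slice_top t)" unfolding slice_top_def by (rule compact_space_subtopology)
  ultimately show ?thesis
    using holomorphic_quotient.complex_manifold[OF slice_quotient] by (simp add: compact_complex_manifold_def
        fibre_eq)
qed

text \<open>In a section chart the projection to the base is the last coordinate, and transition maps have
  bijective derivatives.\<close>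

lemma holomorphic_family_total:
  assumes "Hausdorff_space T" "proper_map T (top_of_set unit_disc) \<pi>" "base_coord ` E \<subseteq> unit_disc"
  shows "holomorphic_family total \<pi>"
  unfolding holomorphic_family_def
proof (intro conjI ballI)
  show "Defs.complex_manifold total" unfolding total_def by (rule complex_manifold[OF assms(1)])
  show "proper_map (mtop total) (top_of_set unit_disc) \<pi>" using assms(2) by (simp add: total_def)
  have qm: "quotient_map (top_of_set E) T q"
    by (rule continuous_open_imp_quotient_map[OF q_continuous q_open]) (simp add: topspace_eq)
  have "continuous_map (top_of_set E) (top_of_set unit_disc) base_coord"
    using assms(3) by (auto simp: continuous_map_in_subtopology intro: continuous_on_component continuous_on_id)
  then have "continuous_map (top_of_set E) (top_of_set unit_disc) (\<pi> \<circ> q)"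
    by (rule continuous_map_eq) (simp add: \<pi>_q)
  then show "continuous_map (mtop total) (top_of_set unit_disc) \<pi>"
    unfolding total_def cmfd.simps by (rule continuous_compose_quotient_map[OF qm])
  fix c assume "c \<in> atlas total"
  then have c: "c \<in> generated_atlas T (section_charts E q)" by (simp add: total_def)
  then have cc: "is_chart T c" by (simp add: generated_atlas_def)
  show "holomorphic_submersion_on (snd c ` fst c) (\<pi> \<circ> chart_inv c)"
    unfolding holomorphic_submersion_on_def
  proof
    fix z assume "z \<in> snd c ` fst c"
    then obtain p where p: "p \<in> fst c" "z = snd c p" by blast
    then have "p \<in> topspace T" using chart_domain_open[OF cc] openin_subset by blast
    then obtain x U where U: "good U" "x \<in> U" "p = q x" using good_exists by blast
    let ?\<beta> = "section_chart q U"
    have pb: "p \<in> fst ?\<beta>" using U by (auto simp: section_chart_def)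
    have "holomorphically_compatible c ?\<beta>" using c U(1) by (auto simp: generated_atlas_def section_charts_def)
    then obtain D where D: "has_cderiv (snd ?\<beta> \<circ> chart_inv c) D (snd c p)" "bij D"
      using compatible_derivative[OF cc section_chart_is_chart[OF U(1)] _ p(1) pb] by blast
    obtain N where N: "open N" "snd c p \<in> N" "N \<subseteq> snd c ` fst c" "\<And>y. y \<in> N \<Longrightarrow> chart_inv c y \<in> fst ?\<beta>"
      using chart_neighbourhood[OF cc chart_domain_open[OF section_chart_is_chart[OF U(1)]] p(1) pb] by blast
    have "((\<lambda>y. base_coord ((snd ?\<beta> \<circ> chart_inv c) y)) has_derivative (\<lambda>v. base_coord (D v))) (at z)"
      using D(1) p(2) unfolding has_cderiv_def
      by (intro bounded_linear.has_derivative[OF bounded_linear_vec_nth]) (simp add: comp_def)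
    then have "((\<pi> \<circ> chart_inv c) has_derivative (\<lambda>v. base_coord (D v))) (at z)"
    proof (rule has_derivative_transform_within_open[OF _ N(1)])
      show "z \<in> N" using N(2) p by simp
      fix y assume "y \<in> N"
      then obtain w where "w \<in> U" "chart_inv c y = q w" using N(4) by (force simp: section_chart_def)
      then show "base_coord ((snd ?\<beta> \<circ> chart_inv c) y) = (\<pi> \<circ> chart_inv c) y"
        using section_chart_apply[OF U(1)] \<pi>_q[of w] U(1) by auto
    qed
    moreover have "base_coord (D (a *s v)) = a * base_coord (D v)" for a v using D(1) by (simp add:
        has_cderiv_def)
    moreover have "surj (\<lambda>v. base_coord (D v))"
    proof (rule surjI)
      show "base_coord (D (inv D (emb 0 s))) = s" for s using D(2) by (simp add: bij_def surj_f_inv_f)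
    qed
    ultimately show "\<exists>D. ((\<pi> \<circ> chart_inv c) has_derivative D) (at z) \<and> (\<forall>a v. D (a *s v) = a * D v) \<and> surj D"
      by blast
  qed
qed

end

section \<open>The Heisenberg family\<close>

lemma gauss_add: "a \<in> gauss \<Longrightarrow> b \<in> gauss \<Longrightarrow> a + b \<in> gauss"
  and gauss_minus: "a \<in> gauss \<Longrightarrow> - a \<in> gauss"
  and gauss_diff: "a \<in> gauss \<Longrightarrow> b \<in> gauss \<Longrightarrow> a - b \<in> gauss"
  and gauss_mult: "a \<in> gauss \<Longrightarrow> b \<in> gauss \<Longrightarrow> a * b \<in> gauss"
  and gauss_cnj: "a \<in> gauss \<Longrightarrow> cnj a \<in> gauss"
  by (simp_all add: gauss_def)

lemma gauss_closed: "closed gauss"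
proof -
  have "gauss = Re -` \<int> \<inter> Im -` \<int>" by (auto simp: gauss_def)
  moreover have "closed (Re -` \<int> \<inter> Im -` \<int>)"
    by (intro closed_Int closed_vimage closed_Ints continuous_on_Re continuous_on_Im continuous_on_id)
  ultimately show ?thesis by (simp only:)
qed

lemma gauss_discrete: "z \<in> gauss \<Longrightarrow> norm z < 1 \<Longrightarrow> z = 0"
  using Ints_nonzero_abs_less1[of "Re z"] Ints_nonzero_abs_less1[of "Im z"] abs_Re_le_cmod[of z]
      abs_Im_le_cmod[of z]
  by (simp add: gauss_def complex_eq_iff)

definition disc_domain :: "(complex ^ (3 + 1)) set" where
  "disc_domain = {x. norm (base_coord x) < 1}"

definition act :: "complex \<Rightarrow> complex \<Rightarrow> complex \<Rightarrow> complex ^ (3 + 1) \<Rightarrow> complex ^ (3 + 1)" where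
  "act a b c x = emb (heis (base_coord x) a b c (fibre_coords x)) (base_coord x)"

definition orbit :: "complex ^ (3 + 1) \<Rightarrow> point" where
  "orbit x = {act a b c x | a b c. a \<in> gauss \<and> b \<in> gauss \<and> c \<in> gauss}"

lemma base_coord_act [simp]: "base_coord (act a b c x) = base_coord x" and fibre_coords_act [simp]:
    "fibre_coords (act a b c x) = heis (base_coord x) a b c (fibre_coords x)"
  by (simp_all add: act_def)

lemma act_domain [simp]: "act a b c x \<in> disc_domain \<longleftrightarrow> x \<in> disc_domain"
  by (simp add: disc_domain_def)

lemma emb_eqI: "fibre_coords x = fibre_coords y \<Longrightarrow> base_coord x = base_coord y \<Longrightarrow> x = y"
  by (metis emb_pr)

lemma act_act: "act a b c (act a' b' c' x) = act (a + a') (b + b') (c + c' + cnj b * a') x"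
  by (rule emb_eqI) (simp_all add: vec_eq_iff forall_3 algebra_simps)

lemma act_0: "act 0 0 0 x = x"
  by (rule emb_eqI) (simp_all add: vec_eq_iff forall_3)

lemma act_inverse: "act (- a) (- b) (- c + cnj b * a) (act a b c x) = x"
    "act a b c (act (- a) (- b) (- c + cnj b * a) x) = x"
  by (simp_all add: act_act act_0)

lemma orbit_self: "x \<in> orbit x"
  unfolding orbit_def using act_0[of x] gauss_simps(1) by (metis (mono_tags, lifting) mem_Collect_eq)

lemma orbit_act: "a \<in> gauss \<Longrightarrow> b \<in> gauss \<Longrightarrow> c \<in> gauss \<Longrightarrow> orbit (act a b c x) = orbit x"
proof -
  have sub: "orbit (act a b c x) \<subseteq> orbit x" if "a \<in> gauss" "b \<in> gauss" "c \<in> gauss" for a b c x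
  proof
    fix y assume "y \<in> orbit (act a b c x)"
    then obtain a' b' c' where "a' \<in> gauss" "b' \<in> gauss" "c' \<in> gauss"
        "y = act (a' + a) (b' + b) (c' + c + cnj b' * a) x"
      by (auto simp: orbit_def act_act)
    moreover have "a' + a \<in> gauss" "b' + b \<in> gauss" "c' + c + cnj b' * a \<in> gauss"
      using that calculation by (simp_all add: gauss_add gauss_mult gauss_cnj)
    ultimately show "y \<in> orbit x" unfolding orbit_def by blast
  qed
  assume g: "a \<in> gauss" "b \<in> gauss" "c \<in> gauss"
  have "orbit (act (- a) (- b) (- c + cnj b * a) (act a b c x)) \<subseteq> orbit (act a b c x)"
    using g by (intro sub) (simp_all add: gauss_add gauss_mult gauss_cnj gauss_minus gauss_diff)
  then have "orbit x \<subseteq> orbit (act a b c x)" unfolding act_inverse(1) .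
  then show ?thesis using sub[OF g] by blast
qed

lemma orbit_eq: "orbit x = orbit y \<longleftrightarrow> (\<exists>a\<in>gauss. \<exists>b\<in>gauss. \<exists>c\<in>gauss. y = act a b c x)"
proof
  assume "orbit x = orbit y"
  then have "y \<in> orbit x" using orbit_self by simp
  then show "\<exists>a\<in>gauss. \<exists>b\<in>gauss. \<exists>c\<in>gauss. y = act a b c x" unfolding orbit_def by blast
qed (use orbit_act in auto)

text \<open>The three coordinates of the only group element that can carry one point to another. They depend
  continuously on both points, so lying in one orbit becomes the closed condition that they are
  Gaussian integers; Hausdorffness and freeness of the action both follow from this.\<close>

definition param1 :: "complex ^ (3 + 1) \<Rightarrow> complex ^ (3 + 1) \<Rightarrow> complex" where
  "param1 x y = y $ Inl 1 - x $ Inl 1"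

definition param2 :: "complex ^ (3 + 1) \<Rightarrow> complex ^ (3 + 1) \<Rightarrow> complex" where
  "param2 x y = untwist (base_coord y) (y $ Inl 2) - untwist (base_coord x) (x $ Inl 2)"

definition param3 :: "complex ^ (3 + 1) \<Rightarrow> complex ^ (3 + 1) \<Rightarrow> complex" where
  "param3 x y = y $ Inl 3 - x $ Inl 3 - cnj (param2 x y) * x $ Inl 1"

lemma act_nth:
  "act a b c x $ Inl 1 = x $ Inl 1 + a" "act a b c x $ Inl 2 = x $ Inl 2 + (b + base_coord x * cnj b)"
  "act a b c x $ Inl 3 = x $ Inl 3 + c + cnj b * x $ Inl 1"
  by (simp_all add: act_def)

lemma act_iff_params:
  assumes "x \<in> disc_domain" "y \<in> disc_domain"
  shows "y = act a b c x \<longleftrightarrow> base_coord y = base_coord x \<and> param1 x y = a \<and> param2 x y = b \<and> param3 x y = c"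
proof
  have t: "norm (base_coord x) < 1" using assms by (simp add: disc_domain_def)
  show "base_coord y = base_coord x \<and> param1 x y = a \<and> param2 x y = b \<and> param3 x y = c" if "y = act a b c x"
  proof -
    have p2: "param2 x y = b"
      unfolding that param2_def act_nth base_coord_act untwist_add[of _ "x $ Inl 2"] untwist_twist[OF t] by simp
    show ?thesis using p2 unfolding param3_def param1_def that act_nth base_coord_act by simp
  qed
  assume h: "base_coord y = base_coord x \<and> param1 x y = a \<and> param2 x y = b \<and> param3 x y = c"
  have "untwist (base_coord y) (y $ Inl 2) - untwist (base_coord x) (x $ Inl 2) = b"
      "base_coord y = base_coord x" using h unfolding param2_def by blast+
  then have "untwist (base_coord x) (y $ Inl 2) = untwist (base_coord x) (x $ Inl 2) + b" by (simp add:
      diff_eq_eq add.commute)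
  then have "y $ Inl 2 = (untwist (base_coord x) (x $ Inl 2) + b) + base_coord x * cnj (untwist (base_coord x)
      (x $ Inl 2) + b)"
    using twist_untwist[OF t, of "y $ Inl 2"] by simp
  also have "\<dots> = x $ Inl 2 + (b + base_coord x * cnj b)"
    using twist_untwist[OF t, of "x $ Inl 2"] by (simp add: algebra_simps)
  finally have "y $ Inl 2 = act a b c x $ Inl 2" by (simp add: act_nth)
  moreover have "y $ Inl 1 = act a b c x $ Inl 1" "y $ Inl 3 = act a b c x $ Inl 3"
    using h by (auto simp: act_nth param1_def param3_def)
  ultimately have "y $ Inl j = act a b c x $ Inl j" for j using exhaust_3[of j] by auto
  then show "y = act a b c x" using h by (intro vec_sum_eqI) simp_all
qed

text \<open>The condition is closed in \<open>(x, y)\<close>, because the Gaussian integers form a closed set.\<close>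

lemma orbit_eq_params:
  assumes "x \<in> disc_domain" "y \<in> disc_domain"
  shows "orbit x = orbit y \<longleftrightarrow> base_coord y - base_coord x = 0 \<and> param1 x y \<in> gauss \<and> param2 x y \<in> gauss \<and> param3
      x y \<in> gauss"
  unfolding orbit_eq act_iff_params[OF assms] by auto

lemma disc_domain_open: "open disc_domain"
proof -
  have "continuous_on UNIV (\<lambda>x :: complex ^ (3 + 1). norm (base_coord x))"
    by (intro continuous_on_norm continuous_on_component continuous_on_id)
  then have "open ((\<lambda>x :: complex ^ (3 + 1). norm (base_coord x)) -` {..<1})" by (intro open_vimage) auto
  then show ?thesis by (simp add: disc_domain_def vimage_def)
qed

lemma untwist_continuous:
  assumes "continuous_on S f" "continuous_on S g" "\<And>x. x \<in> S \<Longrightarrow> norm (f x) < 1"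
  shows "continuous_on S (\<lambda>x. untwist (f x) (g x))"
  unfolding untwist_def
  by (intro continuous_on_divide continuous_on_diff continuous_on_mult continuous_on_cnj continuous_on_const
      assms(1,2))
    (use untwist_denominator assms(3) in auto)

lemma params_continuous:
  assumes "continuous_on S f" "continuous_on S g" "\<And>x. x \<in> S \<Longrightarrow> f x \<in> disc_domain"
      "\<And>x. x \<in> S \<Longrightarrow> g x \<in> disc_domain"
  shows "continuous_on S (\<lambda>x. param1 (f x) (g x))" "continuous_on S (\<lambda>x. param2 (f x) (g x))"
    "continuous_on S (\<lambda>x. param3 (f x) (g x))" "continuous_on S (\<lambda>x. base_coord (g x) - base_coord (f x))"
proof -
  note c = continuous_on_component[OF assms(1)] continuous_on_component[OF assms(2)]
  show p2: "continuous_on S (\<lambda>x. param2 (f x) (g x))"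
    unfolding param2_def
    by (intro continuous_on_diff untwist_continuous c) (use assms in \<open>auto simp: disc_domain_def\<close>)
  show "continuous_on S (\<lambda>x. param1 (f x) (g x))" "continuous_on S (\<lambda>x. base_coord (g x) - base_coord (f x))"
    unfolding param1_def by (intro continuous_on_diff c)+
  show "continuous_on S (\<lambda>x. param3 (f x) (g x))"
    unfolding param3_def by (intro continuous_on_diff continuous_on_mult continuous_on_cnj c p2)
qed

text \<open>The quotient topology.\<close>

definition orbit_top :: "point topology" where
  "orbit_top = topology (\<lambda>U. U \<subseteq> orbit ` disc_domain \<and> open {x \<in> disc_domain. orbit x \<in> U})"

lemma openin_orbit_top: "openin orbit_top U \<longleftrightarrow> U \<subseteq> orbit ` disc_domain \<and> open {x \<in> disc_domain. orbit x \<in> U}"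
proof -
  have "istopology (\<lambda>U. U \<subseteq> orbit ` disc_domain \<and> open {x \<in> disc_domain. orbit x \<in> U})"
    unfolding istopology_def
  proof (intro conjI allI impI)
    fix S V assume "S \<subseteq> orbit ` disc_domain \<and> open {x \<in> disc_domain. orbit x \<in> S}"
      "V \<subseteq> orbit ` disc_domain \<and> open {x \<in> disc_domain. orbit x \<in> V}"
    moreover have "{x \<in> disc_domain. orbit x \<in> S \<inter> V} = {x \<in> disc_domain. orbit x \<in> S} \<inter> {x \<in> disc_domain. orbit
        x \<in> V}"
      by auto
    ultimately show "S \<inter> V \<subseteq> orbit ` disc_domain" "open {x \<in> disc_domain. orbit x \<in> S \<inter> V}" by auto
  next
    fix K assume K: "\<forall>V\<in>K. V \<subseteq> orbit ` disc_domain \<and> open {x \<in> disc_domain. orbit x \<in> V}"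
    have "{x \<in> disc_domain. orbit x \<in> \<Union>K} = (\<Union>V\<in>K. {x \<in> disc_domain. orbit x \<in> V})" by auto
    then show "\<Union>K \<subseteq> orbit ` disc_domain" "open {x \<in> disc_domain. orbit x \<in> \<Union>K}" using K by auto
  qed
  then show ?thesis by (simp add: orbit_top_def topology_inverse')
qed

lemma topspace_orbit_top: "topspace orbit_top = orbit ` disc_domain"
proof
  have "openin orbit_top (orbit ` disc_domain)"
  proof -
    have "{x \<in> disc_domain. orbit x \<in> orbit ` disc_domain} = disc_domain" by auto
    then show ?thesis unfolding openin_orbit_top using disc_domain_open by simp
  qed
  then show "orbit ` disc_domain \<subseteq> topspace orbit_top" by (rule openin_subset)
  show "topspace orbit_top \<subseteq> orbit ` disc_domain" using openin_orbit_top openin_topspace by blast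
qed

lemma has_cderiv_act:
  "has_cderiv (act a b c) (\<lambda>u. emb (vector [u $ Inl 1, u $ Inl 2 + cnj b * base_coord u, u $ Inl 3 + cnj b * u $
      Inl 1]) (base_coord u)) x"
  (is "has_cderiv _ ?L _")
proof -
  have L: "bounded_linear ?L"
    by (rule linear_conv_bounded_linear[THEN iffD1], rule linearI; rule emb_eqI)
      (simp_all add: vec_eq_iff forall_3 algebra_simps)
  have e: "act a b c = (\<lambda>x. ?L x + emb (vector [a, b, c]) 0)"
    by (rule ext, rule emb_eqI) (simp_all add: vec_eq_iff forall_3 algebra_simps)
  have "(act a b c has_derivative ?L) (at x)"
    unfolding e using has_derivative_add[OF bounded_linear_imp_has_derivative[OF L] has_derivative_const] by
        fastforce
  moreover have "?L (d *s v) = d *s ?L v" for d v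
    by (rule emb_eqI) (simp_all add: vec_eq_iff forall_3 algebra_simps)
  ultimately show ?thesis by (simp add: has_cderiv_def)
qed

lemma act_continuous: "continuous_on S (act a b c)"
  by (intro continuous_at_imp_continuous_on ballI has_cderiv_continuous[OF has_cderiv_act])

lemma act_image_open: "open U \<Longrightarrow> open (act a b c ` U)"
proof -
  assume "open U"
  moreover have "act a b c ` U = act (- a) (- b) (- c + cnj b * a) -` U"
    using act_inverse[of a b c] by (auto simp: image_iff) metis
  ultimately show ?thesis using open_vimage[OF _ act_continuous] by simp
qed

lemma orbit_open: "open_map (top_of_set disc_domain) orbit_top orbit"
  unfolding open_map_def
proof (intro allI impI)
  fix U assume "openin (top_of_set disc_domain) U"
  then have U: "open U" "U \<subseteq> disc_domain" using openin_open_eq[OF disc_domain_open] by auto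
  have "{x \<in> disc_domain. orbit x \<in> orbit ` U} = (\<Union>(a, b, c)\<in>gauss \<times> gauss \<times> gauss. act a b c ` U)"
  proof (intro set_eqI iffI)
    fix x assume "x \<in> {x \<in> disc_domain. orbit x \<in> orbit ` U}"
    then obtain u where "u \<in> U" "orbit u = orbit x" by auto
    then show "x \<in> (\<Union>(a, b, c)\<in>gauss \<times> gauss \<times> gauss. act a b c ` U)" unfolding orbit_eq by auto
  next
    fix x assume "x \<in> (\<Union>(a, b, c)\<in>gauss \<times> gauss \<times> gauss. act a b c ` U)"
    then show "x \<in> {x \<in> disc_domain. orbit x \<in> orbit ` U}" using U(2) orbit_act by auto
  qed
  moreover have "open (\<Union>(a, b, c)\<in>gauss \<times> gauss \<times> gauss. act a b c ` U)"
    using act_image_open[OF U(1)] by (intro open_UN) auto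
  ultimately show "openin orbit_top (orbit ` U)" unfolding openin_orbit_top using U(2) by auto
qed

text \<open>All points of an orbit have the same last coordinate, so any of them may be chosen.\<close>

definition base :: "point \<Rightarrow> complex" where
  "base p = base_coord (SOME x. x \<in> p)"

lemma base_orbit: "base (orbit x) = base_coord x"
proof -
  have "(SOME y. y \<in> orbit x) \<in> orbit x" using someI[of "\<lambda>y. y \<in> orbit x", OF orbit_self] .
  then show ?thesis unfolding base_def orbit_def by auto
qed

interpretation heis_family: fibred_quotient disc_domain orbit orbit_top base
proof
  show "open disc_domain" by (rule disc_domain_open)
  show "topspace orbit_top = orbit ` disc_domain" by (rule topspace_orbit_top)
  show "continuous_map (top_of_set disc_domain) orbit_top orbit"
    unfolding continuous_map_def topspace_orbit_top openin_orbit_top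
    by (auto simp: openin_open_eq[OF disc_domain_open])
  show "open_map (top_of_set disc_domain) orbit_top orbit" by (rule orbit_open)
  show "base (orbit x) = base_coord x" for x by (rule base_orbit)
  show "\<exists>U. open U \<and> x \<in> U \<and> U \<subseteq> disc_domain \<and> inj_on orbit U" if x: "x \<in> disc_domain" for x
  proof -
    let ?f = "\<lambda>y. (param1 x y, param2 x y, y $ Inl 3 - x $ Inl 3)"
    let ?B = "ball 0 (1/2) \<times> ball 0 (1/2) \<times> ball (0::complex) (1/2) :: (complex \<times> complex \<times> complex) set"
    let ?U = "disc_domain \<inter> ?f -` ?B"
    have "continuous_on disc_domain ?f"
      using params_continuous[of disc_domain "\<lambda>_. x" "\<lambda>y. y"] x
      by (intro continuous_on_Pair continuous_on_diff continuous_on_component) (auto intro: continuous_on_id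
          continuous_on_const)
    then have "open ?U" by (intro continuous_open_preimage disc_domain_open open_Times) auto
    moreover have "x \<in> ?U" using x by (simp add: param1_def param2_def)
    moreover have "inj_on orbit ?U"
    proof (rule inj_onI)
      fix y z assume y: "y \<in> ?U" and z: "z \<in> ?U" and eq: "orbit y = orbit z"
      have d: "y \<in> disc_domain" "z \<in> disc_domain" using y z by auto
      have small: "norm (u - v) < 1" if "norm u < 1/2" "norm v < 1/2" for u v :: complex
        using norm_triangle_ineq4[of u v] that by linarith
      have g: "base_coord z = base_coord y" "param1 y z \<in> gauss" "param2 y z \<in> gauss" "param3 y z \<in> gauss"
        using eq unfolding orbit_eq_params[OF d] by auto
      have "param1 y z = param1 x z - param1 x y" by (simp add: param1_def)
      then have 1: "param1 y z = 0" using gauss_discrete[OF g(2)] small y z by simp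
      have "param2 y z = param2 x z - param2 x y" by (simp add: param2_def)
      then have 2: "param2 y z = 0" using gauss_discrete[OF g(3)] small y z by simp
      have "param3 y z = (z $ Inl 3 - x $ Inl 3) - (y $ Inl 3 - x $ Inl 3)" by (simp add: param3_def 2)
      then have "norm (param3 y z) < 1" using small[of "z $ Inl 3 - x $ Inl 3" "y $ Inl 3 - x $ Inl 3"] y z by
          simp
      then have "param3 y z = 0" by (rule gauss_discrete[OF g(4)])
      then have "z = act 0 0 0 y" using act_iff_params[OF d] 1 2 g(1) by simp
      then show "y = z" by (simp add: act_0)
    qed
    ultimately show ?thesis by blast
  qed
  show "\<exists>N g. open N \<and> x \<in> N \<and> N \<subseteq> disc_domain \<and> g x = y \<and> g ` N \<subseteq> disc_domain \<and>
      (\<forall>n\<in>N. orbit (g n) = orbit n) \<and> holomorphic_map_on N g"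
    if x: "x \<in> disc_domain" "orbit x = orbit y" for x y
  proof -
    obtain a b c where g: "a \<in> gauss" "b \<in> gauss" "c \<in> gauss" "y = act a b c x" using x(2) unfolding orbit_eq by
        blast
    have "holomorphic_map_on disc_domain (act a b c)"
      unfolding holomorphic_map_on_iff using has_cderiv_act by blast
    then show ?thesis using x(1) g orbit_act disc_domain_open
      by (intro exI[of _ disc_domain] exI[of _ "act a b c"]) auto
  qed
qed

text \<open>An open quotient map whose equivalence relation is closed has a Hausdorff quotient.\<close>

lemma orbit_Hausdorff: "Hausdorff_space orbit_top"
  unfolding Hausdorff_space_def topspace_orbit_top
proof (intro allI impI)
  fix p r assume "p \<in> orbit ` disc_domain \<and> r \<in> orbit ` disc_domain \<and> p \<noteq> r"
  then obtain x y where xy: "x \<in> disc_domain" "y \<in> disc_domain" "p = orbit x" "r = orbit y" "orbit x \<noteq> orbit y"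
      by blast
  let ?f = "\<lambda>z. (base_coord (snd z) - base_coord (fst z), param1 (fst z) (snd z), param2 (fst z) (snd z), param3
      (fst z) (snd z))"
  let ?D = "disc_domain \<times> disc_domain"
  let ?G = "{0} \<times> gauss \<times> gauss \<times> gauss :: (complex \<times> complex \<times> complex \<times> complex) set"
  have "continuous_on ?D ?f"
  proof -
    have c: "continuous_on ?D fst" "continuous_on ?D snd"
      by (rule continuous_on_fst[OF continuous_on_id], rule continuous_on_snd[OF continuous_on_id])
    show ?thesis by (intro continuous_on_Pair params_continuous[OF c]) auto
  qed
  moreover have "closed ?G" by (intro closed_Times gauss_closed closed_singleton)
  ultimately have op: "open (?D \<inter> ?f -` (- ?G))"
    by (intro continuous_open_preimage open_Times disc_domain_open) (auto simp: open_Compl)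
  have iff: "z \<in> ?D \<inter> ?f -` (- ?G) \<longleftrightarrow> z \<in> ?D \<and> orbit (fst z) \<noteq> orbit (snd z)" for z
    using orbit_eq_params[of "fst z" "snd z"] by (cases z) auto
  have "(x, y) \<in> ?D \<inter> ?f -` (- ?G)" unfolding iff using xy by simp
  from open_prod_elim[OF op this] obtain A B where AB: "open A" "open B" "(x, y) \<in> A \<times> B"
      "A \<times> B \<subseteq> ?D \<inter> ?f -` (- ?G)"
    by blast
  have D: "A \<subseteq> disc_domain" "B \<subseteq> disc_domain" using AB(3,4) by auto
  have "disjnt (orbit ` A) (orbit ` B)"
    unfolding disjnt_iff
  proof (intro allI notI)
    fix o' assume "o' \<in> orbit ` A \<and> o' \<in> orbit ` B"
    then obtain u v where uv: "u \<in> A" "v \<in> B" "orbit u = orbit v" by auto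
    then have "(u, v) \<in> ?D \<inter> ?f -` (- ?G)" using AB(4) by blast
    then show False using iff[of "(u, v)"] uv(3) by simp
  qed
  moreover have "p \<in> orbit ` A" "r \<in> orbit ` B" using AB(3) xy(3,4) by auto
  ultimately show "\<exists>U V. openin orbit_top U \<and> openin orbit_top V \<and> p \<in> U \<and> r \<in> V \<and> disjnt U V"
    using heis_family.image_open[OF AB(1) D(1)] heis_family.image_open[OF AB(2) D(2)] by blast
qed

lemma proper_map_compact_projection:
  assumes "compact A"
  shows "proper_map (top_of_set (A \<times> B)) (top_of_set B) snd"
  unfolding proper_map_def
proof (intro conjI ballI)
  have "compact_space (top_of_set A)" using assms by (simp add: compact_space_subtopology)
  have "top_of_set (A \<times> B) = prod_topology (top_of_set A) (top_of_set B)"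
    using subtopology_Times[of euclidean euclidean A B] by simp
  then show "closed_map (top_of_set (A \<times> B)) (top_of_set B) snd"
    using closed_map_snd[OF \<open>compact_space (top_of_set A)\<close>, of "top_of_set B"] by metis
  fix y assume y: "y \<in> topspace (top_of_set B)"
  have "{x \<in> topspace (top_of_set (A \<times> B)). snd x = y} = A \<times> {y}" using y by auto
  then show "compactin (top_of_set (A \<times> B)) {x \<in> topspace (top_of_set (A \<times> B)). snd x = y}"
    using assms y by (auto simp: compactin_subtopology compact_Times)
qed

text \<open>The compact fundamental domains of the fibres form a trivial family over the disc. It maps onto the
  total space, and properness descends along surjections.\<close>

lemma base_proper: "proper_map orbit_top (top_of_set unit_disc) base"
proof (rule proper_map_from_composition_left)
  let ?h = "\<lambda>z :: (complex ^ 3) \<times> complex. emb (torus_param (snd z) (fst z)) (snd z)"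
  let ?K = "unit_cube \<times> unit_disc"
  have h: "?h z \<in> disc_domain" if "z \<in> ?K" for z using that by (auto simp: disc_domain_def)
  have "compact unit_cube" by (simp add: unit_cube_def)
  then have "proper_map (top_of_set ?K) (top_of_set unit_disc) snd" by (rule proper_map_compact_projection)
  then show "proper_map (top_of_set ?K) (top_of_set unit_disc) (base \<circ> (orbit \<circ> ?h))"
  proof -
    have "base \<circ> (orbit \<circ> ?h) = snd" by (rule ext) (simp add: base_orbit)
    then show ?thesis using \<open>proper_map (top_of_set ?K) (top_of_set unit_disc) snd\<close> by (simp only:)
  qed
  have "continuous_on ?K ?h"
  proof -
    have e: "?h = (\<lambda>z. \<chi> i. case i of Inl j \<Rightarrow> (fst z $ j + (if j = 2 then snd z * cnj (fst z $ j) else 0)) | Inr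
        _ \<Rightarrow> snd z)"
      by (rule ext, rule emb_eqI) (simp_all add: vec_eq_iff forall_3 torus_param_def)
    show ?thesis unfolding e
    proof (rule continuous_on_vec_lambda)
      fix i :: "3 + 1"
      show "continuous_on ?K (\<lambda>z. case i of Inl j \<Rightarrow> (fst z $ j + (if j = 2 then snd z * cnj (fst z $ j) else 0))
          | Inr _ \<Rightarrow> snd z)"
      proof (cases i)
        case (Inl j)
        then show ?thesis
          by (cases "j = 2") (auto intro!: continuous_on_add continuous_on_mult continuous_on_cnj
              continuous_on_component continuous_on_fst continuous_on_snd continuous_on_id continuous_on_const)
      qed (auto intro: continuous_on_snd continuous_on_id)
    qed
  qed
  then have "continuous_map (top_of_set ?K) (top_of_set disc_domain) ?h"
    using h by (auto simp: continuous_map_in_subtopology)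
  then show "continuous_map (top_of_set ?K) orbit_top (orbit \<circ> ?h)"
    using heis_family.q_continuous by (rule continuous_map_compose)
  show "(orbit \<circ> ?h) ` topspace (top_of_set ?K) = topspace orbit_top"
    unfolding topspace_orbit_top
  proof
    show "(orbit \<circ> ?h) ` topspace (top_of_set ?K) \<subseteq> orbit ` disc_domain" using h by auto
    show "orbit ` disc_domain \<subseteq> (orbit \<circ> ?h) ` topspace (top_of_set ?K)"
    proof
      fix p assume "p \<in> orbit ` disc_domain"
      then obtain x where x: "norm (base_coord x) < 1" "p = orbit x" by (auto simp: disc_domain_def)
      obtain a b c z where g: "a \<in> gauss" "b \<in> gauss" "c \<in> gauss" "z \<in> unit_cube"
          "heis (base_coord x) a b c (fibre_coords x) = torus_param (base_coord x) z"
        using fundamental_domain[OF x(1)] by blast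
      have "act a b c x = ?h (z, base_coord x)" using g(5) by (simp add: act_def)
      then have "p = (orbit \<circ> ?h) (z, base_coord x)" using x(2) orbit_act[OF g(1-3), of x] by simp
      then show "p \<in> (orbit \<circ> ?h) ` topspace (top_of_set ?K)" using g(4) x(1) by (intro image_eqI) auto
    qed
  qed
qed

abbreviation heis_total :: "(point, 3 + 1) cmfd" where
  "heis_total \<equiv> heis_family.total"

lemma heis_holomorphic_family: "holomorphic_family heis_total base"
  by (rule heis_family.holomorphic_family_total[OF orbit_Hausdorff base_proper]) (auto simp: disc_domain_def)

lemma heis_fibre_compact: "t \<in> unit_disc \<Longrightarrow> compact_complex_manifold (fibre heis_total base t)"
  by (rule heis_family.fibre_compact_complex_manifold[OF orbit_Hausdorff base_proper])

section \<open>Absence of pseudo-Kaehler forms away from the centre\<close>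

lemma smult_axis [simp]: "\<i> *s axis j 1 = axis j \<i>"
  by (simp add: vec_eq_iff axis_def)

lemma complex_scale_real: "a *s u = Re a *\<^sub>R u + Im a *\<^sub>R (\<i> *s u)" for u :: "complex ^ 'n"
  by (simp add: vec_eq_iff complex_eq_iff)

lemma i_i_scale: "\<i> *s (\<i> *s u) = - u" for u :: "complex ^ 'n"
  by (simp add: vec_eq_iff)

text \<open>For a real form of type (1,1) this is complex linear in the first and conjugate linear in the second
  argument; the form is recovered as minus its imaginary part.\<close>

definition hermitian_part :: "(complex ^ 'n \<Rightarrow> complex ^ 'n \<Rightarrow> real) \<Rightarrow> complex ^ 'n \<Rightarrow> complex ^ 'n \<Rightarrow> complex"
    where
  "hermitian_part B u v = of_real (B u (\<i> *s v)) - \<i> * of_real (B u v)"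

context
  fixes B :: "complex ^ 'n::finite \<Rightarrow> complex ^ 'n \<Rightarrow> real"
  assumes bil: "bilinear B" and alt: "\<And>u. B u u = 0" and Jinv: "\<And>u v. B (\<i> *s u) (\<i> *s v) = B u v"
begin

lemma form_antisym: "B u v = - B v u"
proof -
  have "B (u + v) (u + v) = B u u + B v u + (B u v + B v v)"
    by (simp add: bilinear_ladd[OF bil] bilinear_radd[OF bil])
  then show ?thesis by (simp add: alt)
qed

lemma form_J: "B (\<i> *s u) v = - B u (\<i> *s v)"
  using Jinv[of u "\<i> *s v"] by (simp add: i_i_scale bilinear_rneg[OF bil])

lemma hermitian_part_add:
  "hermitian_part B (u + u') v = hermitian_part B u v + hermitian_part B u' v"
  "hermitian_part B u (v + v') = hermitian_part B u v + hermitian_part B u v'"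
  by (simp_all add: hermitian_part_def bilinear_ladd[OF bil] bilinear_radd[OF bil] vector_add_ldistrib
      algebra_simps)

lemma hermitian_part_scale:
  "hermitian_part B (a *s u) v = a * hermitian_part B u v"
  "hermitian_part B u (a *s v) = cnj a * hermitian_part B u v"
proof -
  have l: "B (a *s u) w = Re a * B u w - Im a * B u (\<i> *s w)" for w
    by (subst complex_scale_real) (simp add: bilinear_ladd[OF bil] bilinear_lmul[OF bil] form_J)
  have r: "B u (a *s w) = Re a * B u w + Im a * B u (\<i> *s w)" for w
    by (subst complex_scale_real) (simp add: bilinear_radd[OF bil] bilinear_rmul[OF bil])
  have s: "\<i> *s (a *s v) = a *s (\<i> *s v)" by (simp add: vec_eq_iff)
  show "hermitian_part B (a *s u) v = a * hermitian_part B u v"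
    unfolding hermitian_part_def l by (simp add: i_i_scale bilinear_rneg[OF bil] complex_eq_iff)
  show "hermitian_part B u (a *s v) = cnj a * hermitian_part B u v"
    unfolding hermitian_part_def s r by (simp add: i_i_scale bilinear_rneg[OF bil] complex_eq_iff)
qed

lemma hermitian_part_cnj: "hermitian_part B v u = cnj (hermitian_part B u v)"
  using form_antisym[of v u] form_antisym[of v "\<i> *s u"] form_J[of u v] by (simp add: hermitian_part_def)

end

lemma mixed_det_det: "mixed_det H H H x = 6 * det (\<chi> k j. H j k x)"
  unfolding mixed_det_def mixed_cofactor_def sum_3 three_arith det_3 by (simp add: algebra_simps)

text \<open>The differential of the group element \<open>(a, b, c)\<close>.\<close>

definition heis_lin :: "complex \<Rightarrow> complex ^ 3 \<Rightarrow> complex ^ 3" where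
  "heis_lin b u = vector [u $ 1, u $ 2, u $ 3 + cnj b * u $ 1]"

lemma heis_lin_nth [simp]: "heis_lin b u $ 1 = u $ 1" "heis_lin b u $ 2 = u $ 2"
    "heis_lin b u $ 3 = u $ 3 + cnj b * u $ 1"
  by (simp_all add: heis_lin_def)

lemma heis_lin_0: "heis_lin 0 u = u"
  by (simp add: vec_eq_iff forall_3)

lemma heis_0: "heis t 0 0 0 x = x"
  by (simp add: vec_eq_iff forall_3)

lemma heis_lin_axis: "heis_lin b (axis j 1) = axis j 1 + (if j = 1 then cnj b *s axis 3 1 else 0)"
  using exhaust_3[of j] by (auto simp: vec_eq_iff forall_3 axis_def)

lemma heis_lin_scale: "heis_lin b (a *s u) = a *s heis_lin b u"
  by (simp add: vec_eq_iff forall_3 algebra_simps)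

lemma has_cderiv_heis: "has_cderiv (heis t a b c) (heis_lin b) x"
proof -
  have L: "bounded_linear (heis_lin b)"
    by (rule linear_conv_bounded_linear[THEN iffD1], rule linearI)
      (simp_all add: vec_eq_iff forall_3 algebra_simps)
  have e: "heis t a b c = (\<lambda>x. heis_lin b x + vector [a, b + t * cnj b, c])"
    by (rule ext) (simp add: vec_eq_iff forall_3)
  have "(heis t a b c has_derivative heis_lin b) (at x)"
    unfolding e using has_derivative_add[OF bounded_linear_imp_has_derivative[OF L] has_derivative_const] by
        fastforce
  then show ?thesis by (simp add: has_cderiv_def heis_lin_scale)
qed

abbreviation fib_map :: "complex \<Rightarrow> complex ^ 3 \<Rightarrow> point" where
  "fib_map t \<equiv> heis_family.slice_map t"

abbreviation fib_top :: "complex \<Rightarrow> point topology" where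
  "fib_top t \<equiv> heis_family.slice_top t"

abbreviation X_fib :: "complex \<Rightarrow> (point, 3) cmfd" where
  "X_fib t \<equiv> fibre heis_total base t"

lemma slice_UNIV: "norm t < 1 \<Longrightarrow> heis_family.slice t = UNIV"
  unfolding heis_family.slice_def by (auto simp: disc_domain_def)

lemma fib_quotient: "norm t < 1 \<Longrightarrow> holomorphic_quotient UNIV (fib_map t) (fib_top t)"
  using heis_family.slice_quotient[of t] by (simp add: slice_UNIV)

lemma X_fib_atlas: "norm t < 1 \<Longrightarrow> atlas (X_fib t) = generated_atlas (fib_top t) (section_charts UNIV (fib_map
    t))"
  using heis_family.fibre_atlas[of t] by (simp add: slice_UNIV)

lemma fib_map_heis: "a \<in> gauss \<Longrightarrow> b \<in> gauss \<Longrightarrow> c \<in> gauss \<Longrightarrow> fib_map t (heis t a b c x) = fib_map t x"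
  using orbit_act[of a b c "emb x t"] by (simp add: heis_family.slice_map_def act_def)

lemma fib_map_eq:
  assumes "fib_map t x = fib_map t y"
  obtains a b c where "a \<in> gauss" "b \<in> gauss" "c \<in> gauss" "y = heis t a b c x"
proof -
  obtain a b c where "a \<in> gauss" "b \<in> gauss" "c \<in> gauss" "emb y t = act a b c (emb x t)"
    using assms unfolding heis_family.slice_map_def orbit_eq by blast
  moreover from this(4) have "y = heis t a b c x" by (metis act_def emb_nth(2) fibre_coords_emb)
  ultimately show ?thesis using that by blast
qed

text \<open>Read the form in the section charts. They differ by group elements, so the local expressions glue to one
  field \<open>B\<close> of bilinear forms on \<open>\<complex>\<^sup>3\<close>, equivariant under the differentials of the action.\<close>

theorem pseudo_kaehler_gives_kaehler_matrix:
  assumes t: "norm t < 1" and F: "pseudo_kaehler_structure (X_fib t) F"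
  shows "\<exists>H. kaehler_matrix t H \<and> (\<forall>x. mixed_det H H H x \<noteq> 0)"
proof -
  interpret S: holomorphic_quotient UNIV "fib_map t" "fib_top t" by (rule fib_quotient[OF t])
  let ?ch = "section_chart (fib_map t)"
  have at: "?ch U \<in> atlas (X_fib t)" if "S.good U" for U
    unfolding X_fib_atlas[OF t] by (rule S.section_charts_atlas[OF that])
  have F1: "\<And>c p. c \<in> atlas (X_fib t) \<Longrightarrow> p \<in> fst c \<Longrightarrow> bilinear (F c p) \<and> (\<forall>u. F c p u u = 0)"
    and F2: "\<And>c d p u v. c \<in> atlas (X_fib t) \<Longrightarrow> d \<in> atlas (X_fib t) \<Longrightarrow> p \<in> fst c \<inter> fst d \<Longrightarrow>
        F c p u v = F d p (coord_change c d p u) (coord_change c d p v)"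
    and F3: "\<And>c u v. c \<in> atlas (X_fib t) \<Longrightarrow> smooth_on (snd c ` fst c) (coeff_fun F c u v)"
    using F unfolding pseudo_kaehler_structure_def smooth_two_form_def by blast+
  have F4: "\<And>c z u v w. c \<in> atlas (X_fib t) \<Longrightarrow> z \<in> snd c ` fst c \<Longrightarrow>
        dir_deriv u (coeff_fun F c v w) z - dir_deriv v (coeff_fun F c u w) z + dir_deriv w (coeff_fun F c u v)
            z = 0"
    using F unfolding pseudo_kaehler_structure_def closed_two_form_def dir_deriv_def by blast
  have F5: "\<And>c p u. c \<in> atlas (X_fib t) \<Longrightarrow> p \<in> fst c \<Longrightarrow> u \<noteq> 0 \<Longrightarrow> \<exists>v. F c p u v \<noteq> 0"
    and F6: "\<And>c p u v. c \<in> atlas (X_fib t) \<Longrightarrow> p \<in> fst c \<Longrightarrow> F c p (\<i> *s u) (\<i> *s v) = F c p u v"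
    using F unfolding pseudo_kaehler_structure_def nondegenerate_form_def J_invariant_form_def by blast+
  define V where "V x = (SOME U. S.good U \<and> x \<in> U)" for x
  have V: "S.good (V x)" "x \<in> V x" for x
    using someI_ex[of "\<lambda>U. S.good U \<and> x \<in> U"] S.locally_inj[of x] unfolding V_def by blast+
  define B where "B x = F (?ch (V x)) (fib_map t x)" for x
  have dom: "fib_map t x \<in> fst (?ch U)" if "x \<in> U" for x U
    using that by (simp add: section_chart_def)
  have trans: "F (?ch U) (fib_map t x) u v = F (?ch W) (fib_map t x) (heis_lin b u) (heis_lin b v)"
    if U: "S.good U" "x \<in> U" and W: "S.good W" "heis t a b c x \<in> W" and g: "a \<in> gauss" "b \<in> gauss" "c \<in> gauss"
    for U W x a b c u v
  proof -
    have "has_cderiv (snd (?ch W) \<circ> chart_inv (?ch U)) (heis_lin b) x"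
      by (rule S.section_chart_transition[OF U(1) W(1) U(2) W(2), where N=UNIV and g="heis t a b c"])
        (simp_all add: fib_map_heis[OF g] has_cderiv_heis)
    then have "coord_change (?ch U) (?ch W) (fib_map t x) = heis_lin b"
      unfolding coord_change_def S.section_chart_apply[OF U] has_cderiv_def
      using frechet_derivative_at by metis
    moreover have "fib_map t x \<in> fst (?ch U) \<inter> fst (?ch W)"
      using dom[OF U(2)] dom[OF W(2)] fib_map_heis[OF g] by simp
    ultimately show ?thesis using F2[OF at[OF U(1)] at[OF W(1)]] by metis
  qed
  have loc: "F (?ch U) (fib_map t x) u v = B x u v" if "S.good U" "x \<in> U" for U x u v
    using trans[where x=x and a=0 and b=0 and c=0 and u=u and v=v, OF that V(1)[of x]] V(2)[of x]
    unfolding B_def heis_0 heis_lin_0 by simp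
  have eqv: "B x u v = B (heis t a b c x) (heis_lin b u) (heis_lin b v)"
    if "a \<in> gauss" "b \<in> gauss" "c \<in> gauss" for a b c x u v
    using trans[OF V(1,2)[of x] V(1,2)[of "heis t a b c x"] that, of u v] fib_map_heis[OF that, of t x]
    unfolding B_def by simp
  have B1: "bilinear (B x)" "B x u u = 0" "B x (\<i> *s u) (\<i> *s v) = B x u v" for x u v
    using F1[OF at[OF V(1)] dom[OF V(2)]] F6[OF at[OF V(1)] dom[OF V(2)]] unfolding B_def by blast+
  have B2: "\<exists>v. B x u v \<noteq> 0" if "u \<noteq> 0" for x u
    using F5[OF at[OF V(1)] dom[OF V(2)] that] unfolding B_def by blast
  have coef: "coeff_fun F (?ch (V x)) u v y = B y u v" if "y \<in> V x" for x y u v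
    unfolding coeff_fun_def S.section_chart_inv[OF V(1) that] by (rule loc[OF V(1) that])
  have im: "snd (?ch (V x)) ` fst (?ch (V x)) = V x" for x by (rule S.section_chart_image[OF V(1)])
  have sm: "C1_on (V x) (\<lambda>y. B y u v)" for x u v
  proof -
    have "Ck_on (Suc 0) (V x) (coeff_fun F (?ch (V x)) u v)"
      using F3[OF at[OF V(1)[of x]], of u v] unfolding im smooth_on_def by blast
    moreover have "Ck_on (Suc 0) (V x) (coeff_fun F (?ch (V x)) u v) \<longleftrightarrow> Ck_on (Suc 0) (V x) (\<lambda>y. B y u v)"
      by (rule Ck_on_cong) (use V(1) coef in blast)+
    ultimately show ?thesis unfolding C1_on_def dir_deriv_def[abs_def] by simp
  qed
  have C: "C1_on UNIV (\<lambda>x. B x u v)" for u v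
    unfolding C1_on_def
  proof (intro conjI ballI allI)
    show "(\<lambda>x. B x u v) differentiable at x" for x using C1_on_differentiable[OF sm V(2)] .
    show "continuous_on UNIV (dir_deriv w (\<lambda>x. B x u v))" for w
    proof (rule continuous_at_imp_continuous_on, rule ballI)
      fix x
      have "continuous_on (V x) (dir_deriv w (\<lambda>x. B x u v))" using sm[of x u v] by (simp add: C1_on_def)
      then show "continuous (at x) (dir_deriv w (\<lambda>x. B x u v))"
        using continuous_on_eq_continuous_at V[of x] by blast
    qed
  qed
  define Q where "Q x u v w = dir_deriv u (\<lambda>y. B y v w) x" for x u v w
  have clo: "Q x u v w - Q x v u w + Q x w u v = 0" for x u v w
  proof -
    have "dir_deriv a (coeff_fun F (?ch (V x)) b c) x = Q x a b c" for a b c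
      unfolding Q_def by (rule dir_deriv_cong[of "V x"]) (use V[of x] coef in blast)+
    then show ?thesis using F4[OF at[OF V(1)[of x]], of x u v w] V(2)[of x] unfolding im by simp
  qed
  have QJ: "Q x u (\<i> *s v) w = - Q x u v (\<i> *s w)" "Q x u (\<i> *s v) (\<i> *s w) = Q x u v w" for x u v w
  proof -
    have "(\<lambda>y. B y (\<i> *s v) w) = (\<lambda>y. - B y v (\<i> *s w))" using form_J[OF B1] by (intro ext)
    then show "Q x u (\<i> *s v) w = - Q x u v (\<i> *s w)"
      unfolding Q_def
      by (simp only: dir_deriv_bounded_linear[OF bounded_linear_minus[OF bounded_linear_ident]
          C1_on_differentiable[OF C UNIV_I]])
    have "(\<lambda>y. B y (\<i> *s v) (\<i> *s w)) = (\<lambda>y. B y v w)" using B1(3) by (intro ext)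
    then show "Q x u (\<i> *s v) (\<i> *s w) = Q x u v w" unfolding Q_def by simp
  qed
  define H where "H j k x = hermitian_part (B x) (axis j 1) (axis k 1)" for j k x
  have He: "H j k = (\<lambda>x. of_real (B x (axis j 1) (axis k \<i>)) + (- \<i>) * of_real (B x (axis j 1) (axis k 1)))" for
      j k
    by (simp add: fun_eq_iff H_def hermitian_part_def)
  have Cc: "C1 (\<lambda>x. complex_of_real (B x u v))" for u v by (rule C1_on_bounded_linear[OF bounded_linear_of_real
      C])
  have HC: "C1 (H j k)" for j k unfolding He by (intro C1_on_add C1_on_mult C1_on_const Cc)
  have ddH: "dir_deriv u (H j k) x = of_real (Q x u (axis j 1) (axis k \<i>)) - \<i> * of_real (Q x u (axis j 1) (axis
      k 1))" for u j k x
  proof -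
    have d: "(\<lambda>x. complex_of_real (B x u v)) differentiable at x" for u v by (rule C1_on_differentiable[OF Cc
        UNIV_I])
    have e: "dir_deriv u (\<lambda>x. complex_of_real (B x v w)) x = of_real (Q x u v w)" for v w
      unfolding Q_def by (rule dir_deriv_bounded_linear[OF bounded_linear_of_real C1_on_differentiable[OF C
          UNIV_I]])
    show ?thesis unfolding He
      by (simp only: dir_deriv_add dir_deriv_mult dir_deriv_const d e differentiable_mult differentiable_const)
          simp
  qed
  have "kaehler_matrix t H"
    unfolding kaehler_matrix_def
  proof (intro conjI allI ballI)
    show "C1 (H j k)" for j k by (rule HC)
    show "H k j x = cnj (H j k x)" for j k x unfolding H_def by (rule hermitian_part_cnj[OF B1])
    show "wirtinger i (H j k) x = wirtinger j (H i k) x" for i j k x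
    proof -
      let ?e = "\<lambda>j. axis j 1 :: complex ^ 3" and ?f = "\<lambda>j. axis j \<i> :: complex ^ 3"
      \<comment> \<open>Closedness on \<open>e\<^sub>i, e\<^sub>j\<close> and on \<open>\<i> e\<^sub>i, \<i> e\<^sub>j\<close>, with third argument \<open>\<i> e\<^sub>k\<close> or \<open>e\<^sub>k\<close>: the
        differences are the real and the imaginary part of the claim, since the form has type (1,1).\<close>
      have a1: "Q x (?e i) (?e j) (?f k) - Q x (?e j) (?e i) (?f k) + Q x (?f k) (?e i) (?e j) = 0" by (rule
          clo)
      have a2: "Q x (?f i) (?e j) (?e k) - Q x (?f j) (?e i) (?e k) + Q x (?f k) (?e i) (?e j) = 0"
        using clo[of x "?f i" "?f j" "?f k"] QJ(2)[of x _ "?e _" "?e _"] by simp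
      have a3: "Q x (?e i) (?e j) (?e k) - Q x (?e j) (?e i) (?e k) + Q x (?e k) (?e i) (?e j) = 0" by (rule
          clo)
      have a4: "- Q x (?f i) (?e j) (?f k) + Q x (?f j) (?e i) (?f k) + Q x (?e k) (?e i) (?e j) = 0"
        using clo[of x "?f i" "?f j" "?e k"] QJ(1)[of x _ "?e _" "?e k"] QJ(2)[of x _ "?e _" "?e _"] by simp
      show ?thesis unfolding wirtinger_def ddH using a1 a2 a3 a4 by (simp add: complex_eq_iff)
    qed
    fix a b c j k x assume g: "a \<in> gauss" "b \<in> gauss" "c \<in> gauss"
    let ?y = "heis t a b c x"
    note add = hermitian_part_add[OF B1, of ?y] and sc = hermitian_part_scale[OF B1, of ?y]
    have "H j k x = hermitian_part (B ?y) (heis_lin b (axis j 1)) (heis_lin b (axis k 1))"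
      unfolding H_def hermitian_part_def using eqv[OF g, of x] by (simp only: heis_lin_scale)
    also have "\<dots> = pull b (\<lambda>j k. H j k ?y) j k"
      unfolding heis_lin_axis pull_def H_def
      by (cases "j = 1"; cases "k = 1") (simp_all add: add sc algebra_simps)
    finally show "H j k x = pull b (\<lambda>j k. H j k ?y) j k" .
  qed
  moreover have "mixed_det H H H x \<noteq> 0" for x
  proof
    assume "mixed_det H H H x = 0"
    then have "det (\<chi> k j. H j k x) = 0" by (simp add: mixed_det_det)
    then have "\<not> (\<exists>A. A ** (\<chi> k j. H j k x) = mat 1)"
      using invertible_det_nz invertible_left_inverse by blast
    then obtain u where u: "(\<chi> k j. H j k x) *v u = 0" "u \<noteq> 0" using matrix_left_invertible_ker by blast
    have col: "u $ 1 * H 1 k x + u $ 2 * H 2 k x + u $ 3 * H 3 k x = 0" for k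
    proof -
      have "((\<chi> k j. H j k x) *v u) $ k = 0" using u(1) by simp
      then show ?thesis by (simp add: matrix_vector_mult_def sum_3 mult.commute)
    qed
    have dec: "v = v $ 1 *s axis 1 1 + v $ 2 *s axis 2 1 + v $ 3 *s axis 3 1" for v :: "complex ^ 3"
      by (simp add: vec_eq_iff forall_3 axis_def)
    note add = hermitian_part_add[OF B1, of x] and sc = hermitian_part_scale[OF B1, of x]
    have uk: "hermitian_part (B x) u (axis k 1) = 0" for k
      by (subst dec[of u]) (simp add: add sc H_def[symmetric] col)
    have "hermitian_part (B x) u v = 0" for v
      by (subst dec[of v]) (simp add: add sc uk)
    then have "B x u v = 0" for v by (simp add: hermitian_part_def complex_eq_iff)
    then show False using B2[OF u(2)] by blast
  qed
  ultimately show ?thesis by blast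
qed

lemma X_fib_not_pseudo_kaehler: "norm t < 1 \<Longrightarrow> t \<noteq> 0 \<Longrightarrow> \<not> admits_pseudo_kaehler (X_fib t)"
  unfolding admits_pseudo_kaehler_def
  using pseudo_kaehler_gives_kaehler_matrix kaehler_matrix_degenerate by blast

section \<open>The pseudo-Kaehler form on the central fibre\<close>

lemma transition_chain:
  assumes c: "is_chart T c" and d: "is_chart T d" and p: "p \<in> fst c" "p \<in> fst d"
    and D: "has_cderiv (snd d \<circ> chart_inv c) D1 (snd c p)" "has_cderiv (snd e \<circ> chart_inv d) D2 (snd d p)"
  shows "has_cderiv (snd e \<circ> chart_inv c) (D2 \<circ> D1) (snd c p)"
proof -
  obtain N where N: "open N" "snd c p \<in> N" "N \<subseteq> snd c ` fst c" "\<And>y. y \<in> N \<Longrightarrow> chart_inv c y \<in> fst d"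
    using chart_neighbourhood[OF c chart_domain_open[OF d] p] by blast
  have "has_cderiv ((snd e \<circ> chart_inv d) \<circ> (snd d \<circ> chart_inv c)) (D2 \<circ> D1) (snd c p)"
    by (rule has_cderiv_compose[OF D(1)]) (simp add: chart_inv_left[OF c p(1)] D(2))
  then show ?thesis
    by (rule has_cderiv_cong[OF _ N(1,2)]) (simp add: chart_inv_left[OF d] N(4))
qed

text \<open>In the notation of the introduction, the real part of \<open>\<omega>\<^sub>2 \<and> cnj \<omega>\<^sub>3\<close> plus a multiple of
  \<open>\<i> \<omega>\<^sub>1 \<and> cnj \<omega>\<^sub>1\<close>, with \<open>v $ 3 - cnj (x $ 2) * v $ 1\<close> as the value of \<open>\<omega>\<^sub>3\<close> on \<open>v\<close>.\<close>

definition model_form :: "complex ^ 3 \<Rightarrow> complex ^ 3 \<Rightarrow> complex ^ 3 \<Rightarrow> real" where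
  "model_form x u v = Im (u $ 1 * cnj (v $ 1))
     + Re (u $ 2 * cnj (v $ 3 - cnj (x $ 2) * v $ 1) - v $ 2 * cnj (u $ 3 - cnj (x $ 2) * u $ 1))"

lemma model_form_heis: "model_form (heis 0 a b c x) (heis_lin b u) (heis_lin b v) = model_form x u v"
  unfolding model_form_def by (simp add: algebra_simps)

lemma model_form_bilinear: "linear A \<Longrightarrow> bilinear (\<lambda>u v. model_form x (A u) (A v))"
  unfolding bilinear_def
  by (intro conjI allI linearI)
    (simp_all add: linear_add linear_scale model_form_def algebra_simps)

lemma model_form_alternating: "model_form x u u = 0"
  unfolding model_form_def by (simp add: mult.commute)

lemma model_form_J: "model_form x (\<i> *s u) (\<i> *s v) = model_form x u v"
  unfolding model_form_def by (simp add: algebra_simps)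

text \<open>The three coframe values \<open>u $ 1\<close>, \<open>u $ 2\<close> and \<open>?w\<close> of \<open>u\<close> do not all vanish. The second one pairs with
  the third, and the first one with itself.\<close>

lemma model_form_nondegenerate:
  assumes "u \<noteq> 0" shows "\<exists>v. model_form x u v \<noteq> 0"
proof -
  let ?w = "u $ 3 - cnj (x $ 2) * u $ 1"
  have pos: "Re (z * cnj z) \<noteq> 0" if "z \<noteq> 0" for z using that by (simp add: complex_mult_cnj complex_eq_iff
      sum_power2_eq_zero_iff)
  consider "u $ 2 \<noteq> 0" | "?w \<noteq> 0" "u $ 2 = 0" | "u $ 1 \<noteq> 0" "u $ 2 = 0" "?w = 0"
  proof (cases "u $ 2 = 0 \<and> ?w = 0")
    case True
    then have "u $ 1 \<noteq> 0" using assms by (auto simp: vec_eq_iff forall_3)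
    then show ?thesis using True that(3) by blast
  qed (use that in blast)
  then show ?thesis
  proof cases
    case 1
    have "model_form x u (vector [0, 0, u $ 2]) = Re (u $ 2 * cnj (u $ 2))" by (simp add: model_form_def)
    then show ?thesis using pos[OF 1] by metis
  next
    case 2
    have "model_form x u (vector [0, ?w, 0]) = - Re (?w * cnj ?w)" by (simp add: model_form_def 2(2))
    then show ?thesis using pos[OF 2(1)] by (metis neg_equal_0_iff_equal)
  next
    case 3
    have "model_form x u (vector [- \<i> * u $ 1, 0, 0]) = Re (u $ 1 * cnj (u $ 1))"
      using 3 by (simp add: model_form_def)
    then show ?thesis using pos[OF 3(1)] by metis
  qed
qed

text \<open>In an arbitrary chart, define the form by pulling back the model form along the change to a section
  chart.\<close>

lemma X_fib_0_pseudo_kaehler: "admits_pseudo_kaehler (X_fib 0)"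
proof -
  have t: "norm (0::complex) < 1" by simp
  interpret S: holomorphic_quotient UNIV "fib_map 0" "fib_top 0" by (rule fib_quotient[OF t])
  let ?ch = "section_chart (fib_map 0)" and ?A = "atlas (X_fib 0)"
  have chart: "is_chart (fib_top 0) c" if "c \<in> ?A" for c
    using that unfolding X_fib_atlas[OF t] by (simp add: generated_atlas_def)
  have compat: "holomorphically_compatible c (?ch U)" if "c \<in> ?A" "S.good U" for c U
    using that unfolding X_fib_atlas[OF t] by (auto simp: generated_atlas_def section_charts_def)
  have compat2: "holomorphically_compatible c d" if "c \<in> ?A" "d \<in> ?A" for c d
    using heis_fibre_compact[of 0] that
    unfolding compact_complex_manifold_def complex_manifold_def by simp
  define x where "x p = (SOME x. fib_map 0 x = p)" for p
  define V where "V y = (SOME U. S.good U \<and> y \<in> U)" for y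
  have V: "S.good (V y)" "y \<in> V y" for y
    using someI_ex[of "\<lambda>U. S.good U \<and> y \<in> U"] S.locally_inj[of y] unfolding V_def by blast+
  have x: "fib_map 0 (x p) = p" if "c \<in> ?A" "p \<in> fst c" for c p
  proof -
    have "p \<in> topspace (fib_top 0)" using chart_domain_open[OF chart[OF that(1)]] that(2) openin_subset by blast
    then have "\<exists>x. fib_map 0 x = p" using S.topspace_eq by auto
    then show ?thesis unfolding x_def by (rule someI_ex)
  qed
  have dom: "fib_map 0 y \<in> fst (?ch U)" if "y \<in> U" for y U
    using that by (simp add: section_chart_def)
  define A :: "(point, 3) chart \<Rightarrow> point \<Rightarrow> (complex ^ 3) set \<Rightarrow> complex ^ 3 \<Rightarrow> complex ^ 3" where
    "A c p U = frechet_derivative (snd (?ch U) \<circ> chart_inv c) (at (snd c p))" for c p U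
  have A: "has_cderiv (snd (?ch U) \<circ> chart_inv c) (A c p U) (snd c p)" "bij (A c p U)"
    if h: "c \<in> ?A" "p \<in> fst c" "S.good U" "p \<in> fst (?ch U)" for c p U
  proof -
    obtain D where D: "has_cderiv (snd (?ch U) \<circ> chart_inv c) D (snd c p)" "bij D"
      using compatible_derivative[OF chart[OF h(1)] S.section_chart_is_chart[OF h(3)] compat[OF h(1,3)] h(2,4)]
          by blast
    then have "A c p U = D" unfolding A_def has_cderiv_def
      using frechet_derivative_at[of "snd (?ch U) \<circ> chart_inv c" D "snd c p"] by simp
    then show "has_cderiv (snd (?ch U) \<circ> chart_inv c) (A c p U) (snd c p)" "bij (A c p U)" using D by simp_all
  qed
  define F where "F c p u v = model_form (x p) (A c p (V (x p)) u) (A c p (V (x p)) v)" for c p u v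
  \<comment> \<open>Two lifts of a point differ by a group element, which preserves the model form; hence any lift
    and any section chart may be used.\<close>
  have F: "F c p u v = model_form y (A c p U u) (A c p U v)"
    if c: "c \<in> ?A" "p \<in> fst c" and U: "S.good U" "y \<in> U" and y: "fib_map 0 y = p" for c p U y u v
  proof -
    let ?W = "V (x p)"
    have W: "S.good ?W" "x p \<in> ?W" by (rule V)+
    have pW: "p \<in> fst (?ch ?W)" and pU: "p \<in> fst (?ch U)" using dom[OF W(2)] dom[OF U(2)] x[OF c] y by simp_all
    obtain a b d where g: "a \<in> gauss" "b \<in> gauss" "d \<in> gauss" "y = heis 0 a b d (x p)"
      using fib_map_eq[of 0 "x p" y] x[OF c] y by metis
    have "has_cderiv (snd (?ch U) \<circ> chart_inv (?ch ?W)) (heis_lin b) (x p)"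
      by (rule S.section_chart_transition[OF W(1) U(1) W(2) U(2), where N=UNIV and g="heis 0 a b d"])
        (simp_all add: fib_map_heis[OF g(1-3)] has_cderiv_heis g(4))
    then have "has_cderiv (snd (?ch U) \<circ> chart_inv (?ch ?W)) (heis_lin b) (snd (?ch ?W) p)"
      using S.section_chart_apply[OF W] x[OF c] by simp
    then have "has_cderiv (snd (?ch U) \<circ> chart_inv c) (heis_lin b \<circ> A c p ?W) (snd c p)"
      by (rule transition_chain[OF chart[OF c(1)] S.section_chart_is_chart[OF W(1)] c(2) pW A(1)[OF c W(1) pW]])
    then have "A c p U = heis_lin b \<circ> A c p ?W" using has_cderiv_unique A(1)[OF c U(1) pU] by blast
    then show ?thesis unfolding F_def g(4) by (simp add: model_form_heis)
  qed
  have lift: "fib_map 0 (x p) = p" "p \<in> fst (?ch (V (x p)))" if "c \<in> ?A" "p \<in> fst c" for c p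
    using x[OF that] dom[OF V(2)[of "x p"]] by simp_all
  have Ap: "has_cderiv (snd (?ch (V (x p))) \<circ> chart_inv c) (A c p (V (x p))) (snd c p)" "bij (A c p (V (x p)))"
    if "c \<in> ?A" "p \<in> fst c" for c p
    by (rule A[OF that V(1) lift(2)[OF that]])+
  \<comment> \<open>A chart of the maximal atlas is arbitrary, but the change to a section chart is holomorphic, and
    in its components the coefficients have the shape handled for the model form.\<close>
  have local: "\<exists>N f1 f2 f3. open N \<and> z \<in> N \<and> N \<subseteq> snd c ` fst c \<and> hol_fun_on N f1 \<and> hol_fun_on N f2 \<and> hol_fun_on
      N f3 \<and>
      (\<forall>y u v. y \<in> N \<longrightarrow> coeff_fun F c u v y = Re (model_term f1 f2 f3 u v y - model_term f1 f2 f3 v u y))"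
    if c: "c \<in> ?A" and z: "z \<in> snd c ` fst c" for c z
  proof -
    obtain p where p: "p \<in> fst c" "z = snd c p" using z by blast
    define U where "U = V (x p)"
    have U: "S.good U" unfolding U_def by (rule V)
    have pU: "p \<in> fst (?ch U)" unfolding U_def by (rule lift(2)[OF c p(1)])
    obtain N where N: "open N" "snd c p \<in> N" "N \<subseteq> snd c ` fst c" "\<And>y. y \<in> N \<Longrightarrow> chart_inv c y \<in> fst (?ch U)"
      using chart_neighbourhood[OF chart[OF c] chart_domain_open[OF S.section_chart_is_chart[OF U]] p(1) pU] by
          blast
    define \<phi> where "\<phi> = snd (?ch U) \<circ> chart_inv c"
    have D: "has_cderiv \<phi> (A c (chart_inv c y) U) y" if y: "y \<in> N" for y
    proof -
      have q: "chart_inv c y \<in> fst c" "snd c (chart_inv c y) = y" using chart_inv_right[OF chart[OF c]] N(3) y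
          by blast+
      show ?thesis using A(1)[OF c q(1) U N(4)[OF y]] unfolding q(2) \<phi>_def .
    qed
    have comp: "dir_deriv u (\<lambda>y. \<phi> y $ j) y = A c (chart_inv c y) U u $ j" "(\<lambda>y. \<phi> y $ j) differentiable (at y)"
        if "y \<in> N" for y u j
    proof -
      have "((\<lambda>y. \<phi> y $ j) has_derivative (\<lambda>u. A c (chart_inv c y) U u $ j)) (at y)"
        using D[OF that] unfolding has_cderiv_def by (intro bounded_linear.has_derivative[OF
            bounded_linear_vec_nth]) simp
      then show "dir_deriv u (\<lambda>y. \<phi> y $ j) y = A c (chart_inv c y) U u $ j"
          "(\<lambda>y. \<phi> y $ j) differentiable (at y)"
        using dir_deriv_eqI by (blast, simp add: differentiableI)
    qed
    have hol: "hol_fun_on N (\<lambda>y. \<phi> y $ j)" for j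
      unfolding hol_fun_on_def using comp D by (simp add: has_cderiv_def)
    have "coeff_fun F c u v y = Re (model_term (\<lambda>y. \<phi> y $ 1) (\<lambda>y. \<phi> y $ 2) (\<lambda>y. \<phi> y $ 3) u v y
        - model_term (\<lambda>y. \<phi> y $ 1) (\<lambda>y. \<phi> y $ 2) (\<lambda>y. \<phi> y $ 3) v u y)" if y: "y \<in> N" for u v y
    proof -
      have q: "chart_inv c y \<in> fst c" using chart_inv_right[OF chart[OF c]] N(3) y by blast
      obtain w where w: "w \<in> U" "chart_inv c y = fib_map 0 w" using N(4)[OF y] by (auto simp: section_chart_def)
      have "\<phi> y = w" unfolding \<phi>_def using S.section_chart_apply[OF U w(1)] w(2) by simp
      then show ?thesis
        unfolding coeff_fun_def F[OF c q U w(1) w(2)[symmetric]] model_term_def comp[OF y] model_form_def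
        by (simp add: algebra_simps) (simp add: field_simps)
    qed
    then show ?thesis using N(1-3) hol p(2)
      by (intro exI[of _ N] exI[of _ "\<lambda>y. \<phi> y $ 1"] exI[of _ "\<lambda>y. \<phi> y $ 2"] exI[of _ "\<lambda>y. \<phi> y $ 3"]) simp
  qed
  have "pseudo_kaehler_structure (X_fib 0) F"
    unfolding pseudo_kaehler_structure_def smooth_two_form_def closed_two_form_def nondegenerate_form_def
        J_invariant_form_def
  proof (intro conjI ballI allI impI)
    show "bilinear (F c p)" if "c \<in> ?A" "p \<in> fst c" for c p
      unfolding F_def[abs_def] using model_form_bilinear[OF has_cderiv_linear[OF Ap(1)[OF that]]] by simp
    show "F c p u u = 0" for c p u unfolding F_def by (rule model_form_alternating)
    show "F c p u v = F d p (coord_change c d p u) (coord_change c d p v)"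
      if cd: "c \<in> ?A" "d \<in> ?A" and p: "p \<in> fst c \<inter> fst d" for c d p u v
    proof -
      have pc: "p \<in> fst c" and pd: "p \<in> fst d" using p by auto
      obtain D where D: "has_cderiv (snd d \<circ> chart_inv c) D (snd c p)"
        using compatible_derivative[OF chart[OF cd(1)] chart[OF cd(2)] compat2[OF cd] pc pd] by blast
      then have e: "coord_change c d p = D"
        unfolding coord_change_def has_cderiv_def
        using frechet_derivative_at[of "snd d \<circ> chart_inv c" D "snd c p"] by simp
      have "has_cderiv (snd (?ch (V (x p))) \<circ> chart_inv c) (A d p (V (x p)) \<circ> D) (snd c p)"
        by (rule transition_chain[OF chart[OF cd(1)] chart[OF cd(2)] pc pd D Ap(1)[OF cd(2) pd]])
      then have "A c p (V (x p)) = A d p (V (x p)) \<circ> D" by (rule has_cderiv_unique[OF Ap(1)[OF cd(1) pc]])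
      then show ?thesis unfolding F_def e by simp
    qed
    show "smooth_on (snd c ` fst c) (coeff_fun F c u v)" if c: "c \<in> ?A" for c u v
      unfolding smooth_on_def
    proof (intro allI Ck_on_local)
      fix k z assume "z \<in> snd c ` fst c"
      from this obtain N f1 f2 f3 where N: "open N" "z \<in> N" "N \<subseteq> snd c ` fst c" "hol_fun_on N f1"
          "hol_fun_on N f2" "hol_fun_on N f3"
        "\<And>y u v. y \<in> N \<Longrightarrow> coeff_fun F c u v y = Re (model_term f1 f2 f3 u v y - model_term f1 f2 f3 v u y)"
        using local[OF c \<open>z \<in> snd c ` fst c\<close>] by (elim exE conjE, simp)
      have "Ck_on k N (coeff_fun F c u v) \<longleftrightarrow> Ck_on k N (\<lambda>y. Re (model_term f1 f2 f3 u v y - model_term f1 f2 f3 v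
          u y))"
        by (rule Ck_on_cong[OF N(1) N(7)])
      then show "\<exists>N. open N \<and> z \<in> N \<and> N \<subseteq> snd c ` fst c \<and> Ck_on k N (coeff_fun F c u v)"
        using model_smooth[OF N(1,4,5,6), of u v] N(1-3) unfolding smooth_on_def by blast
    qed
    show "frechet_derivative (coeff_fun F c v w) (at z) u - frechet_derivative (coeff_fun F c u w) (at z) v
        + frechet_derivative (coeff_fun F c u v) (at z) w = 0"
      if c: "c \<in> ?A" and z: "z \<in> snd c ` fst c" for c z u v w
    proof -
      obtain N f1 f2 f3 where N: "open N" "z \<in> N" "hol_fun_on N f1" "hol_fun_on N f2" "hol_fun_on N f3"
        "\<And>y u v. y \<in> N \<Longrightarrow> coeff_fun F c u v y = Re (model_term f1 f2 f3 u v y - model_term f1 f2 f3 v u y)"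
        using local[OF c z] by (elim exE conjE, simp)
      have "dir_deriv a (coeff_fun F c u v) z = dir_deriv a (\<lambda>y. Re (model_term f1 f2 f3 u v y - model_term f1
          f2 f3 v u y)) z" for a u v
        by (rule dir_deriv_cong[OF N(1,2) N(6)])
      then show ?thesis using model_closed[OF N(1-5), of u v w] unfolding dir_deriv_def by simp
    qed
    show "\<exists>v. F c p u v \<noteq> 0" if c: "c \<in> ?A" "p \<in> fst c" "u \<noteq> 0" for c p u
    proof -
      note l = has_cderiv_linear[OF Ap(1)[OF c(1,2)]] and b = Ap(2)[OF c(1,2)]
      have "A c p (V (x p)) u \<noteq> 0"
        using c(3) linear_0[OF l] bij_is_inj[OF b] by (metis injD)
      then obtain w where "model_form (x p) (A c p (V (x p)) u) w \<noteq> 0" using model_form_nondegenerate by blast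
      moreover obtain v where "w = A c p (V (x p)) v" using bij_is_surj[OF b] by (metis surjD)
      ultimately show ?thesis unfolding F_def by blast
    qed
    show "F c p (\<i> *s u) (\<i> *s v) = F c p u v" if c: "c \<in> ?A" "p \<in> fst c" for c p u v
      using Ap(1)[OF c] unfolding F_def has_cderiv_def by (simp add: model_form_J)
  qed
  then show ?thesis unfolding admits_pseudo_kaehler_def by blast
qed

theorem proposition2p1:
  shows "(\<exists>(X :: (point, 3 + 1) cmfd) \<pi>.
            holomorphic_family X \<pi> \<and>
            (\<forall>t\<in>unit_disc. compact_complex_manifold (fibre X \<pi> t)) \<and>
            admits_pseudo_kaehler (fibre X \<pi> 0) \<and>
            (\<forall>t\<in>unit_disc. t \<noteq> 0 \<longrightarrow> \<not> admits_pseudo_kaehler (fibre X \<pi> t)))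
         \<and> \<not> stable_under_deformations (admits_pseudo_kaehler :: (point, 3) cmfd \<Rightarrow> bool)"
proof
  show "\<exists>(X :: (point, 3 + 1) cmfd) \<pi>.
            holomorphic_family X \<pi> \<and>
            (\<forall>t\<in>unit_disc. compact_complex_manifold (fibre X \<pi> t)) \<and>
            admits_pseudo_kaehler (fibre X \<pi> 0) \<and>
            (\<forall>t\<in>unit_disc. t \<noteq> 0 \<longrightarrow> \<not> admits_pseudo_kaehler (fibre X \<pi> t))"
    using heis_holomorphic_family heis_fibre_compact X_fib_0_pseudo_kaehler X_fib_not_pseudo_kaehler
    by (intro exI[of _ heis_total] exI[of _ base]) simp
  show "\<not> stable_under_deformations (admits_pseudo_kaehler :: (point, 3) cmfd \<Rightarrow> bool)"
  proof
    assume "stable_under_deformations (admits_pseudo_kaehler :: (point, 3) cmfd \<Rightarrow> bool)"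
    then have "\<forall>\<^sub>F t in nhds 0. admits_pseudo_kaehler (X_fib t)"
      unfolding stable_under_deformations_def
      using heis_fibre_compact[of 0] X_fib_0_pseudo_kaehler heis_holomorphic_family by simp
    then obtain e where e: "e > 0" "\<And>t. dist t 0 < e \<Longrightarrow> admits_pseudo_kaehler (X_fib t)"
      unfolding eventually_nhds_metric by blast
    define s :: complex where "s = of_real (min e 1 / 2)"
    have n: "norm s = min e 1 / 2" using e(1) by (simp add: s_def)
    then have "dist s 0 < e" "norm s < 1" "s \<noteq> 0" using e(1) by auto
    then show False using e(2) X_fib_not_pseudo_kaehler by blast
  qed
qed

end
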